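(* For every $\overline{\alpha}=(\alpha_{11},\alpha_{12},\alpha_{21},\alpha_{22})\in\mathbb{R}_+^4$, the generalized degrees of freedom region of the Gaussian interference channel with common information satisfies $\mathbf{D}(\overline{\alpha})=\mathcal{D}(\overline{\alpha})$.
   Context: Gaussian interference channel with common information (IC-CI): $Y_1(t)=h_{11}X_1(t)+h_{12}X_2(t)+Z_1(t)$, $Y_2(t)=h_{21}X_1(t)+h_{22}X_2(t)+Z_2(t)$, with $X_i(t),Y_i(t)\in\mathbb{C}$, noises $Z_i(t)\sim\mathcal{CN}(0,1)$ i.i.d. over time and independent of messages, channel coefficients $H=(h_{11},h_{12},h_{21},h_{22})$ deterministic and known to all terminals. An $(n,R_0,R_1,R_2,P_e^{(n)})$ code: independent messages $\mathcal{M}_0$ (common) and $\mathcal{M}_1,\mathcal{M}_2$ (individual), $\mathcal{M}_k$ uniform on $\{1,\dots,2^{nR_k}\}$; encoders $X_i(t)=f_i(\mathcal{M}_0,\mathcal{M}_i,t,H)$ with $\frac1n\sum_{t=1}^n\mathbb{E}|X_i(t)|^2\le1$; decoders at receiver $i$ output $(\hat M_{0i},\hat M_i)=g_i(Y_i^n,H)$; $P_e^{(n)}$ is the probability that any of $\hat M_1,\hat M_2,\hat M_{01},\hat M_{02}$ is wrong. $(R_0,R_1,R_2)$ is achievable if some sequence of codes has $P_e^{(n)}\to0$; the capacity region $\mathbf{C}(H)$ is the closure of the achievable set. GDoF region: $\mathbf{D}(\overline{\alpha})$ is the set of $(d_0,d_1,d_2)\in\mathbb{R}_+^3$ such that, for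 channels with $|h_{ij}|^2=P^{\alpha_{ij}}$ for all $i,j\in\{1,2\}$ and $P>0$, there are rate triples $(R_0,R_1,R_2)\in\mathbf{C}(H)$ (depending on $P$) with $d_k=\lim_{P\to\infty}R_k/\log_2P$ for $k=0,1,2$. With $(a)^+=\max\{0,a\}$, set ${\sf a_1}=(\alpha_{11}-\alpha_{21})^+$, ${\sf a_2}=(\alpha_{22}-\alpha_{12})^+$, ${\sf d_1}=\alpha_{11}$, ${\sf d_2}=\alpha_{22}$, ${\sf e_1}=\max\{\alpha_{11}-\alpha_{21},\alpha_{12}\}$, ${\sf e_2}=\max\{\alpha_{22}-\alpha_{12},\alpha_{21}\}$, ${\sf g_1}=\max\{\alpha_{11},\alpha_{12}\}$, ${\sf g_2}=\max\{\alpha_{22},\alpha_{21}\}$. $\mathcal{D}(\overline{\alpha})$ is the set of $(d_0,d_1,d_2)$ with $d_0,d_1,d_2\ge0$ and $d_0+d_1\le{\sf g_1}$, $d_0+d_2\le{\sf g_2}$, $d_1\le{\sf d_1}$, $d_2\le{\sf d_2}$, $d_1+d_2\le{\sf e_1}+{\sf e_2}$, $d_0+d_1+d_2\le{\sf a_1}+{\sf g_2}$, $d_0+d_1+d_2\le{\sf a_2}+{\sf g_1}$, $d_0+2d_1+d_2\le{\sf a_1}+{\sf g_1}+{\sf e_2}$, $d_0+d_1+2d_2\le{\sf a_2}+{\sf g_2}+{\sf e_1}$. *)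

theory Defs
  imports "HOL-Probability.Probability"
begin

definition CN01 :: "complex measure" where
  "CN01 = distr (pair_measure (density lborel (normal_density 0 (sqrt (1/2))))
                               (density lborel (normal_density 0 (sqrt (1/2)))))
                borel (\<lambda>(a, b). Complex a b)"

definition noise :: "nat \<Rightarrow> ((nat \<Rightarrow> complex) \<times> (nat \<Rightarrow> complex)) measure" where
  "noise n = pair_measure (PiM {..<n} (\<lambda>_. CN01)) (PiM {..<n} (\<lambda>_. CN01))"

definition msgs :: "nat \<Rightarrow> real \<Rightarrow> nat" where
  "msgs n R = nat \<lceil>2 powr (real n * R)\<rceil>"

definition rx :: "nat \<Rightarrow> complex \<Rightarrow> complex \<Rightarrow> (nat \<Rightarrow> complex) \<Rightarrow> (nat \<Rightarrow> complex)
                   \<Rightarrow> (nat \<Rightarrow> complex) \<Rightarrow> (nat \<Rightarrow> complex)" where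
  "rx n a b x1 x2 z = restrict (\<lambda>t. a * x1 t + b * x2 t + z t) {..<n}"

text \<open>A code: encoders f1 m0 m1 t, f2 m0 m2 t (messages numbered from 1); decoders
  g1, g2 map the received block to (common message estimate, private message estimate).
  Validity: average power constraint (expectation over the uniform messages) and
  measurability of the decoders.\<close>
definition valid_code ::
  "nat \<Rightarrow> nat \<Rightarrow> nat \<Rightarrow> nat \<Rightarrow> (nat \<Rightarrow> nat \<Rightarrow> nat \<Rightarrow> complex) \<Rightarrow> (nat \<Rightarrow> nat \<Rightarrow> nat \<Rightarrow> complex)
   \<Rightarrow> ((nat \<Rightarrow> complex) \<Rightarrow> nat \<times> nat) \<Rightarrow> ((nat \<Rightarrow> complex) \<Rightarrow> nat \<times> nat) \<Rightarrow> bool" where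
  "valid_code n K0 K1 K2 f1 f2 g1 g2 \<longleftrightarrow>
     n > 0 \<and>
     (1 / real n) * (\<Sum>t<n. (1 / (real K0 * real K1)) *
        (\<Sum>m0\<in>{1..K0}. \<Sum>m1\<in>{1..K1}. (cmod (f1 m0 m1 t))\<^sup>2)) \<le> 1 \<and>
     (1 / real n) * (\<Sum>t<n. (1 / (real K0 * real K2)) *
        (\<Sum>m0\<in>{1..K0}. \<Sum>m2\<in>{1..K2}. (cmod (f2 m0 m2 t))\<^sup>2)) \<le> 1 \<and>
     g1 \<in> measurable (PiM {..<n} (\<lambda>_. borel)) (count_space UNIV) \<and>
     g2 \<in> measurable (PiM {..<n} (\<lambda>_. borel)) (count_space UNIV)"

definition err_prob ::
  "complex \<Rightarrow> complex \<Rightarrow> complex \<Rightarrow> complex \<Rightarrow>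
   nat \<Rightarrow> nat \<Rightarrow> nat \<Rightarrow> nat \<Rightarrow> (nat \<Rightarrow> nat \<Rightarrow> nat \<Rightarrow> complex) \<Rightarrow> (nat \<Rightarrow> nat \<Rightarrow> nat \<Rightarrow> complex)
   \<Rightarrow> ((nat \<Rightarrow> complex) \<Rightarrow> nat \<times> nat) \<Rightarrow> ((nat \<Rightarrow> complex) \<Rightarrow> nat \<times> nat) \<Rightarrow> real" where
  "err_prob h11 h12 h21 h22 n K0 K1 K2 f1 f2 g1 g2 =
     (1 / (real K0 * real K1 * real K2)) *
     (\<Sum>m0\<in>{1..K0}. \<Sum>m1\<in>{1..K1}. \<Sum>m2\<in>{1..K2}.
        measure (noise n)
          {zz \<in> space (noise n).
             g1 (rx n h11 h12 (f1 m0 m1) (f2 m0 m2) (fst zz)) \<noteq> (m0, m1) \<or>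
             g2 (rx n h21 h22 (f1 m0 m1) (f2 m0 m2) (snd zz)) \<noteq> (m0, m2)})"

definition achievable :: "complex \<Rightarrow> complex \<Rightarrow> complex \<Rightarrow> complex \<Rightarrow> real \<Rightarrow> real \<Rightarrow> real \<Rightarrow> bool" where
  "achievable h11 h12 h21 h22 R0 R1 R2 \<longleftrightarrow>
     R0 \<ge> 0 \<and> R1 \<ge> 0 \<and> R2 \<ge> 0 \<and>
     (\<exists>(f1 :: nat \<Rightarrow> nat \<Rightarrow> nat \<Rightarrow> nat \<Rightarrow> complex) (f2 :: nat \<Rightarrow> nat \<Rightarrow> nat \<Rightarrow> nat \<Rightarrow> complex)
        (g1 :: nat \<Rightarrow> (nat \<Rightarrow> complex) \<Rightarrow> nat \<times> nat) (g2 :: nat \<Rightarrow> (nat \<Rightarrow> complex) \<Rightarrow> nat \<times> nat).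
        (\<forall>n>0. valid_code n (msgs n R0) (msgs n R1) (msgs n R2) (f1 n) (f2 n) (g1 n) (g2 n)) \<and>
        (\<lambda>n. err_prob h11 h12 h21 h22 n (msgs n R0) (msgs n R1) (msgs n R2)
                 (f1 n) (f2 n) (g1 n) (g2 n)) \<longlonglongrightarrow> 0)"

definition capacity_region :: "complex \<Rightarrow> complex \<Rightarrow> complex \<Rightarrow> complex \<Rightarrow> (real \<times> real \<times> real) set" where
  "capacity_region h11 h12 h21 h22 =
     closure {(R0, R1, R2). achievable h11 h12 h21 h22 R0 R1 R2}"

definition GDoF_region :: "real \<Rightarrow> real \<Rightarrow> real \<Rightarrow> real \<Rightarrow> (real \<times> real \<times> real) set" where
  "GDoF_region a11 a12 a21 a22 =
     {(d0, d1, d2). d0 \<ge> 0 \<and> d1 \<ge> 0 \<and> d2 \<ge> 0 \<and>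
       (\<forall>h11 h12 h21 h22 :: real \<Rightarrow> complex.
          (\<forall>P>0. (cmod (h11 P))\<^sup>2 = P powr a11 \<and> (cmod (h12 P))\<^sup>2 = P powr a12 \<and>
                 (cmod (h21 P))\<^sup>2 = P powr a21 \<and> (cmod (h22 P))\<^sup>2 = P powr a22) \<longrightarrow>
          (\<exists>R0 R1 R2 :: real \<Rightarrow> real.
             (\<forall>P>0. (R0 P, R1 P, R2 P) \<in> capacity_region (h11 P) (h12 P) (h21 P) (h22 P)) \<and>
             ((\<lambda>P. R0 P / log 2 P) \<longlongrightarrow> d0) at_top \<and>
             ((\<lambda>P. R1 P / log 2 P) \<longlongrightarrow> d1) at_top \<and>
             ((\<lambda>P. R2 P / log 2 P) \<longlongrightarrow> d2) at_top))}"

definition pos_part :: "real \<Rightarrow> real" where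
  "pos_part a = max 0 a"

definition GDoF_formula :: "real \<Rightarrow> real \<Rightarrow> real \<Rightarrow> real \<Rightarrow> (real \<times> real \<times> real) set" where
  "GDoF_formula a11 a12 a21 a22 =
     (let A1 = pos_part (a11 - a21); A2 = pos_part (a22 - a12);
          D1 = a11; D2 = a22;
          E1 = max (a11 - a21) a12; E2 = max (a22 - a12) a21;
          G1 = max a11 a12; G2 = max a22 a21
      in {(d0, d1, d2). d0 \<ge> 0 \<and> d1 \<ge> 0 \<and> d2 \<ge> 0 \<and>
            d0 + d1 \<le> G1 \<and> d0 + d2 \<le> G2 \<and> d1 \<le> D1 \<and> d2 \<le> D2 \<and>
            d1 + d2 \<le> E1 + E2 \<and>
            d0 + d1 + d2 \<le> A1 + G2 \<and> d0 + d1 + d2 \<le> A2 + G1 \<and>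
            d0 + 2 * d1 + d2 \<le> A1 + G1 + E2 \<and>
            d0 + d1 + 2 * d2 \<le> A2 + G2 + E1})"

end

theory Submission
  imports Defs "HOL-Real_Asymp.Real_Asymp"
begin

text \<open>
  Achievability is a random coding argument. Each transmitter superposes letters for the common message, for a
  part of its own message that both receivers decode, and for a private part whose power is scaled so that it
  arrives at the other receiver below the noise level. All letters are uniform on a square, and the receivers use
  minimum distance decoding. A wrong tuple of messages differs from the right one in some letter that is
  independent of everything else, and integrating this letter out bounds the expected pairwise error per symbol
  by a constant over the power gain of that letter. The union bound then gives all rates up to a
  constant, which is invisible in the degrees of freedom.

  The converse is the genie argument of Etkin, Tse and Wang, given the common message. Receiver 1 is handed
  $s = h_{21} x_1 + z_2$ (or nothing), and the entropies of $h_{21} x_1 + z_2$ and $h_{12} x_2 + z_1$ given the common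
  message cancel between suitable inequalities for the two receivers. Each inequality is a single Gibbs inequality
  against a test density, which contains the Fano inequality and a Gaussian bound on the
  entropy of $y_1$ given $s$ at once; expectations are taken over messages and noise, so that the terms
  cancel without any change of variables.
\<close>

section \<open>Complex Gaussian noise\<close>

text \<open>Only the growth in \<open>log 2 P\<close> counts, so both halves may lose additive
  constants: square letters replace Gaussian ones, the Chernoff parameter is fixed, and the
  variances of the test densities are crude. Two points allow no such generosity. A layer of rate 0
  must impose no condition at all, because its error bound need not decay when its link is weak;
  hence the case distinctions on the numbers of messages. And the transmitters are correlated
  through the common message, so entropies at the two receivers can be matched only conditionally on
  it; each bound of the converse therefore either decodes the common message or takes it as given.
  The genie signal carries the noise of the other receiver: this noise is independent of the own
  one, and given the common message the signal is distributed exactly like what the other receiver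
  has left after removing its own signal. This makes the entropies cancel. The region asks for rates
  at every \<open>P > 0\<close> and for all phases: below 1 the rates are 0, and the converse picks
  real coefficients.\<close>

lemma measurable_case_Complex [measurable]:
  "(\<lambda>(a, b). Complex a b) \<in> borel \<Otimes>\<^sub>M borel \<rightarrow>\<^sub>M borel"
proof -
  have "(\<lambda>(a, b). Complex a b) = (\<lambda>p. complex_of_real (fst p) + \<i> * complex_of_real (snd p))"
    by (auto simp: complex_eq_iff)
  then show ?thesis by simp
qed

text \<open>The noise is defined through two real coordinates, while all later densities refer to
  Lebesgue measure on the plane. Boxes determine that measure, and the area of a box is the product
  of its sides.\<close>

lemma lborel_complex:
  "(lborel :: complex measure) = distr (lborel \<Otimes>\<^sub>M lborel) borel (\<lambda>(a, b). Complex a b)"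
proof (rule lborel_eqI)
  fix l u :: complex
  assume le: "\<And>b. b \<in> Basis \<Longrightarrow> l \<bullet> b \<le> u \<bullet> b"
  have "Re l \<le> Re u" "Im l \<le> Im u"
    using le[of 1] le[of \<i>] by (auto simp: Basis_complex_def)
  have "(\<lambda>(a, b). Complex a b) -` box l u \<inter> space (lborel \<Otimes>\<^sub>M lborel)
      = {Re l<..<Re u} \<times> {Im l<..<Im u}"
    by (auto simp: box_def Basis_complex_def space_pair_measure)
  then have "emeasure (distr (lborel \<Otimes>\<^sub>M lborel) borel (\<lambda>(a, b). Complex a b)) (box l u)
      = emeasure (lborel \<Otimes>\<^sub>M lborel) ({Re l<..<Re u} \<times> {Im l<..<Im u})"
    by (subst emeasure_distr) auto
  also have "\<dots> = ennreal ((Re u - Re l) * (Im u - Im l))"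
    using \<open>Re l \<le> Re u\<close> \<open>Im l \<le> Im u\<close>
    by (subst lborel.emeasure_pair_measure_Times) (auto simp: ennreal_mult)
  also have "(Re u - Re l) * (Im u - Im l) = (\<Prod>b\<in>Basis. (u - l) \<bullet> b)"
    by (simp add: Basis_complex_def)
  finally show "emeasure (distr (lborel \<Otimes>\<^sub>M lborel) borel (\<lambda>(a, b). Complex a b)) (box l u)
      = (\<Prod>b\<in>Basis. (u - l) \<bullet> b)" .
qed simp

definition cgauss :: "complex \<Rightarrow> real" where
  "cgauss z = exp (- (cmod z)\<^sup>2) / pi"

lemma cgauss_pos: "cgauss z > 0"
  by (simp add: cgauss_def)

lemma cgauss_nonneg [simp]: "cgauss z \<ge> 0"
  by (simp add: cgauss_def)

lemma cgauss_le_1: "cgauss z \<le> 1"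
proof -
  have "exp (- (cmod z)\<^sup>2) \<le> 1" by simp
  also have "1 < pi" using pi_gt3 by simp
  finally show ?thesis by (simp add: cgauss_def divide_le_eq)
qed

lemma measurable_cgauss [measurable]: "cgauss \<in> borel_measurable borel"
  unfolding cgauss_def by measurable

lemma CN01_eq: "CN01 = density lborel cgauss"
proof -
  let ?g = "normal_density 0 (sqrt (1/2))"
  \<comment> \<open>Variance 1/2 in each coordinate gives complex variance 1 and the normalisation
    \<open>1 / pi\<close>.\<close>
  have g: "?g a * ?g b = cgauss (Complex a b)" for a b
    by (simp add: normal_density_def cgauss_def cmod_def power2_eq_square
        real_sqrt_divide flip: exp_add)
  interpret P: prob_space "density lborel ?g"
    by (rule prob_space_normal_density) simp
  have "density lborel ?g \<Otimes>\<^sub>M density lborel ?g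
      = density (lborel \<Otimes>\<^sub>M lborel) (\<lambda>(x, y). ennreal (?g x) * ennreal (?g y))"
    by (rule pair_measure_density) (auto intro: P.sigma_finite_measure_axioms lborel.sigma_finite_measure_axioms)
  also have "\<dots> = density (lborel \<Otimes>\<^sub>M lborel) (\<lambda>p. ennreal (cgauss (case p of (a, b) \<Rightarrow> Complex a b)))"
    by (rule arg_cong2[where f = density])
      (auto simp: fun_eq_iff g simp flip: ennreal_mult split: prod.split)
  finally show ?thesis
    unfolding CN01_def lborel_complex
    by (subst density_distr) auto
qed

lemma sets_CN01 [measurable_cong, simp]: "sets CN01 = sets borel"
  by (simp add: CN01_def)

lemma space_CN01 [simp]: "space CN01 = UNIV"
  by (simp add: CN01_def)

lemma prob_space_CN01: "prob_space CN01"
proof -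
  interpret P: prob_space "density lborel (normal_density 0 (sqrt (1/2)))"
    by (rule prob_space_normal_density) simp
  interpret PP: pair_prob_space "density lborel (normal_density 0 (sqrt (1/2)))"
    "density lborel (normal_density 0 (sqrt (1/2)))" ..
  show ?thesis
    unfolding CN01_def
    by (rule PP.prob_space_distr) (simp cong: measurable_cong_sets)
qed

interpretation CN01: prob_space CN01
  by (rule prob_space_CN01)

section \<open>Translates of the noise and their densities\<close>

lemma nn_integral_lborel_shift:
  fixes x :: "'a::euclidean_space"
  assumes [measurable]: "f \<in> borel_measurable borel"
  shows "(\<integral>\<^sup>+z. f (x + z) \<partial>lborel) = (\<integral>\<^sup>+z. f z \<partial>lborel)"
proof -
  have "(\<integral>\<^sup>+z. f z \<partial>lborel) = (\<integral>\<^sup>+z. f z \<partial>distr lborel borel ((+) x))"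
    by (simp add: lborel_distr_plus)
  also have "\<dots> = (\<integral>\<^sup>+z. f (x + z) \<partial>lborel)"
    by (subst nn_integral_distr) auto
  finally show ?thesis ..
qed

lemma nn_integral_cgauss: "(\<integral>\<^sup>+z. cgauss (z - x) \<partial>lborel) = 1"
proof -
  have "(\<integral>\<^sup>+z. cgauss z \<partial>lborel) = emeasure CN01 UNIV"
    unfolding CN01_eq by (subst emeasure_density) auto
  also have "\<dots> = 1"
    using CN01.emeasure_space_1 by simp
  finally show ?thesis
    using nn_integral_lborel_shift[of "\<lambda>z. ennreal (cgauss z)" "-x"] by simp
qed

lemma distr_CN01_shift:
  "distr CN01 borel (\<lambda>z. x + z) = density lborel (\<lambda>y. ennreal (cgauss (y - x)))"
proof (rule measure_eqI)
  fix B assume "B \<in> sets (distr CN01 borel (\<lambda>z. x + z))"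
  then have [measurable]: "B \<in> sets borel" by simp
  have "emeasure (distr CN01 borel (\<lambda>z. x + z)) B
      = (\<integral>\<^sup>+z. indicator B z \<partial>distr CN01 borel (\<lambda>z. x + z))"
    by simp
  also have "\<dots> = (\<integral>\<^sup>+z. ennreal (cgauss z) * indicator B (x + z) \<partial>lborel)"
    unfolding CN01_eq by (subst nn_integral_distr) (auto intro!: nn_integral_cong simp: nn_integral_density indicator_def)
  also have "\<dots> = (\<integral>\<^sup>+z. (\<lambda>y. ennreal (cgauss (y - x)) * indicator B y) (x + z) \<partial>lborel)"
    by simp
  also have "\<dots> = (\<integral>\<^sup>+y. ennreal (cgauss (y - x)) * indicator B y \<partial>lborel)"
    by (rule nn_integral_lborel_shift) simp
  finally show "emeasure (distr CN01 borel (\<lambda>z. x + z)) B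
      = emeasure (density lborel (\<lambda>y. ennreal (cgauss (y - x)))) B"
    by (simp add: emeasure_density)
qed simp

text \<open>Completing the square turns the integrand into a Gaussian about \<open>d / 2\<close>.
  This moment generating function serves twice: in the Chernoff bound of the decoder and in the
  bound on the noise power.\<close>

lemma nn_integral_CN01_exp:
  "(\<integral>\<^sup>+z. exp (Re (cnj d * z)) \<partial>CN01) = ennreal (exp ((cmod d)\<^sup>2 / 4))"
proof -
  have "- (cmod z)\<^sup>2 + Re (cnj d * z) = (cmod d)\<^sup>2 / 4 + - (cmod (z - d / 2))\<^sup>2" for z
    unfolding cmod_power2 by (simp add: power2_eq_square field_simps)
  then have eq: "cgauss z * exp (Re (cnj d * z)) = exp ((cmod d)\<^sup>2 / 4) * cgauss (z - d / 2)" for z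
    by (simp add: cgauss_def flip: exp_add)
  have "(\<integral>\<^sup>+z. exp (Re (cnj d * z)) \<partial>CN01)
      = (\<integral>\<^sup>+z. ennreal (exp ((cmod d)\<^sup>2 / 4)) * ennreal (cgauss (z - d / 2)) \<partial>lborel)"
    unfolding CN01_eq by (subst nn_integral_density) (auto intro!: nn_integral_cong simp del: times_complex.sel simp: eq simp flip: ennreal_mult)
  then show ?thesis
    by (simp add: nn_integral_cmult nn_integral_cgauss)
qed

text \<open>Boxes determine a product measure, and on a box the integral of the product density
  factors.\<close>

lemma density_PiM:
  assumes "finite I" "\<And>i. sigma_finite_measure (N i)"
    and g [measurable]: "\<And>i. g i \<in> borel_measurable (N i)"
    and "\<And>i. sigma_finite_measure (density (N i) (g i))"
  shows "density (PiM I N) (\<lambda>y. \<Prod>i\<in>I. g i (y i)) = PiM I (\<lambda>i. density (N i) (g i))"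
proof -
  interpret N: product_sigma_finite N
    using assms by (simp add: product_sigma_finite_def)
  interpret D: product_sigma_finite "\<lambda>i. density (N i) (g i)"
    using assms by (simp add: product_sigma_finite_def)
  show ?thesis
  proof (rule D.PiM_eqI)
    show "sets (density (Pi\<^sub>M I N) (\<lambda>y. \<Prod>i\<in>I. g i (y i))) = sets (Pi\<^sub>M I (\<lambda>i. density (N i) (g i)))"
      by (auto intro!: sets_PiM_cong)
    fix A assume A: "\<And>i. i \<in> I \<Longrightarrow> A i \<in> sets (density (N i) (g i))"
    have [measurable]: "i \<in> I \<Longrightarrow> A i \<in> sets (N i)" for i using A by simp
    have "emeasure (density (PiM I N) (\<lambda>y. \<Prod>i\<in>I. g i (y i))) (PiE I A)
        = (\<integral>\<^sup>+y. (\<Prod>i\<in>I. g i (y i)) * indicator (PiE I A) y \<partial>PiM I N)"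
      by (subst emeasure_density) (auto intro!: sets_PiM_I_finite assms)
    also have "\<dots> = (\<integral>\<^sup>+y. (\<Prod>i\<in>I. g i (y i) * indicator (A i) (y i)) \<partial>PiM I N)"
    proof (rule nn_integral_cong)
      fix y assume "y \<in> space (PiM I N)"
      then have "y \<in> extensional I" by (auto simp: space_PiM PiE_def)
      then have "indicator (PiE I A) y = (\<Prod>i\<in>I. indicator (A i) (y i) :: ennreal)"
        using \<open>finite I\<close> by (auto simp: indicator_def PiE_def Pi_def prod_zero_iff)
      then show "(\<Prod>i\<in>I. g i (y i)) * indicator (PiE I A) y = (\<Prod>i\<in>I. g i (y i) * indicator (A i) (y i))"
        by (simp add: prod.distrib)
    qed
    also have "\<dots> = (\<Prod>i\<in>I. \<integral>\<^sup>+y. g i y * indicator (A i) y \<partial>N i)"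
      by (rule N.product_nn_integral_prod) (auto intro!: assms)
    also have "\<dots> = (\<Prod>i\<in>I. emeasure (density (N i) (g i)) (A i))"
      by (rule prod.cong) (auto simp: emeasure_density)
    finally show "emeasure (density (PiM I N) (\<lambda>y. \<Prod>i\<in>I. g i (y i))) (PiE I A)
       = (\<Prod>i\<in>I. emeasure (density (N i) (g i)) (A i))" .
  qed fact
qed

text \<open>The passage from noise to likelihood: when \<open>x\<close> is sent, the received block
  has this density, and the mixtures in the converse are averages of such densities.\<close>

lemma distr_PiM_shift:
  fixes x :: "'i \<Rightarrow> complex"
  assumes "finite I"
  shows "distr (PiM I (\<lambda>_. CN01)) (PiM I (\<lambda>_. borel)) (\<lambda>z. restrict (\<lambda>t. x t + z t) I)
    = density (PiM I (\<lambda>_. lborel)) (\<lambda>y. \<Prod>t\<in>I. ennreal (cgauss (y t - x t)))"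
proof -
  let ?d = "distr (PiM I (\<lambda>_. CN01)) (PiM I (\<lambda>_. borel)) (\<lambda>z. restrict (\<lambda>t. x t + z t) I)"
  let ?D = "\<lambda>t. density lborel (\<lambda>y. ennreal (cgauss (y - x t)))"
  have pD: "prob_space (?D t)" for t
    unfolding distr_CN01_shift[symmetric] by (rule CN01.prob_space_distr) simp
  then have sD: "sigma_finite_measure (?D t)" for t
    using prob_space_imp_sigma_finite by blast
  interpret D: product_sigma_finite ?D
    using sD by (simp add: product_sigma_finite_def)
  interpret C: product_sigma_finite "\<lambda>_. CN01"
    by (simp add: product_sigma_finite_def CN01.sigma_finite_measure_axioms)
  have "?d = PiM I ?D"
  proof (rule D.PiM_eqI)
    show "sets ?d
      = sets (PiM I ?D)"
      by (auto intro!: sets_PiM_cong)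
    fix A assume A: "\<And>t. t \<in> I \<Longrightarrow> A t \<in> sets (?D t)"
    have [measurable]: "t \<in> I \<Longrightarrow> A t \<in> sets borel" for t using A by simp
    have AA: "PiE I A \<in> sets (PiM I (\<lambda>_. borel))"
      using A assms by (intro sets_PiM_I_finite) auto
    have "emeasure ?d (PiE I A)
       = emeasure (PiM I (\<lambda>_. CN01)) ((\<lambda>z. restrict (\<lambda>t. x t + z t) I) -` PiE I A \<inter> space (PiM I (\<lambda>_. CN01)))"
      by (rule emeasure_distr[OF _ AA]) simp
    also have "(\<lambda>z. restrict (\<lambda>t. x t + z t) I) -` PiE I A \<inter> space (PiM I (\<lambda>_. CN01))
       = PiE I (\<lambda>t. (\<lambda>z. x t + z) -` A t)"
      by (auto simp: space_PiM PiE_def Pi_def)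
    also have "emeasure (PiM I (\<lambda>_. CN01)) \<dots> = (\<Prod>t\<in>I. emeasure CN01 ((\<lambda>z. x t + z) -` A t))"
    proof (rule C.emeasure_PiM[OF assms])
      fix t assume t: "t \<in> I"
      have "(\<lambda>z. x t + z) \<in> borel \<rightarrow>\<^sub>M borel" by simp
      then show "(\<lambda>z. x t + z) -` A t \<in> sets CN01"
        using measurable_sets[of "(+) (x t)" borel borel "A t"] A[OF t] by simp
    qed
    also have "\<dots> = (\<Prod>t\<in>I. emeasure (distr CN01 borel (\<lambda>z. x t + z)) (A t))"
      using A by (intro prod.cong) (auto simp: emeasure_distr)
    finally show "emeasure ?d (PiE I A)
       = (\<Prod>t\<in>I. emeasure (?D t) (A t))"
      unfolding distr_CN01_shift .
  qed fact
  also have "\<dots> = density (PiM I (\<lambda>_. lborel)) (\<lambda>y. \<Prod>t\<in>I. ennreal (cgauss (y t - x t)))"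
    by (rule density_PiM[symmetric]) (auto intro: assms sD lborel.sigma_finite_measure_axioms)
  finally show ?thesis .
qed

abbreviation blocks :: "nat \<Rightarrow> (nat \<Rightarrow> complex) measure" where
  "blocks n \<equiv> PiM {..<n} (\<lambda>_. borel)"

abbreviation lebesgue_blocks :: "nat \<Rightarrow> (nat \<Rightarrow> complex) measure" where
  "lebesgue_blocks n \<equiv> PiM {..<n} (\<lambda>_. lborel)"

abbreviation add_noise :: "nat \<Rightarrow> (nat \<Rightarrow> complex) \<Rightarrow> (nat \<Rightarrow> complex) \<Rightarrow> nat \<Rightarrow> complex" where
  "add_noise n x z \<equiv> restrict (\<lambda>t. x t + z t) {..<n}"

section \<open>Minimum distance decoding\<close>

definition noise1 :: "nat \<Rightarrow> (nat \<Rightarrow> complex) measure" where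
  "noise1 n = PiM {..<n} (\<lambda>_. CN01)"

lemma noise_eq: "noise n = noise1 n \<Otimes>\<^sub>M noise1 n"
  by (simp add: noise_def noise1_def)

lemma sets_noise1 [measurable_cong, simp]: "sets (noise1 n) = sets (blocks n)"
  unfolding noise1_def by (rule sets_PiM_cong) auto

lemma prob_space_noise1: "prob_space (noise1 n)"
  unfolding noise1_def by (rule prob_space_PiM) (rule prob_space_CN01)

interpretation noise1: prob_space "noise1 n" for n
  by (rule prob_space_noise1)

interpretation noise_pair: pair_prob_space "noise1 n" "noise1 n" for n ..

interpretation CN01_product: product_sigma_finite "\<lambda>_. CN01"
  by (simp add: product_sigma_finite_def CN01.sigma_finite_measure_axioms)

text \<open>The Chernoff factor contributed by one letter: the parameter is fixed at $1/2$ and the untreated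
  interference only enters through its bound $1$, which costs the linear term.\<close>

definition pair_err :: "complex \<Rightarrow> real" where
  "pair_err d = exp (cmod d - (cmod d)\<^sup>2 / 4)"

lemma measurable_pair_err [measurable]: "pair_err \<in> borel_measurable borel"
  unfolding pair_err_def by measurable

lemma pair_err_nonneg [simp]: "pair_err d \<ge> 0"
  by (simp add: pair_err_def)

lemma cmod_add_power2: "(cmod (w + d))\<^sup>2 = (cmod w)\<^sup>2 + 2 * Re (cnj d * w) + (cmod d)\<^sup>2"
  unfolding cmod_power2 by (simp add: power2_eq_square algebra_simps)

text \<open>The indicator of a nonnegative quantity is at most its exponential. After the
  interference \<open>i\<close>, which may be any fixed sequence in the unit disk, has been
  estimated away, the exponent is linear in the noise, so the expectation factors over time into
  moment generating functions.\<close>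

lemma pairwise_error:
  assumes i: "\<And>t. t < n \<Longrightarrow> cmod (i t) \<le> 1"
  shows "emeasure (noise1 n) {z \<in> space (noise1 n).
      (\<Sum>t<n. (cmod (i t + z t + d t))\<^sup>2) \<le> (\<Sum>t<n. (cmod (i t + z t))\<^sup>2)}
    \<le> ennreal (\<Prod>t<n. pair_err (d t))"
proof -
  let ?c = "\<lambda>t. exp (cmod (d t) - (cmod (d t))\<^sup>2 / 2)"
  have pt: "indicator {z \<in> space (noise1 n).
      (\<Sum>t<n. (cmod (i t + z t + d t))\<^sup>2) \<le> (\<Sum>t<n. (cmod (i t + z t))\<^sup>2)} z
    \<le> (\<Prod>t<n. ennreal (?c t) * ennreal (exp (Re (cnj (- d t) * z t))))" (is "indicator ?A z \<le> _") for z
  proof (cases "z \<in> ?A")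
    case True
    have le: "(\<Sum>t<n. (cmod (i t + z t + d t))\<^sup>2) \<le> (\<Sum>t<n. (cmod (i t + z t))\<^sup>2)"
      using CollectD[OF True] by blast
    have "0 \<le> (\<Sum>t<n. (cmod (i t + z t))\<^sup>2 - (cmod (i t + z t + d t))\<^sup>2) / 2"
      using le unfolding sum_subtractf by (intro divide_nonneg_pos) simp_all
    also have "\<dots> = (\<Sum>t<n. ((cmod (i t + z t))\<^sup>2 - (cmod (i t + z t + d t))\<^sup>2) / 2)"
      by (rule sum_divide_distrib)
    also have "\<dots> \<le> (\<Sum>t<n. cmod (d t) - (cmod (d t))\<^sup>2 / 2 + Re (cnj (- d t) * z t))"
    proof (rule sum_mono)
      fix t assume "t \<in> {..<n}"
      have "Re (cnj (d t) * i t) \<ge> - cmod (cnj (d t) * i t)"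
        using abs_Re_le_cmod[of "cnj (d t) * i t"] by linarith
      moreover have "cmod (cnj (d t) * i t) \<le> cmod (d t)"
        using i[of t] \<open>t \<in> _\<close> by (simp add: norm_mult mult_left_le)
      moreover have "((cmod (i t + z t))\<^sup>2 - (cmod (i t + z t + d t))\<^sup>2) / 2
        = - Re (cnj (d t) * i t) - (cmod (d t))\<^sup>2 / 2 + Re (cnj (- d t) * z t)"
      proof -
        have "Re (cnj (d t) * (i t + z t)) = Re (cnj (d t) * i t) + Re (cnj (d t) * z t)"
          by (simp add: distrib_left)
        moreover have "Re (cnj (- d t) * z t) = - Re (cnj (d t) * z t)"
          by simp
        ultimately show ?thesis
          unfolding cmod_add_power2[of "i t + z t"] by argo
      qed
      ultimately show "((cmod (i t + z t))\<^sup>2 - (cmod (i t + z t + d t))\<^sup>2) / 2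
        \<le> cmod (d t) - (cmod (d t))\<^sup>2 / 2 + Re (cnj (- d t) * z t)"
        by linarith
    qed
    finally have "1 \<le> exp (\<Sum>t<n. cmod (d t) - (cmod (d t))\<^sup>2 / 2 + Re (cnj (- d t) * z t))"
      by simp
    also have "\<dots> = (\<Prod>t<n. ?c t * exp (Re (cnj (- d t) * z t)))"
      by (simp only: exp_sum[OF finite_lessThan] exp_add)
    finally have "1 \<le> ennreal (\<Prod>t<n. ?c t * exp (Re (cnj (- d t) * z t)))"
by (subst ennreal_1[symmetric], rule ennreal_leI)
    also have "\<dots> = (\<Prod>t<n. ennreal (?c t * exp (Re (cnj (- d t) * z t))))"
      by (rule prod_ennreal[symmetric]) simp
    also have "\<dots> = (\<Prod>t<n. ennreal (?c t) * ennreal (exp (Re (cnj (- d t) * z t))))"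
      by (rule prod.cong[OF refl], rule ennreal_mult) auto
    finally show ?thesis
      unfolding indicator_simps(1)[OF True] .
  next
    case False
    show ?thesis unfolding indicator_simps(2)[OF False] by (rule zero_le)
  qed
  have A: "?A \<in> sets (noise1 n)"
    by measurable
  have "emeasure (noise1 n) ?A = (\<integral>\<^sup>+z. indicator ?A z \<partial>noise1 n)"
    by (rule nn_integral_indicator[OF A, symmetric])
  also have "\<dots> \<le> (\<integral>\<^sup>+z. (\<Prod>t<n. ennreal (?c t) * ennreal (exp (Re (cnj (- d t) * z t)))) \<partial>noise1 n)"
    by (intro nn_integral_mono pt)
  also have "\<dots> = (\<Prod>t<n. \<integral>\<^sup>+z. ennreal (?c t) * ennreal (exp (Re (cnj (- d t) * z))) \<partial>CN01)"
    unfolding noise1_def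
    by (rule CN01_product.product_nn_integral_prod
        [where f = "\<lambda>t z. ennreal (?c t) * ennreal (exp (Re (cnj (- d t) * z)))"]) simp_all
  also have "\<dots> = (\<Prod>t<n. ennreal (?c t) * ennreal (exp ((cmod (d t))\<^sup>2 / 4)))"
  proof (rule prod.cong[OF refl])
    fix t
    show "(\<integral>\<^sup>+z. ennreal (?c t) * ennreal (exp (Re (cnj (- d t) * z))) \<partial>CN01)
        = ennreal (?c t) * ennreal (exp ((cmod (d t))\<^sup>2 / 4))"
      using nn_integral_CN01_exp[of "- d t"]
      by (subst nn_integral_cmult) (simp_all only: norm_minus_cancel, simp_all)
  qed
  also have "\<dots> = (\<Prod>t<n. ennreal (pair_err (d t)))"
  proof (rule prod.cong[OF refl])
    fix t
    have "?c t * exp ((cmod (d t))\<^sup>2 / 4) = pair_err (d t)"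
      unfolding pair_err_def exp_add[symmetric] by simp
    then show "ennreal (?c t) * ennreal (exp ((cmod (d t))\<^sup>2 / 4)) = ennreal (pair_err (d t))"
      by (metis ennreal_mult exp_ge_zero)
  qed
  finally show ?thesis
    unfolding prod_ennreal[OF pair_err_nonneg] .
qed

text \<open>Ties are broken by the position in a fixed enumeration of \<open>W\<close>; the decoder
  is then a \<open>LEAST\<close> of measurable predicates and hence measurable. The map
  \<open>l\<close> forgets the part of a candidate that is not asked for, here the public part of
  the interfering user.\<close>

lemma min_distance_decoder:
  fixes s :: "'w \<Rightarrow> nat \<Rightarrow> complex" and l :: "'w \<Rightarrow> 'b"
  assumes "finite W" "W \<noteq> {}"
  obtains g where "g \<in> blocks n \<rightarrow>\<^sub>M count_space UNIV"
    "\<And>y. \<exists>w\<in>W. g y = l w \<and>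
      (\<forall>w'\<in>W. (\<Sum>t<n. (cmod (y t - s w t))\<^sup>2) \<le> (\<Sum>t<n. (cmod (y t - s w' t))\<^sup>2))"
proof -
  obtain xs where xs: "set xs = W" using finite_list[OF \<open>finite W\<close>] by auto
  define dst where "dst w y = (\<Sum>t<n. (cmod (y t - s w t))\<^sup>2)" for w y
  define Q where "Q k y \<longleftrightarrow> k < length xs \<and> (\<forall>w'\<in>W. dst (xs ! k) y \<le> dst w' y)" for k y
  define g where "g y = l (xs ! (LEAST k. Q k y))" for y
  have dst_meas: "dst w \<in> borel_measurable (blocks n)" for w
    unfolding dst_def by measurable
  have le: "Measurable.pred (blocks n) (\<lambda>y. dst w y \<le> dst w' y)" for w w'
    unfolding pred_def by (rule borel_measurable_le) (simp_all add: dst_meas)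
  have "(\<lambda>y. Q k y) \<in> blocks n \<rightarrow>\<^sub>M count_space UNIV" for k
    unfolding Q_def
    by (intro pred_intros_logic pred_intros_finite \<open>finite W\<close> le) simp
  then have "(\<lambda>y. LEAST k. Q k y) \<in> blocks n \<rightarrow>\<^sub>M count_space UNIV"
    by (rule measurable_Least)
  then have "g \<in> blocks n \<rightarrow>\<^sub>M count_space UNIV"
    unfolding g_def by (rule measurable_compose) simp
  moreover have "\<exists>w\<in>W. g y = l w \<and> (\<forall>w'\<in>W. dst w y \<le> dst w' y)" for y
  proof -
    obtain w where "is_arg_min (\<lambda>w. dst w y) (\<lambda>w. w \<in> W) w"
      using ex_is_arg_min_if_finite[OF assms] by blast
    then have w: "w \<in> set xs" "\<forall>w'\<in>W. dst w y \<le> dst w' y"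
      using xs by (auto simp: is_arg_min_linorder)
    then obtain k where "k < length xs" "xs ! k = w"
      by (auto simp: in_set_conv_nth)
    then have "Q k y" using w by (auto simp: Q_def)
    then have "Q (LEAST k. Q k y) y" by (rule LeastI)
    then show ?thesis
      unfolding Q_def g_def using xs by auto
  qed
  ultimately show thesis
    using that unfolding dst_def by blast
qed

text \<open>Union bound over the competitors with another label. A nearer candidate with the same
  label is harmless.\<close>

lemma decoder_error:
  fixes s :: "'w \<Rightarrow> nat \<Rightarrow> complex" and l :: "'w \<Rightarrow> 'b"
  assumes "finite W" "w \<in> W"
    and g: "\<And>y. \<exists>w\<in>W. g y = l w \<and>
      (\<forall>w'\<in>W. (\<Sum>t<n. (cmod (y t - s w t))\<^sup>2) \<le> (\<Sum>t<n. (cmod (y t - s w' t))\<^sup>2))"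
    and i: "\<And>t. t < n \<Longrightarrow> cmod (i t) \<le> 1"
    and y: "\<And>z t. t < n \<Longrightarrow> y z t = s w t + i t + z t"
  shows "\<P>(z in noise1 n. g (y z) \<noteq> l w)
    \<le> (\<Sum>w'\<in>{w'\<in>W. l w' \<noteq> l w}. \<Prod>t<n. pair_err (s w t - s w' t))"
proof -
  define E where "E w' = {z \<in> space (noise1 n).
      (\<Sum>t<n. (cmod (i t + z t + (s w t - s w' t)))\<^sup>2) \<le> (\<Sum>t<n. (cmod (i t + z t))\<^sup>2)}" for w'
  have E: "E w' \<in> noise1.events n" for w'
    unfolding E_def by measurable
  have "\<P>(z in noise1 n. g (y z) \<noteq> l w)
      \<le> measure (noise1 n) (\<Union>w'\<in>{w'\<in>W. l w' \<noteq> l w}. E w')"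
  proof (rule noise1.finite_measure_mono)
    show "{z \<in> space (noise1 n). g (y z) \<noteq> l w} \<subseteq> (\<Union>w'\<in>{w'\<in>W. l w' \<noteq> l w}. E w')"
    proof safe
      fix z assume z: "z \<in> space (noise1 n)" and ne: "g (y z) \<noteq> l w"
      obtain w' where w': "w' \<in> W" "g (y z) = l w'"
        and le: "(\<Sum>t<n. (cmod (y z t - s w' t))\<^sup>2) \<le> (\<Sum>t<n. (cmod (y z t - s w t))\<^sup>2)"
        using g[of "y z"] \<open>w \<in> W\<close> by blast
      have eq1: "(\<Sum>t<n. (cmod (i t + z t + (s w t - s w' t)))\<^sup>2) = (\<Sum>t<n. (cmod (y z t - s w' t))\<^sup>2)"
        by (rule sum.cong) (auto simp: y algebra_simps)
      have eq2: "(\<Sum>t<n. (cmod (i t + z t))\<^sup>2) = (\<Sum>t<n. (cmod (y z t - s w t))\<^sup>2)"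
        by (rule sum.cong) (auto simp: y algebra_simps)
      have "z \<in> E w'"
        unfolding E_def mem_Collect_eq eq1 eq2 using z le by (rule conjI)
      moreover have "w' \<in> {w' \<in> W. l w' \<noteq> l w}"
        using w' ne by simp
      ultimately show "z \<in> (\<Union>w'\<in>{w'\<in>W. l w' \<noteq> l w}. E w')"
        by blast
    qed
    show "(\<Union>w'\<in>{w'\<in>W. l w' \<noteq> l w}. E w') \<in> noise1.events n"
      using \<open>finite W\<close> by (intro sets.finite_UN E) simp
  qed
  also have "\<dots> \<le> (\<Sum>w'\<in>{w'\<in>W. l w' \<noteq> l w}. measure (noise1 n) (E w'))"
    using \<open>finite W\<close> by (intro noise1.finite_measure_subadditive_finite image_subsetI E) simp
  also have "\<dots> \<le> (\<Sum>w'\<in>{w'\<in>W. l w' \<noteq> l w}. \<Prod>t<n. pair_err (s w t - s w' t))"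
  proof (rule sum_mono)
    fix w'
    show "measure (noise1 n) (E w') \<le> (\<Prod>t<n. pair_err (s w t - s w' t))"
      using pairwise_error[of n i "\<lambda>t. s w t - s w' t", OF i]
      unfolding noise1.emeasure_eq_measure E_def[symmetric] by (simp add: prod_nonneg)
  qed
  finally show ?thesis .
qed

section \<open>Random letters\<close>

text \<open>Letters are drawn from a square inside the unit disk, so clipping changes them on a null set only; it
  makes the power constraint hold for every codebook and not just almost surely.\<close>

definition clip :: "complex \<Rightarrow> complex" where
  "clip z = (if cmod z \<le> 1 then z else 0)"

lemma cmod_clip: "cmod (clip z) \<le> 1"
  by (simp add: clip_def)

lemma measurable_clip [measurable]: "clip \<in> borel_measurable borel"
  unfolding clip_def by measurable

definition letter :: "complex measure" where
  "letter = uniform_measure lborel (cbox 0 (Complex (1/2) (1/2)))"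

lemma emeasure_letter_box: "emeasure lborel (cbox 0 (Complex (1/2) (1/2))) = ennreal (1/4)"
  by (subst emeasure_lborel_cbox) (auto simp: Basis_complex_def)

lemma prob_space_letter: "prob_space letter"
  unfolding letter_def by (rule prob_space_uniform_measure) (auto simp: emeasure_letter_box)

lemma sets_letter [measurable_cong, simp]: "sets letter = sets borel"
  by (simp add: letter_def)

interpretation letter: prob_space letter
  by (rule prob_space_letter)

interpretation letter_product: product_sigma_finite "\<lambda>_. letter"
  by (simp add: product_sigma_finite_def letter.sigma_finite_measure_axioms)

text \<open>The exponent 2 is the real dimension of the plane. It is the reason why the error per
  symbol is inverse to the power gain \<open>(cmod a)\<^sup>2\<close> and thus matches one full
  degree of freedom.\<close>

lemma nn_integral_cgauss_scaleR:
  assumes "r > 0"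
  shows "(\<integral>\<^sup>+u. cgauss (r *\<^sub>R (c + u)) \<partial>lborel) = ennreal (1 / r\<^sup>2)"
proof -
  have "1 = (\<integral>\<^sup>+z. ennreal (cgauss z) \<partial>lborel)"
    using nn_integral_cgauss[of 0] by simp
  also have "\<dots> = (\<integral>\<^sup>+z. ennreal (cgauss z) \<partial>density (distr lborel borel (\<lambda>x::complex. 0 + r *\<^sub>R x)) (\<lambda>_. ennreal (\<bar>r\<bar> ^ DIM(complex))))"
    by (subst lborel_affine[of r 0]) (use assms in auto)
  also have "\<dots> = ennreal (r\<^sup>2) * (\<integral>\<^sup>+u. cgauss (r *\<^sub>R u) \<partial>lborel)"
    using assms by (simp add: nn_integral_density nn_integral_distr nn_integral_cmult)
  finally have one: "ennreal (r\<^sup>2) * (\<integral>\<^sup>+u. cgauss (r *\<^sub>R u) \<partial>lborel) = 1" ..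
  have "ennreal (1 / r\<^sup>2) = ennreal (1 / r\<^sup>2) * (ennreal (r\<^sup>2) * (\<integral>\<^sup>+u. cgauss (r *\<^sub>R u) \<partial>lborel))"
    unfolding one by simp
  also have "\<dots> = (\<integral>\<^sup>+u. cgauss (r *\<^sub>R u) \<partial>lborel)"
    using assms by (simp add: mult.assoc[symmetric] flip: ennreal_mult)
  finally show ?thesis
    using nn_integral_lborel_shift[of "\<lambda>u. ennreal (cgauss (r *\<^sub>R u))" c] by simp
qed

lemma pair_err_le: "pair_err v \<le> exp 2 * exp (- (cmod v)\<^sup>2 / 8)"
proof -
  \<comment> \<open>One eighth of this square absorbs the linear term; the price is the constant 2
    and half of the Gaussian exponent.\<close>
  have "0 \<le> (cmod v - 4)\<^sup>2" by simp
  then have "cmod v - (cmod v)\<^sup>2 / 4 \<le> 2 + - (cmod v)\<^sup>2 / 8"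
    by (simp add: power2_eq_square algebra_simps)
  then show ?thesis
    unfolding pair_err_def exp_add[symmetric] by simp
qed

text \<open>The factors are 4 for the density of a letter on a square of area 1/4, 8 from the
  exponent in \<open>pair_err_le\<close>, \<open>pi\<close> for the normalisation of
  \<open>cgauss\<close>, and \<open>exp 2\<close> from \<open>pair_err_le\<close>.\<close>

definition letter_const :: real where
  "letter_const = 32 * pi * exp 2"

lemma letter_const_pos: "letter_const > 0"
  by (simp add: letter_const_def)

text \<open>The letter has a bounded density, so the integral may be extended to the whole plane,
  where the shift \<open>b\<close> disappears by translation invariance.\<close>

lemma nn_integral_pair_err_letter:
  assumes "a \<noteq> 0"
  shows "(\<integral>\<^sup>+u. pair_err (a * clip u + b) \<partial>letter) \<le> ennreal (letter_const / (cmod a)\<^sup>2)"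
proof -
  let ?B = "cbox 0 (Complex (1/2) (1/2))"
  let ?r = "cmod a / sqrt 8"
  have r: "?r > 0" using assms by simp
  have clip: "clip u = u" if "u \<in> ?B" for u
  proof -
    have "0 \<le> Re u" "Re u \<le> 1/2" "0 \<le> Im u" "Im u \<le> 1/2"
      using that by (auto simp: cbox_def Basis_complex_def)
    then have "cmod u \<le> 1/2 + 1/2"
      using cmod_le[of u] by linarith
    then show ?thesis by (simp add: clip_def)
  qed
  have le: "pair_err (a * u + b) \<le> (exp 2 * pi) * cgauss (?r *\<^sub>R (b / a + u))" for u
  proof -
    have "a * u + b = a * (b / a + u)"
      using assms by (simp add: field_simps)
    then have "(cmod (a * u + b))\<^sup>2 / 8 = (cmod (?r *\<^sub>R (b / a + u)))\<^sup>2"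
      by (simp add: norm_mult power_mult_distrib power_divide)
    then show ?thesis
      using pair_err_le[of "a * u + b"] by (simp add: cgauss_def)
  qed
  have "(\<integral>\<^sup>+u. pair_err (a * clip u + b) \<partial>letter)
      = (\<integral>\<^sup>+u. ennreal (pair_err (a * clip u + b)) * indicator ?B u \<partial>lborel) / ennreal (1/4)"
    unfolding letter_def by (subst nn_integral_uniform_measure) (auto simp: emeasure_letter_box)
  also have "\<dots> \<le> (\<integral>\<^sup>+u. ennreal (exp 2 * pi) * ennreal (cgauss (?r *\<^sub>R (b / a + u))) \<partial>lborel) / ennreal (1/4)"
  proof (intro divide_right_mono_ennreal nn_integral_mono)
    fix u
    show "ennreal (pair_err (a * clip u + b)) * indicator ?B u
        \<le> ennreal (exp 2 * pi) * ennreal (cgauss (?r *\<^sub>R (b / a + u)))"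
      using le[of u] clip[of u]
      by (auto simp: indicator_def simp flip: ennreal_mult intro!: ennreal_leI)
  qed
  also have "\<dots> = ennreal (exp 2 * pi) * ennreal (1 / ?r\<^sup>2) / ennreal (1/4)"
    using nn_integral_cgauss_scaleR[OF r, of "b / a"] by (simp add: nn_integral_cmult)
  also have "\<dots> = ennreal (letter_const / (cmod a)\<^sup>2)"
    using assms
    by (subst ennreal_mult[symmetric], simp, simp, subst divide_ennreal)
      (auto simp: letter_const_def power_divide field_simps)
  finally show ?thesis .
qed

text \<open>Fubini with the coordinate \<open>j\<close> innermost: all other letters enter only as a
  shift, to which the bound for one letter is insensitive.\<close>

lemma nn_integral_fresh_letter:
  fixes rest :: "('k \<Rightarrow> complex) \<Rightarrow> complex"
  assumes "finite J" "j \<in> J" "a \<noteq> 0"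
    and [measurable]: "rest \<in> borel_measurable (PiM J (\<lambda>_. borel))"
    and rest: "\<And>c u. rest (c(j := u)) = rest c"
  shows "(\<integral>\<^sup>+c. pair_err (a * clip (c j) + rest c) \<partial>PiM J (\<lambda>_. letter))
    \<le> ennreal (letter_const / (cmod a)\<^sup>2)"
proof -
  interpret P: prob_space "PiM (J - {j}) (\<lambda>_. letter)"
    by (rule prob_space_PiM) (rule prob_space_letter)
  have J: "J = insert j (J - {j})" using \<open>j \<in> J\<close> by auto
  have s: "sets (PiM J (\<lambda>_. letter)) = sets (PiM J (\<lambda>_. borel))"
    by (rule sets_PiM_cong) auto
  have m: "(\<lambda>c. ennreal (pair_err (a * clip (c j) + rest c))) \<in> borel_measurable (PiM J (\<lambda>_. letter))"
    using \<open>j \<in> J\<close> unfolding measurable_cong_sets[OF s refl] by measurable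
  have "(\<integral>\<^sup>+c. pair_err (a * clip (c j) + rest c) \<partial>PiM J (\<lambda>_. letter))
    = (\<integral>\<^sup>+c. \<integral>\<^sup>+u. pair_err (a * clip ((c(j := u)) j) + rest (c(j := u))) \<partial>letter \<partial>PiM (J - {j}) (\<lambda>_. letter))"
    using letter_product.product_nn_integral_insert[of "J - {j}" j
        "\<lambda>c. ennreal (pair_err (a * clip (c j) + rest c))"] m \<open>finite J\<close>
    unfolding J[symmetric] by simp
  also have "\<dots> = (\<integral>\<^sup>+c. \<integral>\<^sup>+u. pair_err (a * clip u + rest c) \<partial>letter \<partial>PiM (J - {j}) (\<lambda>_. letter))"
    by (simp only: rest fun_upd_same)
  also have "\<dots> \<le> (\<integral>\<^sup>+c. ennreal (letter_const / (cmod a)\<^sup>2) \<partial>PiM (J - {j}) (\<lambda>_. letter))"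
    by (intro nn_integral_mono nn_integral_pair_err_letter \<open>a \<noteq> 0\<close>)
  also have "\<dots> = ennreal (letter_const / (cmod a)\<^sup>2)"
    by (simp add: P.emeasure_space_1)
  finally show ?thesis .
qed

type_synonym column = "nat \<times> nat \<Rightarrow> complex"

text \<open>The common message is carried by independent letters of both transmitters (layers \<open>k0\<close> and \<open>l0\<close>), so that
  a wrong common message always meets a fresh letter on the stronger of the two links. The layers \<open>kc\<close>
  and \<open>kp\<close> carry the two parts of the own message, \<open>lc\<close> the decodable part of the interfering one.\<close>

definition rx_signal :: "complex \<Rightarrow> complex \<Rightarrow> real \<Rightarrow> nat \<times> nat \<times> nat \<Rightarrow> nat \<times> nat
    \<Rightarrow> nat \<times> nat \<times> nat \<times> nat \<Rightarrow> column \<Rightarrow> complex" where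
  "rx_signal a b p = (\<lambda>(k0, kc, kp) (l0, lc) (m0, c, q, c') u.
     a / 3 * (clip (u (k0, m0)) + clip (u (kc, c)) + p * clip (u (kp, q)))
     + b / 3 * (clip (u (l0, m0)) + clip (u (lc, c'))))"

text \<open>A column holds all letters of one time index. The six layers are, for each of the two
  transmitters, one for the common message, one public and one private.\<close>

definition columns :: "nat \<Rightarrow> column measure" where
  "columns N = PiM ({..<6} \<times> {..<N}) (\<lambda>_. letter)"

text \<open>The 9 is the square of the 3 in \<open>rx_signal\<close>, by which each transmitter
  divides the sum of its three letters in order to stay in the unit disk.\<close>

definition gain_bound :: "complex \<Rightarrow> real" where
  "gain_bound a = 9 * letter_const / (cmod a)\<^sup>2"

lemma gain_bound_nonneg [simp]: "gain_bound a \<ge> 0"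
  using letter_const_pos by (simp add: gain_bound_def)

lemma sets_columns: "sets (columns N) = sets (PiM ({..<6} \<times> {..<N}) (\<lambda>_. borel))"
  unfolding columns_def by (rule sets_PiM_cong) auto

lemma prob_space_columns: "prob_space (columns N)"
  unfolding columns_def by (rule prob_space_PiM) (rule prob_space_letter)

context
  fixes a b :: complex and p :: real and k0 kc kp l0 lc N :: nat
  assumes layers: "distinct [k0, kc, kp, l0, lc]" "set [k0, kc, kp, l0, lc] \<subseteq> {..<6}"
begin

abbreviation "layered_signal \<equiv> rx_signal a b p (k0, kc, kp) (l0, lc)"

lemma rx_signal_measurable:
  assumes "m0 < N" "c < N" "q < N" "c' < N"
  shows "layered_signal (m0, c, q, c') \<in> borel_measurable (PiM ({..<6} \<times> {..<N}) (\<lambda>_. borel))"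
proof -
  have [measurable]: "(\<lambda>u. u (k, m)) \<in> borel_measurable (PiM ({..<6} \<times> {..<N}) (\<lambda>_. borel))"
    if "k \<in> set [k0, kc, kp, l0, lc]" "m < N" for k m
    using that layers(2) by (intro measurable_component_singleton) auto
  have "(\<lambda>u. a / 3 * (clip (u (k0, m0)) + clip (u (kc, c)) + p * clip (u (kp, q)))
     + b / 3 * (clip (u (l0, m0)) + clip (u (lc, c'))))
     \<in> borel_measurable (PiM ({..<6} \<times> {..<N}) (\<lambda>_. borel))"
    using assms by measurable
  then show ?thesis by (simp add: rx_signal_def)
qed

text \<open>The letter at \<open>(k, m)\<close> occurs in the competing signal with gain
  \<open>g / 3\<close> and not in the true one, so the difference is a multiple of this letter plus
  something independent of it.\<close>

lemma rx_signal_fresh: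
  assumes "m0 < N" "c < N" "q < N" "c' < N" "m0' < N" "d < N" "r < N" "d' < N"
    and "k \<in> set [k0, kc, kp, l0, lc]" "m < N" "g \<noteq> 0"
    and indep: "\<And>u z. layered_signal (m0, c, q, c') (u((k, m) := z)) = layered_signal (m0, c, q, c') u"
    and fresh: "\<And>u z. layered_signal (m0', d, r, d') (u((k, m) := z))
      = layered_signal (m0', d, r, d') u + g / 3 * (clip z - clip (u (k, m)))"
  shows "(\<integral>\<^sup>+u. pair_err (layered_signal (m0, c, q, c') u - layered_signal (m0', d, r, d') u) \<partial>columns N) \<le> gain_bound g"
proof -
  let ?J = "{..<6} \<times> {..<N}"
  let ?rest = "\<lambda>u. layered_signal (m0, c, q, c') u - layered_signal (m0', d, r, d') u + g / 3 * clip (u (k, m))"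
  have j: "(k, m) \<in> ?J" using assms layers by auto
  have m: "?rest \<in> borel_measurable (PiM ?J (\<lambda>_. borel))"
    using rx_signal_measurable[OF assms(1-4)] rx_signal_measurable[OF assms(5-8)]
      measurable_component_singleton[OF j, of "\<lambda>_. borel"] by measurable
  have "(\<integral>\<^sup>+u. pair_err (- g / 3 * clip (u (k, m)) + ?rest u) \<partial>PiM ?J (\<lambda>_. letter))
      \<le> ennreal (letter_const / (cmod (- g / 3))\<^sup>2)"
  proof (rule nn_integral_fresh_letter)
    show "?rest (u((k, m) := z)) = ?rest u" for u z
      unfolding indep fresh by (simp add: algebra_simps)
  qed (use j m \<open>g \<noteq> 0\<close> in auto)
  also have "letter_const / (cmod (- g / 3))\<^sup>2 = gain_bound g"
    by (simp add: gain_bound_def norm_divide power_divide)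
  finally show ?thesis
    by (simp add: columns_def algebra_simps)
qed

text \<open>Every wrong index brings a letter that the true signal does not contain. A wrong common
  index brings two of them, one on each link, and hence two bounds, of which the better one will be
  used.\<close>

lemma rx_signal_diff_bounds:
  assumes "m0 < N" "c < N" "q < N" "c' < N" "m0' < N" "d < N" "r < N" "d' < N"
    and "a \<noteq> 0" "b \<noteq> 0" "p > 0"
  defines "E \<equiv> (\<integral>\<^sup>+u. pair_err (layered_signal (m0, c, q, c') u - layered_signal (m0', d, r, d') u) \<partial>columns N)"
  shows "m0 \<noteq> m0' \<Longrightarrow> E \<le> gain_bound a" "m0 \<noteq> m0' \<Longrightarrow> E \<le> gain_bound b"
    "c \<noteq> d \<Longrightarrow> E \<le> gain_bound a" "q \<noteq> r \<Longrightarrow> E \<le> gain_bound (a * p)"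
    "c' \<noteq> d' \<Longrightarrow> E \<le> gain_bound b"
proof -
  note fr = rx_signal_fresh[OF assms(1-8)]
  note sd = rx_signal_def
  show "E \<le> gain_bound a" if "m0 \<noteq> m0'"
    unfolding E_def using that layers assms(1-11) by (intro fr[of k0 m0']) (auto simp: sd algebra_simps)
  show "E \<le> gain_bound b" if "m0 \<noteq> m0'"
    unfolding E_def using that layers assms(1-11) by (intro fr[of l0 m0']) (auto simp: sd algebra_simps)
  show "E \<le> gain_bound a" if "c \<noteq> d"
    unfolding E_def using that layers assms(1-11) by (intro fr[of kc d]) (auto simp: sd algebra_simps)
  show "E \<le> gain_bound (a * p)" if "q \<noteq> r"
    unfolding E_def using that layers assms(1-11) by (intro fr[of kp r]) (auto simp: sd field_simps)
  show "E \<le> gain_bound b" if "c' \<noteq> d'"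
    unfolding E_def using that layers assms(1-11) by (intro fr[of lc d']) (auto simp: sd algebra_simps)
qed

end

section \<open>The random coding bound\<close>

lemma sum_Un_le_ennreal:
  fixes f :: "'a \<Rightarrow> ennreal"
  assumes "finite A" "finite B"
  shows "sum f (A \<union> B) \<le> sum f A + sum f B"
  using sum.union_inter[OF assms, of f] by (metis add_increasing2 order_refl zero_le)

text \<open>\<open>h\<close> enumerates the possible competitors, and \<open>P\<close> is a
  consequence of there being one. An event without competitors contributes exactly 0, so a layer
  with a single message puts no condition on its gain.\<close>

lemma sum_le_card_mult:
  fixes f :: "'a \<Rightarrow> ennreal"
  assumes "finite T" "S \<subseteq> h ` T" "\<And>x. x \<in> S \<Longrightarrow> f x \<le> ennreal \<beta>" "\<beta> \<ge> 0" "S \<noteq> {} \<Longrightarrow> P"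
  shows "sum f S \<le> ennreal (if P then real (card T) * \<beta> else 0)"
proof (cases "S = {}")
  case False
  have "sum f S \<le> of_nat (card S) * ennreal \<beta>"
    using sum_bounded_above[of S f "ennreal \<beta>"] assms(3) by simp
  also have "\<dots> \<le> of_nat (card T) * ennreal \<beta>"
    using surj_card_le[OF assms(1,2)] by (intro mult_right_mono) auto
  also have "\<dots> = ennreal (real (card T) * \<beta>)"
    using \<open>\<beta> \<ge> 0\<close> by (simp add: ennreal_mult ennreal_of_nat_eq_real_of_nat)
  finally show ?thesis using assms(5) False by simp
qed simp

text \<open>Messages are numbered from 1; the two digits of \<open>m - 1\<close> in base \<open>Kp\<close> are the publicly decodable and the
  private part.\<close>

definition split_index :: "nat \<Rightarrow> nat \<times> nat \<times> nat \<Rightarrow> nat \<times> nat \<times> nat \<times> nat" where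
  "split_index Kp = (\<lambda>(m0, m, c'). (m0, (m - 1) div Kp, (m - 1) mod Kp, c'))"

text \<open>The four summands count the error events: common message wrong, or both public parts wrong; own public
  part wrong; only the private part wrong, with the interfering public part right or wrong. An interfering
  public part that is wrong on its own is not an error.\<close>

definition rx_bound :: "nat \<Rightarrow> nat \<Rightarrow> nat \<Rightarrow> nat \<Rightarrow> nat \<Rightarrow> nat \<Rightarrow> complex \<Rightarrow> complex \<Rightarrow> real \<Rightarrow> real" where
  "rx_bound n K0 K1 Kc Kp Kc' a b p =
     (if K0 > 1 \<or> Kc > 1 then real (K0 * K1 * Kc') * min (gain_bound a) (gain_bound b) ^ n else 0)
   + (if Kc > 1 then real K1 * gain_bound a ^ n else 0)
   + (if Kp > 1 then real Kp * gain_bound (a * p) ^ n else 0)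
   + (if Kp > 1 then real (Kp * Kc') * min (gain_bound (a * p)) (gain_bound b) ^ n else 0)"

lemma rx_bound_nonneg: "rx_bound n K0 K1 Kc Kp Kc' a b p \<ge> 0"
  by (simp add: rx_bound_def)

definition codebooks :: "nat \<Rightarrow> nat \<Rightarrow> (nat \<Rightarrow> column) measure" where
  "codebooks n N = PiM {..<n} (\<lambda>_. columns N)"

lemma prob_space_codebooks: "prob_space (codebooks n N)"
  unfolding codebooks_def by (rule prob_space_PiM) (rule prob_space_columns)

context
  fixes a b :: complex and p :: real and k0 kc kp l0 lc N n K0 K1 Kc Kp Kc' :: nat
  assumes layers: "distinct [k0, kc, kp, l0, lc]" "set [k0, kc, kp, l0, lc] \<subseteq> {..<6}"
    and nz: "a \<noteq> 0" "b \<noteq> 0" "p > 0"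
    and K: "K0 < N" "Kc \<le> N" "Kp \<le> N" "Kc' \<le> N" "K1 \<le> Kc * Kp" "Kp > 0"
begin

text \<open>The candidates of the decoder. Own messages start at 1 as in a code, but the last
  component is a digit of the interfering message and starts at 0.\<close>

definition "msg_set = {1..K0} \<times> {1..K1} \<times> {..<Kc'}"
definition "code_signal w = rx_signal a b p (k0, kc, kp) (l0, lc) (split_index Kp w)"
definition "label w = (fst w, fst (snd w))" for w :: "nat \<times> nat \<times> nat"
definition "confusion w cb = (\<Sum>w'\<in>{w'\<in>msg_set. label w' \<noteq> label w}.
    \<Prod>t<n. pair_err (code_signal w (cb t) - code_signal w' (cb t)))" for cb :: "nat \<Rightarrow> column"

lemma finite_msg_set [simp]: "finite msg_set"
  by (simp add: msg_set_def)

lemma split_bounds: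
  assumes "m \<in> {1..K1}"
  shows "(m - 1) div Kp < Kc" "(m - 1) mod Kp < Kp"
proof -
  have "m - 1 < Kc * Kp" using assms K(5) by (auto simp: Suc_le_eq)
  then show "(m - 1) div Kp < Kc" by (simp add: less_mult_imp_div_less)
qed (use K(6) in simp)

lemma code_signal_measurable:
  assumes "w \<in> msg_set"
  shows "code_signal w \<in> borel_measurable (columns N)"
proof -
  obtain m0 m c where w: "w = (m0, m, c)" "m0 \<le> K0" "m \<in> {1..K1}" "c < Kc'"
    using assms by (auto simp: msg_set_def)
  show ?thesis
    unfolding measurable_cong_sets[OF sets_columns refl] code_signal_def w split_index_def prod.case
    using w K split_bounds[OF w(3)] by (intro rx_signal_measurable[OF layers]) auto
qed

lemma pair_measurable:
  assumes "w \<in> msg_set" "w' \<in> msg_set"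
  shows "(\<lambda>u. pair_err (code_signal w u - code_signal w' u)) \<in> borel_measurable (columns N)"
  using code_signal_measurable[OF assms(1)] code_signal_measurable[OF assms(2)] by measurable

lemma codebook_pair_measurable:
  assumes "w \<in> msg_set" "w' \<in> msg_set" "t < n"
  shows "(\<lambda>cb. pair_err (code_signal w (cb t) - code_signal w' (cb t))) \<in> borel_measurable (codebooks n N)"
  unfolding codebooks_def
  using measurable_compose[of "\<lambda>cb. cb t" "PiM {..<n} (\<lambda>_. columns N)" "columns N", OF _ pair_measurable[OF assms(1,2)]]
    measurable_component_singleton[of t "{..<n}" "\<lambda>_. columns N"] assms(3) by simp

lemma confusion_measurable:
  assumes "w \<in> msg_set"
  shows "confusion w \<in> borel_measurable (codebooks n N)"
  unfolding confusion_def
  by (intro borel_measurable_sum borel_measurable_prod codebook_pair_measurable) (use assms in auto)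

lemma confusion_nonneg: "confusion w cb \<ge> 0"
  unfolding confusion_def by (intro sum_nonneg prod_nonneg) simp

lemma expected_pair:
  assumes "w \<in> msg_set" "w' \<in> msg_set"
  shows "(\<integral>\<^sup>+cb. (\<Prod>t<n. pair_err (code_signal w (cb t) - code_signal w' (cb t))) \<partial>codebooks n N)
    = (\<integral>\<^sup>+u. pair_err (code_signal w u - code_signal w' u) \<partial>columns N) ^ n"
proof -
  interpret col: prob_space "columns N" by (rule prob_space_columns)
  interpret cols: product_sigma_finite "\<lambda>_. columns N"
    by (simp add: product_sigma_finite_def col.sigma_finite_measure_axioms)
  have "(\<integral>\<^sup>+cb. (\<Prod>t<n. ennreal (pair_err (code_signal w (cb t) - code_signal w' (cb t)))) \<partial>codebooks n N)
    = (\<Prod>t<n. \<integral>\<^sup>+u. pair_err (code_signal w u - code_signal w' u) \<partial>columns N)"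
    unfolding codebooks_def
    by (rule cols.product_nn_integral_prod
        [where f = "\<lambda>t u. ennreal (pair_err (code_signal w u - code_signal w' u))"])
      (use pair_measurable[OF assms] in auto)
  then show ?thesis by (simp add: prod_ennreal)
qed

lemma expected_confusion:
  assumes w: "w \<in> msg_set"
  shows "(\<integral>\<^sup>+cb. confusion w cb \<partial>codebooks n N) \<le> ennreal (rx_bound n K0 K1 Kc Kp Kc' a b p)"
proof -
  obtain m0 m c where weq: "w = (m0, m, c)" and wm: "m0 \<in> {1..K0}" "m \<in> {1..K1}" "c < Kc'"
    using assms by (auto simp: msg_set_def)
  define E where "E w' = (\<integral>\<^sup>+u. pair_err (code_signal w u - code_signal w' u) \<partial>columns N)" for w'
  let ?T = "{w'\<in>msg_set. label w' \<noteq> label w}"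
  let ?hi = "\<lambda>m. (m - 1) div Kp" and ?lo = "\<lambda>m. (m - 1) mod Kp"
  \<comment> \<open>The classes are separated by the fresh letters they offer. In \<open>A\<close>
    and \<open>D\<close> there is one on each link, so both gains bound the error and the minimum
    may be taken.\<close>
  define A where "A = {(m0', m', c') \<in> msg_set. m0' \<noteq> m0 \<or> ?hi m' \<noteq> ?hi m \<and> c' \<noteq> c}"
  define B where "B = {(m0', m', c') \<in> msg_set. m0' = m0 \<and> ?hi m' \<noteq> ?hi m \<and> c' = c}"
  define C where "C = {(m0', m', c') \<in> msg_set. m0' = m0 \<and> ?hi m' = ?hi m \<and> ?lo m' \<noteq> ?lo m \<and> c' = c}"
  define D where "D = {(m0', m', c') \<in> msg_set. m0' = m0 \<and> ?hi m' = ?hi m \<and> ?lo m' \<noteq> ?lo m \<and> c' \<noteq> c}"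
  note ABCD = A_def B_def C_def D_def
  have fin: "finite A" "finite B" "finite C" "finite D"
    unfolding ABCD by (auto intro: finite_subset[OF _ finite_msg_set])
  have recover: "m' = Suc (?hi m' * Kp + ?lo m')" if "m' \<in> {1..K1}" for m'
    using that by (simp add: div_mult_mod_eq)
  have sub: "?T \<subseteq> A \<union> B \<union> C \<union> D"
  proof
    fix w' assume "w' \<in> ?T"
    then obtain m0' m' c' where w': "w' = (m0', m', c')" "(m0', m', c') \<in> msg_set" "m' \<in> {1..K1}"
      "m0' \<noteq> m0 \<or> m' \<noteq> m"
      by (auto simp: msg_set_def label_def weq)
    have "?hi m' \<noteq> ?hi m \<or> ?lo m' \<noteq> ?lo m" if "m' \<noteq> m"
      using that recover[OF w'(3)] recover[OF wm(2)] by metis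
    then show "w' \<in> A \<union> B \<union> C \<union> D"
      using w' unfolding ABCD by auto
  qed
  have bound: "m0' \<noteq> m0 \<Longrightarrow> E (m0', m', c') \<le> gain_bound a" "m0' \<noteq> m0 \<Longrightarrow> E (m0', m', c') \<le> gain_bound b"
    "?hi m' \<noteq> ?hi m \<Longrightarrow> E (m0', m', c') \<le> gain_bound a"
    "?lo m' \<noteq> ?lo m \<Longrightarrow> E (m0', m', c') \<le> gain_bound (a * p)"
    "c' \<noteq> c \<Longrightarrow> E (m0', m', c') \<le> gain_bound b"
    if "(m0', m', c') \<in> msg_set" for m0' m' c'
  proof -
    have m': "m0' \<in> {1..K0}" "m' \<in> {1..K1}" "c' < Kc'"
      using that by (auto simp: msg_set_def)
    have ran: "m0 < N" "?hi m < N" "?lo m < N" "c < N" "m0' < N" "?hi m' < N" "?lo m' < N" "c' < N"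
      using m' wm K less_le_trans[OF split_bounds(1)[OF wm(2)] K(2)]
        less_le_trans[OF split_bounds(1)[OF m'(2)] K(2)] less_le_trans[OF split_bounds(2)[OF wm(2)] K(3)]
        less_le_trans[OF split_bounds(2)[OF m'(2)] K(3)] by auto
    note r = rx_signal_diff_bounds[OF layers ran nz]
    show "m0' \<noteq> m0 \<Longrightarrow> E (m0', m', c') \<le> gain_bound a" "m0' \<noteq> m0 \<Longrightarrow> E (m0', m', c') \<le> gain_bound b"
      "?hi m' \<noteq> ?hi m \<Longrightarrow> E (m0', m', c') \<le> gain_bound a"
      "?lo m' \<noteq> ?lo m \<Longrightarrow> E (m0', m', c') \<le> gain_bound (a * p)"
      "c' \<noteq> c \<Longrightarrow> E (m0', m', c') \<le> gain_bound b"
      unfolding E_def weq code_signal_def split_index_def prod.case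
      by (rule r(1), erule not_sym) (rule r(2), erule not_sym, rule r(3), erule not_sym,
        rule r(4), erule not_sym, rule r(5), erule not_sym)
  qed
  have pw: "E w' ^ n \<le> ennreal (g ^ n)" if "E w' \<le> ennreal g" "g \<ge> 0" for w' g
    using power_mono[OF that(1), of n] that(2) by (simp add: ennreal_power)
  have SA: "(\<Sum>w'\<in>A. E w' ^ n) \<le> ennreal (if K0 > 1 \<or> Kc > 1 then real (card msg_set) * min (gain_bound a) (gain_bound b) ^ n else 0)"
  proof (rule sum_le_card_mult[where h = id])
    show "E w' ^ n \<le> ennreal (min (gain_bound a) (gain_bound b) ^ n)" if "w' \<in> A" for w'
      using that unfolding A_def by (intro pw) (auto simp: min_def intro: bound)
    show "K0 > 1 \<or> Kc > 1" if ne: "A \<noteq> {}"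
    proof -
      obtain m0' m' c' where *: "(m0', m', c') \<in> msg_set" "m0' \<noteq> m0 \<or> ?hi m' \<noteq> ?hi m"
        using ne unfolding A_def by fast
      then have "m' \<in> {1..K1}" "m0' \<in> {1..K0}" by (auto simp: msg_set_def)
      then show ?thesis
        using * wm split_bounds[OF wm(2)] split_bounds[of m'] by fastforce
    qed
  qed (auto simp: A_def)
  have SB: "(\<Sum>w'\<in>B. E w' ^ n) \<le> ennreal (if Kc > 1 then real (card {1..K1}) * gain_bound a ^ n else 0)"
  proof (rule sum_le_card_mult[where h = "\<lambda>m'. (m0, m', c)"])
    show "E w' ^ n \<le> ennreal (gain_bound a ^ n)" if "w' \<in> B" for w'
      using that unfolding B_def by (intro pw) (auto intro: bound)
    show "Kc > 1" if ne: "B \<noteq> {}"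
    proof -
      obtain m0' m' c' where *: "(m0', m', c') \<in> msg_set" "?hi m' \<noteq> ?hi m"
        using ne unfolding B_def by fast
      then have "m' \<in> {1..K1}" by (auto simp: msg_set_def)
      then show ?thesis
        using * split_bounds[OF wm(2)] split_bounds[of m'] by fastforce
    qed
  qed (auto simp: B_def msg_set_def)
  have lo: "Kp > 1" if "(m0', m', c') \<in> msg_set" "?lo m' \<noteq> ?lo m" for m0' m' c'
    using that K(6) by (cases "Kp = 1") auto
  \<comment> \<open>With the public digit known to be right, a competitor is determined by its
    private digit; this counts \<open>Kp\<close> competitors instead of \<open>K1\<close>. The
    \<open>Suc\<close> restores the numbering from 1.\<close>
  let ?emb = "\<lambda>q. (m0, Suc (?hi m * Kp + q), c)" and ?emb' = "\<lambda>(q, c'). (m0, Suc (?hi m * Kp + q), c')"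
  have SC: "(\<Sum>w'\<in>C. E w' ^ n) \<le> ennreal (if Kp > 1 then real (card {..<Kp}) * gain_bound (a * p) ^ n else 0)"
  proof (rule sum_le_card_mult[where h = "?emb"])
    show "E w' ^ n \<le> ennreal (gain_bound (a * p) ^ n)" if "w' \<in> C" for w'
      using that unfolding C_def by (intro pw) (auto intro: bound)
    show "Kp > 1" if "C \<noteq> {}"
      using that lo unfolding C_def by auto
    show "C \<subseteq> ?emb ` {..<Kp}"
    proof
      fix w' assume "w' \<in> C"
      then obtain m' where "w' = (m0, m', c)" "m' \<in> {1..K1}" "?hi m' = ?hi m"
        by (auto simp: C_def msg_set_def)
      then show "w' \<in> ?emb ` {..<Kp}"
        using recover[of m'] split_bounds[of m'] by (intro image_eqI[of _ _ "?lo m'"]) auto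
    qed
  qed simp_all
  have SD: "(\<Sum>w'\<in>D. E w' ^ n) \<le> ennreal (if Kp > 1 then real (card ({..<Kp} \<times> {..<Kc'})) * min (gain_bound (a * p)) (gain_bound b) ^ n else 0)"
  proof (rule sum_le_card_mult[where h = "?emb'"])
    show "E w' ^ n \<le> ennreal (min (gain_bound (a * p)) (gain_bound b) ^ n)" if "w' \<in> D" for w'
      using that unfolding D_def by (intro pw) (auto simp: min_def intro: bound)
    show "Kp > 1" if "D \<noteq> {}"
      using that lo unfolding D_def by auto
    show "D \<subseteq> ?emb' ` ({..<Kp} \<times> {..<Kc'})"
    proof
      fix w' assume "w' \<in> D"
      then obtain m' c' where "w' = (m0, m', c')" "m' \<in> {1..K1}" "?hi m' = ?hi m" "c' < Kc'"
        by (auto simp: D_def msg_set_def)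
      then show "w' \<in> ?emb' ` ({..<Kp} \<times> {..<Kc'})"
        using recover[of m'] split_bounds[of m'] by (intro image_eqI[of _ _ "(?lo m', c')"]) auto
    qed
  qed simp_all
  have sum4: "ennreal x1 + ennreal x2 + ennreal x3 + ennreal x4 = ennreal (x1 + x2 + x3 + x4)"
    if "x1 \<ge> 0" "x2 \<ge> 0" "x3 \<ge> 0" "x4 \<ge> 0" for x1 x2 x3 x4
    using that by simp
  have "(\<integral>\<^sup>+cb. confusion w cb \<partial>codebooks n N)
      = (\<integral>\<^sup>+cb. (\<Sum>w'\<in>?T. ennreal (\<Prod>t<n. pair_err (code_signal w (cb t) - code_signal w' (cb t)))) \<partial>codebooks n N)"
    unfolding confusion_def by (subst sum_ennreal) (auto intro: prod_nonneg)
  also have "\<dots> = (\<Sum>w'\<in>?T. \<integral>\<^sup>+cb. ennreal (\<Prod>t<n. pair_err (code_signal w (cb t) - code_signal w' (cb t))) \<partial>codebooks n N)"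
    by (intro nn_integral_sum measurable_compose[OF _ measurable_ennreal] borel_measurable_prod
      codebook_pair_measurable) (use assms in auto)
  also have "\<dots> = (\<Sum>w'\<in>?T. E w' ^ n)"
    unfolding E_def by (intro sum.cong refl expected_pair w) auto
  also have "\<dots> \<le> (\<Sum>w'\<in>A \<union> B \<union> C \<union> D. E w' ^ n)"
    using fin sub by (intro sum_mono2) auto
  also have "\<dots> \<le> (\<Sum>w'\<in>A. E w' ^ n) + (\<Sum>w'\<in>B. E w' ^ n) + (\<Sum>w'\<in>C. E w' ^ n) + (\<Sum>w'\<in>D. E w' ^ n)"
    using fin by (intro order_trans[OF sum_Un_le_ennreal] add_mono order_refl finite_UnI)
  also have "\<dots> \<le> ennreal (if K0 > 1 \<or> Kc > 1 then real (K0 * K1 * Kc') * min (gain_bound a) (gain_bound b) ^ n else 0)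
    + ennreal (if Kc > 1 then real K1 * gain_bound a ^ n else 0)
    + ennreal (if Kp > 1 then real Kp * gain_bound (a * p) ^ n else 0)
    + ennreal (if Kp > 1 then real (Kp * Kc') * min (gain_bound (a * p)) (gain_bound b) ^ n else 0)"
    using SA SB SC SD by (intro add_mono) (simp_all add: msg_set_def mult.assoc cong: if_cong)
  also have "\<dots> = ennreal (rx_bound n K0 K1 Kc Kp Kc' a b p)"
    unfolding rx_bound_def
    by (intro sum4) simp_all
  finally show ?thesis .
qed

end

section \<open>From random codebooks to a code for both receivers\<close>

interpretation noise: prob_space "noise n" for n
  unfolding noise_eq by (rule noise_pair.prob_space_axioms)

text \<open>The upper bound serves the construction of codes; the lower bounds serve the converse,
  where each receiver alone errs no more often than the pair.\<close>

lemma prob_noise_disj: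
  assumes P: "{z \<in> space (noise1 n). P z} \<in> sets (noise1 n)" (is "?A \<in> _")
    and Q: "{z \<in> space (noise1 n). Q z} \<in> sets (noise1 n)" (is "?B \<in> _")
  defines "PQ \<equiv> measure (noise n) {zz \<in> space (noise n). P (fst zz) \<or> Q (snd zz)}"
  shows "PQ \<le> measure (noise1 n) ?A + measure (noise1 n) ?B"
    and "measure (noise1 n) ?A \<le> PQ" and "measure (noise1 n) ?B \<le> PQ"
proof -
  let ?S = "space (noise1 n)"
  have sets: "?A \<times> ?S \<in> sets (noise n)" "?S \<times> ?B \<in> sets (noise n)"
    unfolding noise_eq by (intro pair_measureI P Q sets.top)+
  have "{zz \<in> space (noise n). P (fst zz) \<or> Q (snd zz)} = ?A \<times> ?S \<union> ?S \<times> ?B"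
    by (auto simp: noise_eq space_pair_measure)
  then have PQ: "PQ = measure (noise n) (?A \<times> ?S \<union> ?S \<times> ?B)"
    by (simp add: PQ_def)
  have "measure (noise n) (?A \<times> ?S) = measure (noise1 n) ?A"
    unfolding noise_eq measure_def
    by (subst noise1.emeasure_pair_measure_Times[OF P sets.top]) (simp add: noise1.emeasure_space_1)
  moreover have "measure (noise n) (?S \<times> ?B) = measure (noise1 n) ?B"
    unfolding noise_eq measure_def
    by (subst noise1.emeasure_pair_measure_Times[OF sets.top Q]) (simp add: noise1.emeasure_space_1)
  moreover have "measure (noise n) (?A \<times> ?S) \<le> PQ" "measure (noise n) (?S \<times> ?B) \<le> PQ"
    unfolding PQ using sets by (intro noise.finite_measure_mono; auto)+
  ultimately show "PQ \<le> measure (noise1 n) ?A + measure (noise1 n) ?B"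
    "measure (noise1 n) ?A \<le> PQ" "measure (noise1 n) ?B \<le> PQ"
    using measure_Un_le[OF sets] unfolding PQ by simp_all
qed

lemma rx_measurable:
  "rx n a b x1 x2 \<in> noise1 n \<rightarrow>\<^sub>M blocks n"
  unfolding rx_def noise1_def by measurable

lemma decoder_error_sets:
  assumes "g \<in> blocks n \<rightarrow>\<^sub>M count_space UNIV"
  shows "{z \<in> space (noise1 n). g (rx n a b x1 x2 z) \<noteq> v} \<in> sets (noise1 n)"
proof -
  have "(\<lambda>z. g (rx n a b x1 x2 z)) \<in> noise1 n \<rightarrow>\<^sub>M count_space UNIV"
    using measurable_compose[OF rx_measurable assms] .
  then have "(\<lambda>z. g (rx n a b x1 x2 z)) -` (- {v}) \<inter> space (noise1 n) \<in> sets (noise1 n)"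
    by (rule measurable_sets) simp
  also have "(\<lambda>z. g (rx n a b x1 x2 z)) -` (- {v}) \<inter> space (noise1 n)
      = {z \<in> space (noise1 n). g (rx n a b x1 x2 z) \<noteq> v}"
    by auto
  finally show ?thesis .
qed

text \<open>The probabilistic method: a bound on the average over codebooks yields a single
  codebook.\<close>

lemma (in prob_space) nn_integral_less_imp_exists:
  assumes "(\<integral>\<^sup>+x. f x \<partial>M) < B"
  shows "\<exists>x\<in>space M. f x < B"
proof (rule ccontr)
  assume "\<not> ?thesis"
  then have "(\<integral>\<^sup>+x. B \<partial>M) \<le> (\<integral>\<^sup>+x. f x \<partial>M)"
    by (intro nn_integral_mono) (auto simp: not_less)
  then show False using assms by (simp add: emeasure_space_1)
qed

lemma average_power_le_1:
  assumes "n > 0" "\<And>m0 m t. cmod (f m0 m t) \<le> 1"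
  shows "(1 / real n) * (\<Sum>t<n. (1 / (real K0 * real K)) *
    (\<Sum>m0\<in>{1..K0}. \<Sum>m\<in>{1..K}. (cmod (f m0 m t))\<^sup>2)) \<le> 1"
proof -
  have "(\<Sum>m0\<in>{1..K0}. \<Sum>m\<in>{1..K}. (cmod (f m0 m t))\<^sup>2) \<le> (\<Sum>m0\<in>{1..K0}. \<Sum>m\<in>{1..K}. 1)" for t
    using assms(2) by (intro sum_mono power_le_one) auto
  then have "(1 / (real K0 * real K)) * (\<Sum>m0\<in>{1..K0}. \<Sum>m\<in>{1..K}. (cmod (f m0 m t))\<^sup>2) \<le> 1" for t
    by (cases "K0 = 0 \<or> K = 0") (auto simp: field_simps)
  then have "(\<Sum>t<n. (1 / (real K0 * real K)) *
    (\<Sum>m0\<in>{1..K0}. \<Sum>m\<in>{1..K}. (cmod (f m0 m t))\<^sup>2)) \<le> (\<Sum>t<n. 1)"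
    by (intro sum_mono)
  then show ?thesis using \<open>n > 0\<close> by (simp add: field_simps)
qed

lemma cmod_sum3_le: "cmod ((x + y + complex_of_real p * z) / 3) \<le> 1"
  if "cmod x \<le> 1" "cmod y \<le> 1" "cmod z \<le> 1" "0 < p" "p \<le> 1"
proof -
  have "cmod (x + y + complex_of_real p * z) \<le> cmod (x + y) + cmod (complex_of_real p * z)"
    by (rule norm_triangle_ineq)
  also have "\<dots> \<le> cmod x + cmod y + p * cmod z"
    using that norm_triangle_ineq[of x y] by (simp add: norm_mult)
  also have "\<dots> \<le> 1 + 1 + 1"
    using that by (intro add_mono mult_le_one) auto
  finally show ?thesis by (simp add: norm_divide)
qed

text \<open>One codebook has to serve both receivers, so \<open>F\<close> adds their union bounds
  and averages them over the messages; its expectation over the codebooks is at most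
  \<open>B\<close>. The slack \<open>\<delta>\<close> makes the comparison strict, so that some
  codebook meets it.\<close>

lemma exists_code:
  assumes "n > 0" "K0 > 0" "K1 > 0" "K2 > 0" "K1p > 0" "K2p > 0"
    and K: "K1 \<le> K1c * K1p" "K2 \<le> K2c * K2p"
    and nz: "h11 \<noteq> 0" "h12 \<noteq> 0" "h21 \<noteq> 0" "h22 \<noteq> 0"
    and p: "0 < p1" "p1 \<le> 1" "0 < p2" "p2 \<le> 1" "cmod h21 * p1 \<le> 1" "cmod h12 * p2 \<le> 1"
    and "\<delta> > 0"
  shows "\<exists>f1 f2 g1 g2. valid_code n K0 K1 K2 f1 f2 g1 g2 \<and>
    err_prob h11 h12 h21 h22 n K0 K1 K2 f1 f2 g1 g2
    \<le> rx_bound n K0 K1 K1c K1p K2c h11 h12 p1 + rx_bound n K0 K2 K2c K2p K1c h22 h21 p2 + \<delta>"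
proof -
  define N where "N = Suc (K0 + K1c + K1p + K2c + K2p)"
  let ?W1 = "msg_set K0 K1 K2c" and ?W2 = "msg_set K0 K2 K1c"
  \<comment> \<open>Layers 0 and 1 carry the common message at the two transmitters, 2 and 3 the
    public and private part of user 1, 4 and 5 those of user 2. Receiver 2 reads the same layers
    with the users exchanged.\<close>
  let ?s1 = "code_signal h11 h12 p1 0 2 3 1 4 K1p" and ?s2 = "code_signal h22 h21 p2 1 4 5 0 2 K2p"
  define cf1 where "cf1 m0 m1 m2 = confusion h11 h12 p1 0 2 3 1 4 n K0 K1 K1p K2c (m0, m1, (m2 - 1) div K2p)" for m0 m1 m2
  define cf2 where "cf2 m0 m1 m2 = confusion h22 h21 p2 1 4 5 0 2 n K0 K2 K2p K1c (m0, m2, (m1 - 1) div K1p)" for m0 m1 m2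
  define cf where "cf m0 m1 m2 cb = cf1 m0 m1 m2 cb + cf2 m0 m1 m2 cb" for m0 m1 m2 cb
  let ?sum = "\<lambda>f. \<Sum>m0\<in>{1..K0}. \<Sum>m1\<in>{1..K1}. \<Sum>m2\<in>{1..K2}. f m0 m1 m2"
  define B where "B = rx_bound n K0 K1 K1c K1p K2c h11 h12 p1 + rx_bound n K0 K2 K2c K2p K1c h22 h21 p2"
  have B0: "B \<ge> 0" by (simp add: B_def rx_bound_nonneg)
  interpret cb: prob_space "codebooks n N" by (rule prob_space_codebooks)
  have ranges: "K0 < N" "K1c \<le> N" "K1p \<le> N" "K2c \<le> N" "K2p \<le> N"
    by (auto simp: N_def)
  have lay1: "distinct [0, 2, 3, 1, 4::nat]" "set [0, 2, 3, 1, 4::nat] \<subseteq> {..<6}"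
    and lay2: "distinct [1, 4, 5, 0, 2::nat]" "set [1, 4, 5, 0, 2::nat] \<subseteq> {..<6}"
    by auto
  note set1 = lay1 nz(1,2) p(1) ranges(1,2,3,4) K(1) \<open>K1p > 0\<close>
  note set2 = lay2 nz(4,3) p(3) ranges(1,4,5,2) K(2) \<open>K2p > 0\<close>
  have hi1: "(m - 1) div K1p < K1c" if "m \<in> {1..K1}" for m
    using split_bounds[OF set1 that] by simp
  have hi2: "(m - 1) div K2p < K2c" if "m \<in> {1..K2}" for m
    using split_bounds[OF set2 that] by simp
  have w1: "(m0, m1, (m2 - 1) div K2p) \<in> ?W1" and w2: "(m0, m2, (m1 - 1) div K1p) \<in> ?W2"
    if "m0 \<in> {1..K0}" "m1 \<in> {1..K1}" "m2 \<in> {1..K2}" for m0 m1 m2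
    using that hi1[of m1] hi2[of m2]
    unfolding msg_set_def[OF set1] msg_set_def[OF set2] by auto
  define F where "F cb = (1 / (real K0 * real K1 * real K2)) *
    (\<Sum>m0\<in>{1..K0}. \<Sum>m1\<in>{1..K1}. \<Sum>m2\<in>{1..K2}. cf m0 m1 m2 cb)" for cb
  have cf_meas: "(\<lambda>cb. ennreal (cf m0 m1 m2 cb)) \<in> borel_measurable (codebooks n N)"
    if "m0 \<in> {1..K0}" "m1 \<in> {1..K1}" "m2 \<in> {1..K2}" for m0 m1 m2
    using confusion_measurable[OF set1 w1[OF that]] confusion_measurable[OF set2 w2[OF that]]
    unfolding cf_def cf1_def cf2_def by measurable
  have cf_nonneg: "cf m0 m1 m2 cb \<ge> 0" for m0 m1 m2 cb
    unfolding cf_def cf1_def cf2_def by (intro add_nonneg_nonneg confusion_nonneg[OF set1] confusion_nonneg[OF set2])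
  have cf_int: "(\<integral>\<^sup>+cb. ennreal (cf m0 m1 m2 cb) \<partial>codebooks n N) \<le> ennreal B"
    if "m0 \<in> {1..K0}" "m1 \<in> {1..K1}" "m2 \<in> {1..K2}" for m0 m1 m2
  proof -
    have "(\<integral>\<^sup>+cb. ennreal (cf m0 m1 m2 cb) \<partial>codebooks n N)
      = (\<integral>\<^sup>+cb. ennreal (cf1 m0 m1 m2 cb) + ennreal (cf2 m0 m1 m2 cb) \<partial>codebooks n N)"
      unfolding cf_def cf1_def cf2_def
      by (intro nn_integral_cong ennreal_plus confusion_nonneg[OF set1] confusion_nonneg[OF set2])
    also have "\<dots> = (\<integral>\<^sup>+cb. ennreal (cf1 m0 m1 m2 cb) \<partial>codebooks n N) + (\<integral>\<^sup>+cb. ennreal (cf2 m0 m1 m2 cb) \<partial>codebooks n N)"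
      unfolding cf1_def cf2_def
      by (intro nn_integral_add measurable_compose[OF _ measurable_ennreal]
        confusion_measurable[OF set1 w1[OF that]] confusion_measurable[OF set2 w2[OF that]])
    also have "\<dots> \<le> ennreal (rx_bound n K0 K1 K1c K1p K2c h11 h12 p1) + ennreal (rx_bound n K0 K2 K2c K2p K1c h22 h21 p2)"
      unfolding cf1_def cf2_def
      by (intro add_mono expected_confusion[OF set1 w1[OF that]] expected_confusion[OF set2 w2[OF that]])
    also have "\<dots> = ennreal B"
      unfolding B_def by (intro ennreal_plus[symmetric] rx_bound_nonneg)
    finally show ?thesis .
  qed
  have "(\<integral>\<^sup>+cb. F cb \<partial>codebooks n N) = ennreal (1 / (real K0 * real K1 * real K2)) *
    (\<Sum>m0\<in>{1..K0}. \<Sum>m1\<in>{1..K1}. \<Sum>m2\<in>{1..K2}. \<integral>\<^sup>+cb. ennreal (cf m0 m1 m2 cb) \<partial>codebooks n N)"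
  proof -
    have "ennreal (F cb) = ennreal (1 / (real K0 * real K1 * real K2)) *
      (?sum (\<lambda>m0 m1 m2. ennreal (cf m0 m1 m2 cb)))" for cb
      unfolding F_def using cf_nonneg
      by (subst ennreal_mult) (auto intro!: sum_nonneg simp: sum_ennreal sum_nonneg)
    moreover have "(\<integral>\<^sup>+cb. (?sum (\<lambda>m0 m1 m2. ennreal (cf m0 m1 m2 cb))) \<partial>codebooks n N)
      = (\<Sum>m0\<in>{1..K0}. \<integral>\<^sup>+cb. (\<Sum>m1\<in>{1..K1}. \<Sum>m2\<in>{1..K2}. ennreal (cf m0 m1 m2 cb)) \<partial>codebooks n N)"
      by (intro nn_integral_sum borel_measurable_sum cf_meas)
    moreover have "\<dots> = (\<Sum>m0\<in>{1..K0}. \<Sum>m1\<in>{1..K1}. \<integral>\<^sup>+cb. (\<Sum>m2\<in>{1..K2}. ennreal (cf m0 m1 m2 cb)) \<partial>codebooks n N)"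
      by (intro sum.cong refl nn_integral_sum borel_measurable_sum cf_meas)
    moreover have "\<dots> = (\<Sum>m0\<in>{1..K0}. \<Sum>m1\<in>{1..K1}. \<Sum>m2\<in>{1..K2}. \<integral>\<^sup>+cb. ennreal (cf m0 m1 m2 cb) \<partial>codebooks n N)"
      by (intro sum.cong refl nn_integral_sum cf_meas)
    moreover have "(\<integral>\<^sup>+cb. ennreal (1 / (real K0 * real K1 * real K2)) *
      (?sum (\<lambda>m0 m1 m2. ennreal (cf m0 m1 m2 cb))) \<partial>codebooks n N)
      = ennreal (1 / (real K0 * real K1 * real K2)) * (\<integral>\<^sup>+cb.
      (?sum (\<lambda>m0 m1 m2. ennreal (cf m0 m1 m2 cb))) \<partial>codebooks n N)"
      by (intro nn_integral_cmult borel_measurable_sum cf_meas)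
    ultimately show ?thesis by (simp only:)
  qed
  also have "\<dots> \<le> ennreal (1 / (real K0 * real K1 * real K2)) *
    (?sum (\<lambda>_ _ _. ennreal B))"
    by (intro mult_left_mono sum_mono cf_int) auto
  also have "\<dots> = ennreal B"
  proof -
    have "(?sum (\<lambda>_ _ _. ennreal B)) = ennreal (real K0 * real K1 * real K2 * B)"
      using B0 by (simp add: sum_ennreal ennreal_of_nat_eq_real_of_nat ennreal_mult mult.assoc)
    then show ?thesis
      using B0 assms(2-4) by (simp flip: ennreal_mult)
  qed
  also have "\<dots> < ennreal (B + \<delta>)"
    using B0 \<open>\<delta> > 0\<close> by (simp add: ennreal_less_iff)
  finally obtain c where c: "ennreal (F c) < ennreal (B + \<delta>)"
    using cb.nn_integral_less_imp_exists by blast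
  have Fc: "F c \<le> B + \<delta>"
    using c B0 \<open>\<delta> > 0\<close> by (subst (asm) ennreal_less_iff) (auto simp: F_def intro!: sum_nonneg divide_nonneg_nonneg cf_nonneg)
  have fin: "finite ?W1" "finite ?W2"
    using finite_msg_set[OF set1] finite_msg_set[OF set2] by auto
  have ne: "?W1 \<noteq> {}" "?W2 \<noteq> {}"
    using w1[of 1 1 1] w2[of 1 1 1] assms(2-4) by auto
  obtain g1 where g1: "g1 \<in> blocks n \<rightarrow>\<^sub>M count_space UNIV"
    "\<And>y. \<exists>w\<in>?W1. g1 y = label w \<and>
      (\<forall>w'\<in>?W1. (\<Sum>t<n. (cmod (y t - ?s1 w (c t)))\<^sup>2) \<le> (\<Sum>t<n. (cmod (y t - ?s1 w' (c t)))\<^sup>2))"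
    by (rule min_distance_decoder[OF fin(1) ne(1), where n = n and s = "\<lambda>w t. ?s1 w (c t)" and l = label]) (rule that; blast)
  obtain g2 where g2: "g2 \<in> blocks n \<rightarrow>\<^sub>M count_space UNIV"
    "\<And>y. \<exists>w\<in>?W2. g2 y = label w \<and>
      (\<forall>w'\<in>?W2. (\<Sum>t<n. (cmod (y t - ?s2 w (c t)))\<^sup>2) \<le> (\<Sum>t<n. (cmod (y t - ?s2 w' (c t)))\<^sup>2))"
    by (rule min_distance_decoder[OF fin(2) ne(2), where n = n and s = "\<lambda>w t. ?s2 w (c t)" and l = label]) (rule that; blast)
  define f1 where "f1 m0 m1 t = (clip (c t (0, m0)) + clip (c t (2, (m1 - 1) div K1p))
      + complex_of_real p1 * clip (c t (3, (m1 - 1) mod K1p))) / 3" for m0 m1 t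
  define f2 where "f2 m0 m2 t = (clip (c t (1, m0)) + clip (c t (4, (m2 - 1) div K2p))
      + complex_of_real p2 * clip (c t (5, (m2 - 1) mod K2p))) / 3" for m0 m2 t
  have "valid_code n K0 K1 K2 f1 f2 g1 g2"
    unfolding valid_code_def
    using \<open>n > 0\<close> g1(1) g2(1) cmod_sum3_le cmod_clip p
    by (intro conjI average_power_le_1) (auto simp: f1_def f2_def)
  moreover have "err_prob h11 h12 h21 h22 n K0 K1 K2 f1 f2 g1 g2 \<le> F c"
    unfolding err_prob_def F_def
  proof (intro mult_left_mono sum_mono)
    fix m0 m1 m2 assume m: "m0 \<in> {1..K0}" "m1 \<in> {1..K1}" "m2 \<in> {1..K2}"
    let ?y1 = "rx n h11 h12 (f1 m0 m1) (f2 m0 m2)" and ?y2 = "rx n h21 h22 (f1 m0 m1) (f2 m0 m2)"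
    \<comment> \<open>The private letter of the interfering user arrives with modulus at most 1, by
      the scaling of its power. It is the sequence \<open>i\<close> of \<open>decoder_error\<close>,
      which the decoder ignores.\<close>
    have small: "cmod (h / 3 * (complex_of_real p * clip z)) \<le> 1" if "cmod h * p \<le> 1" "p > 0" for h p z
    proof -
      have "cmod h * p * cmod (clip z) \<le> 1 * 1"
        using that cmod_clip by (intro mult_mono) auto
      then show ?thesis
        using that by (simp add: norm_mult norm_divide mult_ac)
    qed
    have "measure (noise n) {zz \<in> space (noise n). g1 (?y1 (fst zz)) \<noteq> (m0, m1) \<or> g2 (?y2 (snd zz)) \<noteq> (m0, m2)}
      \<le> \<P>(z in noise1 n. g1 (?y1 z) \<noteq> (m0, m1))
        + \<P>(z in noise1 n. g2 (?y2 z) \<noteq> (m0, m2))"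
      by (intro prob_noise_disj(1) decoder_error_sets g1 g2)
    also have "\<dots> \<le> cf1 m0 m1 m2 c + cf2 m0 m1 m2 c"
    proof (rule add_mono)
      have "\<P>(z in noise1 n. g1 (?y1 z) \<noteq> label (m0, m1, (m2 - 1) div K2p)) \<le> cf1 m0 m1 m2 c"
        unfolding cf1_def confusion_def[OF set1]
      proof (rule decoder_error[OF fin(1) w1[OF m] g1(2)])
        show "cmod (h12 / 3 * (complex_of_real p2 * clip (c t (5, (m2 - 1) mod K2p)))) \<le> 1" for t
          using p by (intro small) auto
        show "?y1 z t = ?s1 (m0, m1, (m2 - 1) div K2p) (c t)
          + h12 / 3 * (complex_of_real p2 * clip (c t (5, (m2 - 1) mod K2p))) + z t" if "t < n" for z t
          using that unfolding rx_def code_signal_def[OF set1] rx_signal_def split_index_def f1_def f2_def prod.case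
          by (simp add: algebra_simps add_divide_distrib)
      qed
      then show "\<P>(z in noise1 n. g1 (?y1 z) \<noteq> (m0, m1)) \<le> cf1 m0 m1 m2 c"
        by (simp add: label_def[OF set1])
      have "\<P>(z in noise1 n. g2 (?y2 z) \<noteq> label (m0, m2, (m1 - 1) div K1p)) \<le> cf2 m0 m1 m2 c"
        unfolding cf2_def confusion_def[OF set2]
      proof (rule decoder_error[OF fin(2) w2[OF m] g2(2)])
        show "cmod (h21 / 3 * (complex_of_real p1 * clip (c t (3, (m1 - 1) mod K1p)))) \<le> 1" for t
          using p by (intro small) auto
        show "?y2 z t = ?s2 (m0, m2, (m1 - 1) div K1p) (c t)
          + h21 / 3 * (complex_of_real p1 * clip (c t (3, (m1 - 1) mod K1p))) + z t" if "t < n" for z t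
          using that unfolding rx_def code_signal_def[OF set2] rx_signal_def split_index_def f1_def f2_def prod.case
          by (simp add: algebra_simps add_divide_distrib)
      qed
      then show "\<P>(z in noise1 n. g2 (?y2 z) \<noteq> (m0, m2)) \<le> cf2 m0 m1 m2 c"
        by (simp add: label_def[OF set2])
    qed
    finally show "measure (noise n) {zz \<in> space (noise n). g1 (?y1 (fst zz)) \<noteq> (m0, m1) \<or> g2 (?y2 (snd zz)) \<noteq> (m0, m2)}
      \<le> cf m0 m1 m2 c"
      unfolding cf_def .
  qed simp
  ultimately show ?thesis
    using Fc unfolding B_def by (meson order_trans)
qed

section \<open>Achievable rates\<close>

lemma msgs_0 [simp]: "msgs n 0 = 1"
  by (simp add: msgs_def)

lemma msgs_ge: "2 powr (real n * R) \<le> real (msgs n R)"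
  unfolding msgs_def by (simp add: le_of_int_ceiling)

lemma msgs_pos: "msgs n R > 0"
proof -
  have "0 < real (msgs n R)"
    using msgs_ge[of n R] by (rule less_le_trans[rotated]) simp
  then show ?thesis by simp
qed

lemma msgs_le:
  assumes "R \<ge> 0"
  shows "real (msgs n R) \<le> 2 * (2 powr R) ^ n"
proof -
  have "real (msgs n R) \<le> 2 powr (real n * R) + 1"
    unfolding msgs_def using of_int_ceiling_le_add_one[of "2 powr (real n * R)"]
    by (simp add: of_nat_nat)
  also have "1 \<le> 2 powr (real n * R)"
    using assms by (simp add: ge_one_powr_ge_zero)
  finally show ?thesis
    by (simp add: powr_realpow[symmetric] powr_powr mult.commute)
qed

text \<open>Rounding up goes in the favourable direction: every message of rate \<open>R + S\<close>
  fits into a pair of digits.\<close>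

lemma msgs_add_le: "msgs n (R + S) \<le> msgs n R * msgs n S"
proof -
  have "2 powr (real n * (R + S)) = 2 powr (real n * R) * 2 powr (real n * S)"
    by (simp add: distrib_left powr_add)
  also have "\<dots> \<le> real (msgs n R) * real (msgs n S)"
    by (intro mult_mono msgs_ge) auto
  finally have "\<lceil>2 powr (real n * (R + S))\<rceil> \<le> int (msgs n R * msgs n S)"
    by (simp add: ceiling_le_iff)
  then show ?thesis
    unfolding msgs_def[of n "R + S"] by (metis nat_int nat_mono)
qed

text \<open>Each condition says that the geometric base of the corresponding term of
  \<open>rx_bound\<close> is below 1. Its premise matches the case distinction there, because rate 0
  means exactly one message.\<close>

definition rx_ok :: "complex \<Rightarrow> complex \<Rightarrow> real \<Rightarrow> real \<Rightarrow> real \<Rightarrow> real \<Rightarrow> real \<Rightarrow> bool" where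
  "rx_ok a b p R0 Rc Rp Rc' \<longleftrightarrow>
     (R0 > 0 \<or> Rc > 0 \<longrightarrow> 2 powr (R0 + (Rc + Rp) + Rc') * min (gain_bound a) (gain_bound b) < 1) \<and>
     (Rc > 0 \<longrightarrow> 2 powr (Rc + Rp) * gain_bound a < 1) \<and>
     (Rp > 0 \<longrightarrow> 2 powr Rp * gain_bound (a * p) < 1) \<and>
     (Rp > 0 \<longrightarrow> 2 powr (Rp + Rc') * min (gain_bound (a * p)) (gain_bound b) < 1)"

lemma tendsto_zero_geometric_bound:
  assumes "\<And>n. 0 \<le> f n" "\<And>n. f n \<le> C * q ^ n" "0 \<le> q" "q < (1::real)"
  shows "f \<longlonglongrightarrow> 0"
proof (rule tendsto_sandwich[of "\<lambda>_. 0" _ _ "\<lambda>n. C * q ^ n"])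
  show "(\<lambda>n. C * q ^ n) \<longlonglongrightarrow> 0"
    using tendsto_mult[OF tendsto_const LIMSEQ_realpow_zero[OF assms(3,4)], of C] by simp
qed (use assms in auto)

lemma rx_bound_tendsto_zero:
  assumes R: "R0 \<ge> 0" "Rc \<ge> 0" "Rp \<ge> 0" "Rc' \<ge> 0" and ok: "rx_ok a b p R0 Rc Rp Rc'"
  shows "(\<lambda>n. rx_bound n (msgs n R0) (msgs n (Rc + Rp)) (msgs n Rc) (msgs n Rp) (msgs n Rc') a b p) \<longlonglongrightarrow> 0"
proof -
  have geo: "(\<lambda>n. if P n then real (k n) * g ^ n else 0) \<longlonglongrightarrow> 0"
    if Q: "Q \<longrightarrow> 2 powr S * g < 1" "\<And>n. P n \<Longrightarrow> Q" and k: "\<And>n. real (k n) \<le> C * (2 powr S) ^ n" and g: "g \<ge> 0"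
    for P :: "nat \<Rightarrow> bool" and Q k C S g
  proof (cases Q)
    case True
    have C: "C \<ge> 0" using k[of 0] by simp
    show ?thesis
    proof (rule tendsto_zero_geometric_bound)
      fix n
      show "0 \<le> (if P n then real (k n) * g ^ n else 0)" using g by simp
      have "real (k n) * g ^ n \<le> C * (2 powr S) ^ n * g ^ n"
        using k g by (intro mult_right_mono) auto
      then show "(if P n then real (k n) * g ^ n else 0) \<le> C * (2 powr S * g) ^ n"
        using C g by (simp add: power_mult_distrib mult.assoc)
    qed (use True Q g in auto)
  next
    case False
    then have "\<not> P n" for n using Q(2) by blast
    then show ?thesis by simp
  qed
  have gt: "R > 0" if "msgs n R > 1" "R \<ge> 0" for n R
    using that by (cases "R = 0") auto
  have l1: "real (msgs n R0 * msgs n (Rc + Rp) * msgs n Rc') \<le> 8 * (2 powr (R0 + (Rc + Rp) + Rc')) ^ n" for n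
  proof -
    have "real (msgs n R0) * real (msgs n (Rc + Rp)) * real (msgs n Rc')
      \<le> (2 * (2 powr R0) ^ n) * (2 * (2 powr (Rc + Rp)) ^ n) * (2 * (2 powr Rc') ^ n)"
      using R by (intro mult_mono msgs_le) auto
    then show ?thesis by (simp add: powr_add power_mult_distrib mult_ac)
  qed
  have l2: "real (msgs n Rp * msgs n Rc') \<le> 4 * (2 powr (Rp + Rc')) ^ n" for n
  proof -
    have "real (msgs n Rp) * real (msgs n Rc') \<le> (2 * (2 powr Rp) ^ n) * (2 * (2 powr Rc') ^ n)"
      using R by (intro mult_mono msgs_le) auto
    then show ?thesis by (simp add: powr_add power_mult_distrib mult_ac)
  qed
  have t1: "(\<lambda>n. if msgs n R0 > 1 \<or> msgs n Rc > 1 then real (msgs n R0 * msgs n (Rc + Rp) * msgs n Rc') * min (gain_bound a) (gain_bound b) ^ n else 0) \<longlonglongrightarrow> 0"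
    by (rule geo[where Q = "R0 > 0 \<or> Rc > 0", OF _ _ l1]) (use ok R gt in \<open>auto simp: rx_ok_def\<close>)
  have t2: "(\<lambda>n. if msgs n Rc > 1 then real (msgs n (Rc + Rp)) * gain_bound a ^ n else 0) \<longlonglongrightarrow> 0"
    by (rule geo[where Q = "Rc > 0", OF _ _ msgs_le]) (use ok R gt in \<open>auto simp: rx_ok_def\<close>)
  have t3: "(\<lambda>n. if msgs n Rp > 1 then real (msgs n Rp) * gain_bound (a * p) ^ n else 0) \<longlonglongrightarrow> 0"
    by (rule geo[where Q = "Rp > 0", OF _ _ msgs_le]) (use ok R gt in \<open>auto simp: rx_ok_def\<close>)
  have t4: "(\<lambda>n. if msgs n Rp > 1 then real (msgs n Rp * msgs n Rc') * min (gain_bound (a * p)) (gain_bound b) ^ n else 0) \<longlonglongrightarrow> 0"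
    by (rule geo[where Q = "Rp > 0", OF _ _ l2]) (use ok R gt in \<open>auto simp: rx_ok_def\<close>)
  show ?thesis
    unfolding rx_bound_def using tendsto_add[OF tendsto_add[OF tendsto_add[OF t1 t2] t3] t4] by simp
qed

lemma achievable_split:
  assumes R: "R0 \<ge> 0" "R1c \<ge> 0" "R1p \<ge> 0" "R2c \<ge> 0" "R2p \<ge> 0"
    and nz: "h11 \<noteq> 0" "h12 \<noteq> 0" "h21 \<noteq> 0" "h22 \<noteq> 0"
    and p: "0 < p1" "p1 \<le> 1" "0 < p2" "p2 \<le> 1" "cmod h21 * p1 \<le> 1" "cmod h12 * p2 \<le> 1"
    and ok: "rx_ok h11 h12 p1 R0 R1c R1p R2c" "rx_ok h22 h21 p2 R0 R2c R2p R1c"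
  shows "achievable h11 h12 h21 h22 R0 (R1c + R1p) (R2c + R2p)"
proof -
  let ?K0 = "\<lambda>n. msgs n R0" and ?K1 = "\<lambda>n. msgs n (R1c + R1p)" and ?K2 = "\<lambda>n. msgs n (R2c + R2p)"
  \<comment> \<open>The slack of \<open>exists_code\<close> is taken as \<open>1 / real n\<close>,
    so that it vanishes in the limit too.\<close>
  let ?B = "\<lambda>n. rx_bound n (?K0 n) (?K1 n) (msgs n R1c) (msgs n R1p) (msgs n R2c) h11 h12 p1
    + rx_bound n (?K0 n) (?K2 n) (msgs n R2c) (msgs n R2p) (msgs n R1c) h22 h21 p2 + 1 / real n"
  have "\<exists>f1 f2 g1 g2. valid_code n (?K0 n) (?K1 n) (?K2 n) f1 f2 g1 g2 \<and>
    err_prob h11 h12 h21 h22 n (?K0 n) (?K1 n) (?K2 n) f1 f2 g1 g2 \<le> ?B n" if "n > 0" for n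
    using that nz p by (intro exists_code msgs_pos msgs_add_le) auto
  then obtain f1 f2 g1 g2 where code: "\<And>n. n > 0 \<Longrightarrow> valid_code n (?K0 n) (?K1 n) (?K2 n) (f1 n) (f2 n) (g1 n) (g2 n)"
    "\<And>n. n > 0 \<Longrightarrow> err_prob h11 h12 h21 h22 n (?K0 n) (?K1 n) (?K2 n) (f1 n) (f2 n) (g1 n) (g2 n) \<le> ?B n"
    by metis
  have "?B \<longlonglongrightarrow> 0 + 0 + 0"
    using R ok by (intro tendsto_add rx_bound_tendsto_zero lim_inverse_n'[unfolded inverse_eq_divide]) auto
  then have B: "?B \<longlonglongrightarrow> 0" by simp
  have "(\<lambda>n. err_prob h11 h12 h21 h22 n (?K0 n) (?K1 n) (?K2 n) (f1 n) (f2 n) (g1 n) (g2 n)) \<longlonglongrightarrow> 0"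
  proof (rule tendsto_sandwich[OF _ _ tendsto_const B])
    show "\<forall>\<^sub>F n in sequentially. 0 \<le> err_prob h11 h12 h21 h22 n (?K0 n) (?K1 n) (?K2 n) (f1 n) (f2 n) (g1 n) (g2 n)"
      unfolding err_prob_def by (intro always_eventually allI mult_nonneg_nonneg sum_nonneg) auto
    show "\<forall>\<^sub>F n in sequentially. err_prob h11 h12 h21 h22 n (?K0 n) (?K1 n) (?K2 n) (f1 n) (f2 n) (g1 n) (g2 n) \<le> ?B n"
      using code(2) by (auto intro: eventually_sequentiallyI[of 1])
  qed
  then show ?thesis
    unfolding achievable_def using R code(1) by (intro conjI exI[of _ f1] exI[of _ f2] exI[of _ g1] exI[of _ g2]) auto
qed

section \<open>Achievability of the polytope\<close>

text \<open>Backing off by this constant from the target number of bits makes all error exponents negative and does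
  not change the degrees of freedom.\<close>

definition rate_loss :: real where
  "rate_loss = max 0 (log 2 (9 * letter_const)) + 1"

text \<open>The truncation keeps this a rate. A positive value carries the whole
  \<open>rate_loss\<close>, and this is the property used for the error exponents.\<close>

definition dof_rate :: "real \<Rightarrow> real \<Rightarrow> real" where
  "dof_rate P d = max 0 (d * log 2 P - rate_loss)"

lemma rate_loss_pos: "rate_loss > 0"
  by (simp add: rate_loss_def)

lemma rate_loss_gain: "9 * letter_const < 2 powr rate_loss"
proof -
  have "9 * letter_const = 2 powr (log 2 (9 * letter_const))"
    using letter_const_pos by simp
  also have "\<dots> < 2 powr rate_loss"
    by (intro powr_less_mono) (auto simp: rate_loss_def)
  finally show ?thesis .
qed

lemma dof_rate_nonneg [simp]: "dof_rate P d \<ge> 0"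
  by (simp add: dof_rate_def)

lemma dof_rate_le: "dof_rate P d \<le> d * log 2 P" if "P \<ge> 1" "d \<ge> 0"
  using that rate_loss_pos by (auto simp: dof_rate_def)

lemma dof_rate_pos_le: "dof_rate P d = d * log 2 P - rate_loss" if "dof_rate P d > 0"
  using that by (simp add: dof_rate_def max_def split: if_splits)

lemma dof_rate_pos: "d > 0" if "dof_rate P d > 0" "P \<ge> 1"
proof (rule ccontr)
  assume "\<not> d > 0"
  then have "d * log 2 P \<le> 0"
    using that by (simp add: mult_nonpos_nonneg)
  then show False using that rate_loss_pos by (simp add: dof_rate_def max_def split: if_splits)
qed

lemma tendsto_dof_rate:
  assumes "d \<ge> 0"
  shows "((\<lambda>P. dof_rate P d / log 2 P) \<longlongrightarrow> d) at_top"
proof -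
  have "((\<lambda>P. rate_loss / log 2 P) \<longlongrightarrow> 0) at_top"
    by (intro tendsto_divide_0[OF tendsto_const] filterlim_at_top_imp_at_infinity) real_asymp
  then have "((\<lambda>P. max 0 (d - rate_loss / log 2 P)) \<longlongrightarrow> max 0 (d - 0)) at_top"
    by (intro tendsto_max tendsto_diff tendsto_const)
  then have "((\<lambda>P. max 0 (d - rate_loss / log 2 P)) \<longlongrightarrow> d) at_top"
    using assms by simp
  moreover have "\<forall>\<^sub>F P in at_top. max 0 (d - rate_loss / log 2 P) = dof_rate P d / log 2 P"
    using eventually_gt_at_top[of 1]
  proof eventually_elim
    case (elim P)
    then have "log 2 P > 0" by simp
    then show ?case by (simp add: dof_rate_def max_def field_simps)
  qed
  ultimately show ?thesis by (rule Lim_transform_eventually)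
qed

lemma powr_half_square: "(P powr (e / 2))\<^sup>2 = P powr e" for P e :: real
proof -
  have "(P powr (e / 2))\<^sup>2 = P powr (e / 2 + e / 2)"
    by (simp only: power2_eq_square powr_add)
  then show ?thesis by (simp only: field_sum_of_halves)
qed

lemma rate_times_gain_bound:
  assumes "P \<ge> 1" "S \<le> e * log 2 P - rate_loss" "g \<le> 9 * letter_const * P powr - e"
  shows "2 powr S * g < 1"
proof -
  have eq: "2 powr (e * log 2 P) = P powr e"
    using assms(1) by (simp add: powr_def log_def)
  have "2 powr S \<le> 2 powr (e * log 2 P - rate_loss)"
    using assms(2) by (intro powr_mono) auto
  also have "\<dots> = P powr e / 2 powr rate_loss"
    by (simp add: powr_diff eq)
  finally have le: "2 powr S \<le> P powr e / 2 powr rate_loss" .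
  have "2 powr S * g \<le> 2 powr S * (9 * letter_const * P powr - e)"
    using assms(3) by (intro mult_left_mono) auto
  also have "\<dots> \<le> P powr e / 2 powr rate_loss * (9 * letter_const * P powr - e)"
    using le letter_const_pos by (intro mult_right_mono) auto
  also have "\<dots> = 9 * letter_const / 2 powr rate_loss"
    using assms(1) by (simp add: powr_minus field_simps)
  also have "\<dots> < 1"
    using rate_loss_gain by (simp add: divide_less_eq)
  finally show ?thesis .
qed

text \<open>A condition of \<open>rx_ok\<close> applies only if some rate in its sum is positive.
  That rate carries a full \<open>rate_loss\<close> and the others are at most their degrees of
  freedom times \<open>log 2 P\<close>, so every sum contains the one loss it needs.
  \<open>\<gamma>\<close> stands for the exponent of the cross link by which the private power is
  scaled down.\<close>

lemma rx_ok_dof: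
  assumes P: "P \<ge> 1" and a: "(cmod a)\<^sup>2 = P powr \<alpha>" and b: "(cmod b)\<^sup>2 = P powr \<beta>" and p: "p = P powr (- \<gamma> / 2)"
    and d: "d0 \<ge> 0" "dc \<ge> 0" "dp \<ge> 0" "dc' \<ge> 0"
    and dof: "d0 + dc + dp + dc' \<le> max \<alpha> \<beta>" "dc + dp \<le> \<alpha>"
      "dp \<le> max 0 (\<alpha> - \<gamma>)" "dp + dc' \<le> max (\<alpha> - \<gamma>) \<beta>"
  shows "rx_ok a b p (dof_rate P d0) (dof_rate P dc) (dof_rate P dp) (dof_rate P dc')"
proof -
  have G: "gain_bound g = 9 * letter_const * P powr - e" if "(cmod g)\<^sup>2 = P powr e" for g e
    by (simp only: gain_bound_def that powr_minus divide_inverse)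
  have Ga: "gain_bound a = 9 * letter_const * P powr - \<alpha>" and Gb: "gain_bound b = 9 * letter_const * P powr - \<beta>"
    by (rule G[OF a], rule G[OF b])
  have "(cmod (complex_of_real p))\<^sup>2 = P powr - \<gamma>"
    by (simp only: norm_of_real power2_abs p powr_half_square)
  then have "(cmod (a * p))\<^sup>2 = P powr (\<alpha> + - \<gamma>)"
    by (simp only: norm_mult power_mult_distrib a powr_add)
  then have "(cmod (a * p))\<^sup>2 = P powr (\<alpha> - \<gamma>)"
    by simp
  note Gap = G[OF this]
  have Gmin: "min (9 * letter_const * P powr - e) (9 * letter_const * P powr - f) \<le> 9 * letter_const * P powr - max e f" for e f
    by (rule linorder_le_cases[of e f]) (simp_all only: max_absorb1 max_absorb2 min.cobounded1 min.cobounded2)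
  have L: "log 2 P \<ge> 0" using P by simp
  note le = dof_rate_le[OF P]
  have mono: "S \<le> e * log 2 P - rate_loss" if "S \<le> D * log 2 P - rate_loss" "D \<le> e" for S D e
    using that mult_right_mono[OF that(2) L] by linarith
  have le0: "dof_rate P d0 \<le> d0 * log 2 P" and lec: "dof_rate P dc \<le> dc * log 2 P"
    and lep: "dof_rate P dp \<le> dp * log 2 P" and lec': "dof_rate P dc' \<le> dc' * log 2 P"
    by (rule le[OF d(1)], rule le[OF d(2)], rule le[OF d(3)], rule le[OF d(4)])
  show ?thesis
    unfolding rx_ok_def Ga Gb Gap
  proof (intro conjI impI)
    assume "dof_rate P d0 > 0 \<or> dof_rate P dc > 0"
    then have "dof_rate P d0 + (dof_rate P dc + dof_rate P dp) + dof_rate P dc' \<le> (d0 + dc + dp + dc') * log 2 P - rate_loss"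
    proof
      assume "dof_rate P d0 > 0"
      from dof_rate_pos_le[OF this] show ?thesis
        using lec lep lec' unfolding distrib_right by linarith
    next
      assume "dof_rate P dc > 0"
      from dof_rate_pos_le[OF this] show ?thesis
        using le0 lep lec' unfolding distrib_right by linarith
    qed
    from mono[OF this dof(1)]
    show "2 powr (dof_rate P d0 + (dof_rate P dc + dof_rate P dp) + dof_rate P dc')
      * min (9 * letter_const * P powr - \<alpha>) (9 * letter_const * P powr - \<beta>) < 1"
      by (rule rate_times_gain_bound[OF P _ Gmin])
  next
    assume *: "dof_rate P dc > 0"
    have "dof_rate P dc + dof_rate P dp \<le> (dc + dp) * log 2 P - rate_loss"
      using dof_rate_pos_le[OF *] lep unfolding distrib_right by linarith
    from mono[OF this dof(2)]
    show "2 powr (dof_rate P dc + dof_rate P dp) * (9 * letter_const * P powr - \<alpha>) < 1"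
      by (rule rate_times_gain_bound[OF P]) simp
  next
    assume *: "dof_rate P dp > 0"
    \<comment> \<open>A positive private rate forces \<open>dp > 0\<close>, which excludes the value
      0 of the maximum.\<close>
    then have "dp \<le> \<alpha> - \<gamma>"
      using dof_rate_pos[OF * P] dof(3) by linarith
    from mono[OF _ this, of "dof_rate P dp"]
    have "dof_rate P dp \<le> (\<alpha> - \<gamma>) * log 2 P - rate_loss"
      by (simp add: dof_rate_pos_le[OF *])
    then show "2 powr dof_rate P dp * (9 * letter_const * P powr - (\<alpha> - \<gamma>)) < 1"
      by (rule rate_times_gain_bound[OF P]) simp
    have "dof_rate P dp + dof_rate P dc' \<le> (dp + dc') * log 2 P - rate_loss"
      using dof_rate_pos_le[OF *] lec' unfolding distrib_right by linarith
    from mono[OF this dof(4)]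
    show "2 powr (dof_rate P dp + dof_rate P dc')
      * min (9 * letter_const * P powr - (\<alpha> - \<gamma>)) (9 * letter_const * P powr - \<beta>) < 1"
      by (rule rate_times_gain_bound[OF P _ Gmin])
  qed
qed

text \<open>Fourier-Motzkin elimination: \<open>x\<close> and \<open>y\<close> are the private degrees of freedom of the two users. Only
  \<open>x\<close>, \<open>y\<close> and \<open>x - y\<close> are constrained.\<close>

lemma split_dof:
  fixes a11 a12 a21 a22 d0 d1 d2 :: real
  assumes a: "a11 \<ge> 0" "a12 \<ge> 0" "a21 \<ge> 0" "a22 \<ge> 0" and "(d0, d1, d2) \<in> GDoF_formula a11 a12 a21 a22"
  obtains x y where "0 \<le> x" "x \<le> d1" "x \<le> max 0 (a11 - a21)" "0 \<le> y" "y \<le> d2" "y \<le> max 0 (a22 - a12)"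
    "d0 + d1 + (d2 - y) \<le> max a11 a12" "d0 + d2 + (d1 - x) \<le> max a22 a21"
    "x + (d2 - y) \<le> max (a11 - a21) a12" "y + (d1 - x) \<le> max (a22 - a12) a21"
proof -
  define A1 A2 E1 E2 G1 G2 where defs: "A1 = max 0 (a11 - a21)" "A2 = max 0 (a22 - a12)"
    "E1 = max (a11 - a21) a12" "E2 = max (a22 - a12) a21" "G1 = max a11 a12" "G2 = max a22 a21"
  have f: "d0 \<ge> 0" "d1 \<ge> 0" "d2 \<ge> 0" "d0 + d1 \<le> G1" "d0 + d2 \<le> G2" "d1 \<le> a11" "d2 \<le> a22"
    "d1 + d2 \<le> E1 + E2" "d0 + d1 + d2 \<le> A1 + G2" "d0 + d1 + d2 \<le> A2 + G1"
    "d0 + 2 * d1 + d2 \<le> A1 + G1 + E2" "d0 + d1 + 2 * d2 \<le> A2 + G2 + E1"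
    using assms(5) by (auto simp: GDoF_formula_def pos_part_def Let_def defs)
  have g: "0 \<le> A1" "0 \<le> A2" "A1 \<le> E1" "A2 \<le> E2" "a22 \<le> A2 + E1" "a11 \<le> A1 + E2"
    using a by (auto simp: defs max_def)
  define lx ux ly uy where u: "lx = max 0 (d0 + d1 + d2 - G2)" "ux = min A1 d1"
    "ly = max 0 (d0 + d1 + d2 - G1)" "uy = min A2 d2"
  \<comment> \<open>The intervals for \<open>x\<close> and for \<open>y\<close> are nonempty and
    compatible with the one for \<open>x - y\<close>, which is nonempty by \<open>f(8)\<close>.
    Together this consumes all nine facets of the polytope.\<close>
  have 1: "lx \<le> ux" "ly \<le> uy" "lx - uy \<le> E1 - d2" "d1 - E2 \<le> ux - ly"
    using f g unfolding u by linarith+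
  \<comment> \<open>\<open>x\<close> is as large as its interval and the largest \<open>y\<close>
    allow; \<open>y\<close> is then taken as small as possible.\<close>
  define x where "x = min ux (uy + E1 - d2)"
  define y where "y = max ly (x - (E1 - d2))"
  have "lx \<le> x" "x \<le> ux" "ly \<le> y" "y \<le> uy" "x - y \<le> E1 - d2" "d1 - E2 \<le> x - y"
    using 1 f(8) unfolding x_def y_def by linarith+
  then show thesis
    using that[of x y] unfolding u by (auto simp flip: defs)
qed

lemma GDoF_formula_subset_region:
  assumes a: "a11 \<ge> 0" "a12 \<ge> 0" "a21 \<ge> 0" "a22 \<ge> 0"
  shows "GDoF_formula a11 a12 a21 a22 \<subseteq> GDoF_region a11 a12 a21 a22"
proof
  fix d assume "d \<in> GDoF_formula a11 a12 a21 a22"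
  then obtain d0 d1 d2 where d: "d = (d0, d1, d2)" and mem: "(d0, d1, d2) \<in> GDoF_formula a11 a12 a21 a22"
    by (cases d) auto
  have nn: "d0 \<ge> 0" "d1 \<ge> 0" "d2 \<ge> 0" "d1 \<le> a11" "d2 \<le> a22"
    using mem by (auto simp: GDoF_formula_def Let_def)
  obtain x y where xy: "0 \<le> x" "x \<le> d1" "x \<le> max 0 (a11 - a21)" "0 \<le> y" "y \<le> d2" "y \<le> max 0 (a22 - a12)"
    "d0 + d1 + (d2 - y) \<le> max a11 a12" "d0 + d2 + (d1 - x) \<le> max a22 a21"
    "x + (d2 - y) \<le> max (a11 - a21) a12" "y + (d1 - x) \<le> max (a22 - a12) a21"
    by (rule split_dof[OF a mem]) blast
  have "\<exists>R0 R1 R2 :: real \<Rightarrow> real.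
      (\<forall>P>0. (R0 P, R1 P, R2 P) \<in> capacity_region (h11 P) (h12 P) (h21 P) (h22 P)) \<and>
      ((\<lambda>P. R0 P / log 2 P) \<longlongrightarrow> d0) at_top \<and>
      ((\<lambda>P. R1 P / log 2 P) \<longlongrightarrow> d1) at_top \<and>
      ((\<lambda>P. R2 P / log 2 P) \<longlongrightarrow> d2) at_top"
    if h: "\<forall>P>0. (cmod (h11 P))\<^sup>2 = P powr a11 \<and> (cmod (h12 P))\<^sup>2 = P powr a12 \<and>
        (cmod (h21 P))\<^sup>2 = P powr a21 \<and> (cmod (h22 P))\<^sup>2 = P powr a22" for h11 h12 h21 h22 :: "real \<Rightarrow> complex"
  proof (intro exI conjI allI impI)
    let ?R1 = "\<lambda>P. dof_rate P (d1 - x) + dof_rate P x" and ?R2 = "\<lambda>P. dof_rate P (d2 - y) + dof_rate P y"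
    have "((\<lambda>P. dof_rate P (d1 - x) / log 2 P + dof_rate P x / log 2 P) \<longlongrightarrow> (d1 - x) + x) at_top"
      using xy by (intro tendsto_add tendsto_dof_rate) auto
    then show "((\<lambda>P. ?R1 P / log 2 P) \<longlongrightarrow> d1) at_top"
      by (simp add: add_divide_distrib)
    have "((\<lambda>P. dof_rate P (d2 - y) / log 2 P + dof_rate P y / log 2 P) \<longlongrightarrow> (d2 - y) + y) at_top"
      using xy by (intro tendsto_add tendsto_dof_rate) auto
    then show "((\<lambda>P. ?R2 P / log 2 P) \<longlongrightarrow> d2) at_top"
      by (simp add: add_divide_distrib)
    show "((\<lambda>P. dof_rate P d0 / log 2 P) \<longlongrightarrow> d0) at_top"
      using nn by (intro tendsto_dof_rate)
    fix P :: real assume "P > 0"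
    \<comment> \<open>The minimum with 1 matters for \<open>P < 1\<close>, where the inverse of the
      cross gain would violate the power constraint.\<close>
    define p1 where "p1 = min 1 (P powr (- a21 / 2))"
    define p2 where "p2 = min 1 (P powr (- a12 / 2))"
    have hP: "(cmod (h11 P))\<^sup>2 = P powr a11" "(cmod (h12 P))\<^sup>2 = P powr a12"
      "(cmod (h21 P))\<^sup>2 = P powr a21" "(cmod (h22 P))\<^sup>2 = P powr a22"
      using h \<open>P > 0\<close> by auto
    have nz: "h11 P \<noteq> 0" "h12 P \<noteq> 0" "h21 P \<noteq> 0" "h22 P \<noteq> 0"
      using hP \<open>P > 0\<close> by auto
    have small: "cmod h * min 1 (P powr (- e / 2)) \<le> 1" if "(cmod h)\<^sup>2 = P powr e" for h e
    proof -
      have "cmod h = P powr (e / 2)"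
      proof (rule power2_eq_imp_eq)
        show "(cmod h)\<^sup>2 = (P powr (e / 2))\<^sup>2"
          by (simp only: that powr_half_square)
      qed auto
      then have "cmod h * P powr (- e / 2) = 1"
        using \<open>P > 0\<close> by (simp add: powr_minus)
      moreover have "cmod h * min 1 (P powr (- e / 2)) \<le> cmod h * P powr (- e / 2)"
        by (intro mult_left_mono) auto
      ultimately show ?thesis by simp
    qed
    have p: "0 < p1" "p1 \<le> 1" "0 < p2" "p2 \<le> 1" "cmod (h21 P) * p1 \<le> 1" "cmod (h12 P) * p2 \<le> 1"
      using \<open>P > 0\<close> small[OF hP(3)] small[OF hP(2)] by (auto simp: p1_def p2_def)
    have "rx_ok (h11 P) (h12 P) p1 (dof_rate P d0) (dof_rate P (d1 - x)) (dof_rate P x) (dof_rate P (d2 - y)) \<and>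
      rx_ok (h22 P) (h21 P) p2 (dof_rate P d0) (dof_rate P (d2 - y)) (dof_rate P y) (dof_rate P (d1 - x))"
    proof (cases "P \<ge> 1")
      case True
      have "P powr (- e / 2) \<le> 1" if "e \<ge> 0" for e
        using powr_mono[of "- e / 2" 0 P] True that by simp
      then have p1: "p1 = P powr (- a21 / 2)" and p2: "p2 = P powr (- a12 / 2)"
        unfolding p1_def p2_def using a by (intro min_absorb2; blast)+
      have "rx_ok (h11 P) (h12 P) p1 (dof_rate P d0) (dof_rate P (d1 - x)) (dof_rate P x) (dof_rate P (d2 - y))"
        by (rule rx_ok_dof[OF True hP(1,2) p1]) (use xy nn in linarith)+
      moreover have "rx_ok (h22 P) (h21 P) p2 (dof_rate P d0) (dof_rate P (d2 - y)) (dof_rate P y) (dof_rate P (d1 - x))"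
        by (rule rx_ok_dof[OF True hP(4,3) p2]) (use xy nn in linarith)+
      ultimately show ?thesis by blast
    next
      case False
      \<comment> \<open>For \<open>P < 1\<close> the logarithm is negative and all rates are 0. The
        premises in \<open>rx_ok\<close> then fail, and the code with one message is accepted
        whatever the gains are.\<close>
      have "dof_rate P e = 0" if "e \<ge> 0" for e
      proof -
        have "log 2 P < 0" using False \<open>P > 0\<close> by simp
        then have "e * log 2 P \<le> 0" using that by (simp add: mult_nonneg_nonpos)
        then show ?thesis using rate_loss_pos by (simp add: dof_rate_def)
      qed
      then show ?thesis
        using xy nn by (simp add: rx_ok_def)
    qed
    then have "achievable (h11 P) (h12 P) (h21 P) (h22 P) (dof_rate P d0) (?R1 P) (?R2 P)"
      using p nz by (intro achievable_split) auto
    then show "(dof_rate P d0, ?R1 P, ?R2 P) \<in> capacity_region (h11 P) (h12 P) (h21 P) (h22 P)"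
      unfolding capacity_region_def by (intro subsetD[OF closure_subset]) simp
  qed
  then show "d \<in> GDoF_region a11 a12 a21 a22"
    unfolding d GDoF_region_def using nn by auto
qed

section \<open>Gaussian mixtures\<close>

text \<open>A crude bound on the second moment of the noise (which is 1).\<close>

definition noise_power :: real where
  "noise_power = 8 * exp (1/4)"

text \<open>Exponentials in the four directions dominate the square, and their expectations are
  known from \<open>nn_integral_CN01_exp\<close>. Four of them, each with mean
  \<open>exp (1/4)\<close>, and the factor 2 give the constant in
  \<open>noise_power\<close>.\<close>

lemma cmod_power2_le_exp:
  "(cmod z)\<^sup>2 \<le> 2 * (exp (Re (cnj 1 * z)) + exp (Re (cnj (-1) * z)) + exp (Re (cnj \<i> * z)) + exp (Re (cnj (-\<i>) * z)))"
proof -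
  have sq: "x\<^sup>2 \<le> 2 * (exp x + exp (- x))" for x :: real
  proof -
    have "x\<^sup>2 / 2 \<le> exp \<bar>x\<bar>"
      using exp_lower_Taylor_quadratic[of "\<bar>x\<bar>"] by simp
    also have "\<dots> \<le> exp x + exp (- x)"
      by (simp add: abs_if)
    finally show ?thesis by simp
  qed
  show ?thesis
    unfolding cmod_power2 using sq[of "Re z"] sq[of "Im z"] by simp
qed

lemma nn_integral_CN01_power2: "(\<integral>\<^sup>+z. (cmod z)\<^sup>2 \<partial>CN01) \<le> ennreal noise_power"
proof -
  let ?e = "\<lambda>d z. ennreal (exp (Re (cnj d * z)))"
  have "(\<integral>\<^sup>+z. (cmod z)\<^sup>2 \<partial>CN01) \<le> (\<integral>\<^sup>+z. 2 * (?e 1 z + ?e (-1) z + ?e \<i> z + ?e (-\<i>) z) \<partial>CN01)"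
  proof (rule nn_integral_mono)
    fix z
    have "ennreal ((cmod z)\<^sup>2) \<le> ennreal (2 * (exp (Re (cnj 1 * z)) + exp (Re (cnj (-1) * z)) + exp (Re (cnj \<i> * z)) + exp (Re (cnj (-\<i>) * z))))"
      by (rule ennreal_leI[OF cmod_power2_le_exp])
    also have "\<dots> = 2 * (?e 1 z + ?e (-1) z + ?e \<i> z + ?e (-\<i>) z)"
      by (subst ennreal_mult'', simp, subst ennreal_plus, simp, simp, subst ennreal_plus, simp, simp, subst ennreal_plus, simp, simp)
        (simp only: ennreal_numeral)
    finally show "ennreal ((cmod z)\<^sup>2) \<le> 2 * (?e 1 z + ?e (-1) z + ?e \<i> z + ?e (-\<i>) z)" .
  qed
  also have "\<dots> = 2 * ((\<integral>\<^sup>+z. ?e 1 z \<partial>CN01) + (\<integral>\<^sup>+z. ?e (-1) z \<partial>CN01) + (\<integral>\<^sup>+z. ?e \<i> z \<partial>CN01) + (\<integral>\<^sup>+z. ?e (-\<i>) z \<partial>CN01))"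
    by (subst nn_integral_cmult, measurable, subst nn_integral_add, measurable, subst nn_integral_add, measurable, subst nn_integral_add, measurable)
  also have "\<dots> = ennreal noise_power"
    unfolding nn_integral_CN01_exp
    by (simp add: noise_power_def numeral_mult_ennreal ennreal_plus[symmetric] del: ennreal_plus)
  finally show ?thesis .
qed

lemma noise_power_pos: "noise_power > 0"
  by (simp add: noise_power_def)

lemma distr_noise1_component:
  assumes "t < n"
  shows "distr (noise1 n) CN01 (\<lambda>z. z t) = CN01"
  unfolding noise1_def by (rule distr_PiM_component) (use assms prob_space_CN01 in auto)

lemma noise1_component_power2:
  assumes "t < n"
  shows "integrable (noise1 n) (\<lambda>z. (cmod (z t))\<^sup>2)" "(\<integral>z. (cmod (z t))\<^sup>2 \<partial>noise1 n) \<le> noise_power"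
proof -
  have m: "(\<lambda>z. z t) \<in> noise1 n \<rightarrow>\<^sub>M CN01"
    unfolding noise1_def using assms by simp
  have "(\<integral>\<^sup>+z. ennreal ((cmod (z t))\<^sup>2) \<partial>noise1 n) = (\<integral>\<^sup>+z. ennreal ((cmod z)\<^sup>2) \<partial>distr (noise1 n) CN01 (\<lambda>z. z t))"
    using m by (subst nn_integral_distr) auto
  also have "\<dots> \<le> ennreal noise_power"
    unfolding distr_noise1_component[OF assms] by (rule nn_integral_CN01_power2)
  finally have le: "(\<integral>\<^sup>+z. ennreal ((cmod (z t))\<^sup>2) \<partial>noise1 n) \<le> ennreal noise_power" .
  have "(\<lambda>z. (cmod (z t))\<^sup>2) \<in> borel_measurable (noise1 n)"
    using measurable_compose[OF m, of "\<lambda>z. (cmod z)\<^sup>2" borel] by simp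
  then show "integrable (noise1 n) (\<lambda>z. (cmod (z t))\<^sup>2)"
    using le by (intro integrableI_bounded) (auto simp: less_top[symmetric] top_unique intro: le_less_trans)
  show "(\<integral>z. (cmod (z t))\<^sup>2 \<partial>noise1 n) \<le> noise_power"
    using le noise_power_pos by (intro integral_real_bounded) auto
qed

lemma distr_noise_fst: "distr (noise n) (noise1 n) fst = noise1 n"
  unfolding noise_eq by (rule noise1.distr_pair_fst)

lemma distr_noise_snd: "distr (noise n) (noise1 n) snd = noise1 n"
proof -
  have "distr (noise n) (noise1 n) snd = distr (distr (noise n) (noise n) (\<lambda>(x, y). (y, x))) (noise1 n) fst"
    unfolding noise_eq by (subst distr_distr) (auto simp: comp_def split_beta')
  also have "distr (noise n) (noise n) (\<lambda>(x, y). (y, x)) = noise n"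
    unfolding noise_eq by (rule noise_pair.distr_pair_swap[symmetric])
  finally show ?thesis by (simp add: distr_noise_fst)
qed

lemma integral_noise_marginal:
  fixes f :: "(nat \<Rightarrow> complex) \<Rightarrow> real"
  assumes f: "f \<in> borel_measurable (noise1 n)" and p: "p = fst \<or> p = snd"
  shows "(\<integral>zz. f (p zz) \<partial>noise n) = (\<integral>z. f z \<partial>noise1 n)"
    and "integrable (noise n) (\<lambda>zz. f (p zz)) \<longleftrightarrow> integrable (noise1 n) f"
proof -
  have m: "p \<in> noise n \<rightarrow>\<^sub>M noise1 n" and d: "distr (noise n) (noise1 n) p = noise1 n"
    using p distr_noise_fst distr_noise_snd unfolding noise_eq by auto
  show "(\<integral>zz. f (p zz) \<partial>noise n) = (\<integral>z. f z \<partial>noise1 n)"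
    using integral_distr[OF m f] by (simp add: d)
  show "integrable (noise n) (\<lambda>zz. f (p zz)) \<longleftrightarrow> integrable (noise1 n) f"
    using integrable_distr_eq[OF m f] by (simp add: d)
qed

section \<open>Block densities, mixtures and their entropies\<close>

definition gauss_density :: "nat \<Rightarrow> (nat \<Rightarrow> complex) \<Rightarrow> real" where
  "gauss_density n u = (\<Prod>t<n. cgauss (u t))"

abbreviation shifted_density :: "nat \<Rightarrow> (nat \<Rightarrow> complex) \<Rightarrow> (nat \<Rightarrow> complex) \<Rightarrow> real" where
  "shifted_density n x y \<equiv> gauss_density n (\<lambda>t. y t - x t)"

lemma gauss_density_pos: "gauss_density n u > 0"
  unfolding gauss_density_def by (intro prod_pos) (simp add: cgauss_pos)

lemma gauss_density_le_1: "gauss_density n u \<le> 1"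
  unfolding gauss_density_def by (intro prod_le_1) (simp add: cgauss_le_1)

lemma ln_gauss_density: "ln (gauss_density n u) = - (\<Sum>t<n. (cmod (u t))\<^sup>2) - real n * ln pi"
  unfolding gauss_density_def by (subst ln_prod) (auto simp: cgauss_pos cgauss_def ln_div sum_subtractf sum_negf)

definition gauss_mix :: "nat \<Rightarrow> 'j set \<Rightarrow> ('j \<Rightarrow> nat \<Rightarrow> complex) \<Rightarrow> (nat \<Rightarrow> complex) \<Rightarrow> real" where
  "gauss_mix n J u y = (1 / real (card J)) * (\<Sum>j\<in>J. shifted_density n (u j) y)"

lemma gauss_mix_pos: "finite J \<Longrightarrow> J \<noteq> {} \<Longrightarrow> gauss_mix n J u y > 0"
  unfolding gauss_mix_def by (intro mult_pos_pos sum_pos) (auto simp: gauss_density_pos card_gt_0_iff)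

lemma gauss_mix_le_1:
  assumes "finite J" "J \<noteq> {}"
  shows "gauss_mix n J u y \<le> 1"
proof -
  have "(\<Sum>j\<in>J. shifted_density n (u j) y) \<le> (\<Sum>j\<in>J. 1)"
    by (intro sum_mono gauss_density_le_1)
  then show ?thesis
    using assms unfolding gauss_mix_def by (simp add: card_gt_0_iff divide_le_eq)
qed

lemma gauss_mix_ge:
  assumes "finite J" "j \<in> J"
  shows "shifted_density n (u j) y / real (card J) \<le> gauss_mix n J u y"
proof -
  have "shifted_density n (u j) y \<le> (\<Sum>j\<in>J. shifted_density n (u j) y)"
    using assms by (intro member_le_sum) (auto intro: less_imp_le gauss_density_pos)
  then show ?thesis
    unfolding gauss_mix_def by (simp add: divide_right_mono)
qed

lemma gauss_density_measurable:
  assumes "\<And>t. t < n \<Longrightarrow> (\<lambda>x. f x t) \<in> borel_measurable M"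
  shows "(\<lambda>x. gauss_density n (f x)) \<in> borel_measurable M"
  unfolding gauss_density_def
  by (intro borel_measurable_prod measurable_compose[OF _ measurable_cgauss] assms) simp

lemma gauss_mix_measurable:
  assumes "\<And>t. t < n \<Longrightarrow> (\<lambda>x. f x t) \<in> borel_measurable M"
  shows "(\<lambda>x. gauss_mix n J u (f x)) \<in> borel_measurable M"
  unfolding gauss_mix_def
  using assms by (intro borel_measurable_times borel_measurable_const borel_measurable_sum gauss_density_measurable borel_measurable_diff) auto

lemma noise1_component_measurable: "t < n \<Longrightarrow> (\<lambda>z. z t) \<in> borel_measurable (noise1 n)"
  using measurable_component_singleton[of t "{..<n}" "\<lambda>_. CN01"]
  by (simp add: noise1_def)

text \<open>Averaged over \<open>j\<close>, this is the negative differential entropy of the noisy signal when \<open>j\<close> is uniform on \<open>J\<close>.\<close>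

definition mix_entropy :: "nat \<Rightarrow> 'j set \<Rightarrow> ('j \<Rightarrow> nat \<Rightarrow> complex) \<Rightarrow> 'j \<Rightarrow> real" where
  "mix_entropy n J u j = (\<integral>z. ln (gauss_mix n J u (\<lambda>t. u j t + z t)) \<partial>noise1 n)"

lemma ln_gauss_mix_measurable:
  "(\<lambda>z. ln (gauss_mix n J u (\<lambda>t. x t + z t))) \<in> borel_measurable (noise1 n)"
  using noise1_component_measurable by (intro borel_measurable_ln gauss_mix_measurable borel_measurable_add) auto

text \<open>Keeping only the component of the true index bounds the logarithm from below by a
  quadratic in the noise; from above it is bounded by 0.\<close>

lemma ln_gauss_mix_integrable:
  assumes "finite J" "j \<in> J"
  shows "integrable (noise1 n) (\<lambda>z. ln (gauss_mix n J u (\<lambda>t. u j t + z t)))"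
proof (rule Bochner_Integration.integrable_bound)
  show "integrable (noise1 n) (\<lambda>z. (\<Sum>t<n. (cmod (z t))\<^sup>2) + (real n * ln pi + ln (real (card J))))"
    by (intro Bochner_Integration.integrable_add Bochner_Integration.integrable_sum noise1_component_power2 noise1.integrable_const) auto
  show "(\<lambda>z. ln (gauss_mix n J u (\<lambda>t. u j t + z t))) \<in> borel_measurable (noise1 n)"
    by (rule ln_gauss_mix_measurable)
  have J: "J \<noteq> {}" "card J > 0" using assms by (auto simp: card_gt_0_iff)
  show "AE z in noise1 n. norm (ln (gauss_mix n J u (\<lambda>t. u j t + z t)))
      \<le> norm ((\<Sum>t<n. (cmod (z t))\<^sup>2) + (real n * ln pi + ln (real (card J))))"
  proof (rule AE_I2)
    fix z :: "nat \<Rightarrow> complex"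
    let ?m = "gauss_mix n J u (\<lambda>t. u j t + z t)"
    have "gauss_density n z / real (card J) \<le> ?m"
      using gauss_mix_ge[OF assms, of n "\<lambda>t. u j t + z t" u] by simp
    then have "ln (gauss_density n z / real (card J)) \<le> ln ?m"
      using gauss_density_pos[of n z] J by (intro ln_mono) auto
    then have "- ((\<Sum>t<n. (cmod (z t))\<^sup>2) + (real n * ln pi + ln (real (card J)))) \<le> ln ?m"
      using gauss_density_pos[of n z] J by (simp add: ln_div ln_gauss_density)
    moreover have "ln ?m \<le> 0"
      using gauss_mix_le_1[OF assms(1) J(1)] gauss_mix_pos[OF assms(1) J(1)] by simp
    ultimately show "norm (ln ?m) \<le> norm ((\<Sum>t<n. (cmod (z t))\<^sup>2) + (real n * ln pi + ln (real (card J))))"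
      unfolding real_norm_def by linarith
  qed
qed

text \<open>The noise density never exceeds 1, so the differential entropies here are nonnegative.
  The converse uses this sign to drop entropy terms that have no partner.\<close>

lemma mix_entropy_le_0:
  assumes "finite J" "j \<in> J"
  shows "mix_entropy n J u j \<le> 0"
proof -
  have "J \<noteq> {}" using assms by auto
  then have "ln (gauss_mix n J u y) \<le> 0" for y
    using gauss_mix_le_1[of J n u y] gauss_mix_pos[of J n u y] assms by simp
  then have "(\<integral>z. - ln (gauss_mix n J u (\<lambda>t. u j t + z t)) \<partial>noise1 n) \<ge> 0"
    by (intro integral_nonneg_AE AE_I2) simp
  then show ?thesis by (simp add: mix_entropy_def)
qed

text \<open>Entropy is invariant under a known shift. With the own messages given, the own signal is
  such a shift, and the entropy of the received block becomes that of the interference.\<close>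

lemma mix_entropy_translate:
  assumes "\<And>j t. j \<in> J \<Longrightarrow> t < n \<Longrightarrow> u j t = w t + u' j t" "j \<in> J"
  shows "mix_entropy n J u j = mix_entropy n J u' j"
proof -
  have "gauss_mix n J u (\<lambda>t. u j t + z t) = gauss_mix n J u' (\<lambda>t. u' j t + z t)" for z
    unfolding gauss_mix_def gauss_density_def using assms
    by (intro arg_cong2[where f = "(*)"] refl sum.cong prod.cong) (auto simp: algebra_simps)
  then show ?thesis by (simp add: mix_entropy_def)
qed

text \<open>The density of \<open>n\<close> independent circular Gaussians of variance
  \<open>v\<close>. The divisor is \<open>v\<close> and not its root because a letter has two real
  coordinates.\<close>

definition gauss_var :: "nat \<Rightarrow> real \<Rightarrow> (nat \<Rightarrow> complex) \<Rightarrow> real" where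
  "gauss_var n v u = (\<Prod>t<n. cgauss ((1 / sqrt v) *\<^sub>R u t) / v)"

lemma gauss_var_pos: "v > 0 \<Longrightarrow> gauss_var n v u > 0"
  unfolding gauss_var_def by (intro prod_pos) (simp add: cgauss_pos)

lemma ln_gauss_var:
  assumes "v > 0"
  shows "ln (gauss_var n v u) = - (\<Sum>t<n. (cmod (u t))\<^sup>2) / v - real n * ln (pi * v)"
proof -
  have "ln (cgauss ((1 / sqrt v) *\<^sub>R u t) / v) = - ((cmod (u t))\<^sup>2 / v) - ln (pi * v)" for t
    using assms by (simp add: cgauss_def ln_div ln_mult power_divide real_sqrt_pow2)
  then show ?thesis
    unfolding gauss_var_def using assms
    by (subst ln_prod) (auto simp: less_imp_neq[OF cgauss_pos, symmetric] cgauss_pos sum_subtractf sum_negf sum_divide_distrib)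
qed

lemma nn_integral_gauss_var:
  assumes "v > 0"
  shows "(\<integral>\<^sup>+y. gauss_var n v (\<lambda>t. y t - x t) \<partial>lebesgue_blocks n) = 1"
proof -
  interpret L: product_sigma_finite "\<lambda>_. lborel :: complex measure"
    by (simp add: product_sigma_finite_def lborel.sigma_finite_measure_axioms)
  let ?g = "\<lambda>t u. ennreal (cgauss ((1 / sqrt v) *\<^sub>R (- x t + u)) / v)"
  have one: "(\<integral>\<^sup>+u. ?g t u \<partial>lborel) = 1" for t
  proof -
    have "(\<integral>\<^sup>+u. ?g t u \<partial>lborel) = (\<integral>\<^sup>+u. ennreal (1 / v) * ennreal (cgauss ((1 / sqrt v) *\<^sub>R (- x t + u))) \<partial>lborel)"
      using assms by (intro nn_integral_cong) (simp flip: ennreal_mult)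
    also have "\<dots> = ennreal (1 / v) * ennreal (1 / (1 / sqrt v)\<^sup>2)"
      using assms nn_integral_cgauss_scaleR[of "1 / sqrt v" "- x t"] by (subst nn_integral_cmult) auto
    also have "\<dots> = 1"
      using assms by (simp add: power_divide flip: ennreal_mult)
    finally show ?thesis .
  qed
  have "(\<integral>\<^sup>+y. (\<Prod>t<n. ?g t (y t)) \<partial>lebesgue_blocks n) = (\<Prod>t<n. \<integral>\<^sup>+u. ?g t u \<partial>lborel)"
    by (rule L.product_nn_integral_prod[where f = ?g]) auto
  also have "\<dots> = 1" by (simp only: one prod.neutral_const)
  finally show ?thesis
    using assms unfolding gauss_var_def by (simp add: prod_ennreal)
qed

lemma nn_integral_gauss_mix:
  assumes "finite J" "J \<noteq> {}"
  shows "(\<integral>\<^sup>+y. gauss_mix n J u y \<partial>lebesgue_blocks n) = 1"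
proof -
  have d: "(\<integral>\<^sup>+y. shifted_density n (u j) y \<partial>lebesgue_blocks n) = 1" for j
    using nn_integral_gauss_var[of 1 n "u j"] by (simp add: gauss_var_def gauss_density_def)
  have m: "(\<lambda>y. ennreal (shifted_density n (u j) y)) \<in> borel_measurable (lebesgue_blocks n)" for j
    by (intro measurable_compose[OF _ measurable_ennreal] gauss_density_measurable) simp
  have "(\<integral>\<^sup>+y. gauss_mix n J u y \<partial>lebesgue_blocks n)
    = (\<integral>\<^sup>+y. ennreal (1 / real (card J)) * (\<Sum>j\<in>J. ennreal (shifted_density n (u j) y)) \<partial>lebesgue_blocks n)"
    unfolding gauss_mix_def
    by (intro nn_integral_cong, subst ennreal_mult)
      (auto simp: sum_ennreal less_imp_le[OF gauss_density_pos] intro!: sum_nonneg)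
  also have "\<dots> = ennreal (1 / real (card J)) * (\<Sum>j\<in>J. 1)"
    using m d by (simp add: nn_integral_cmult nn_integral_sum)
  also have "\<dots> = 1"
    using assms by (simp add: ennreal_of_nat_eq_real_of_nat card_gt_0_iff flip: ennreal_mult)
  finally show ?thesis .
qed

section \<open>The genie-aided inequality at one receiver\<close>

lemma sigma_finite_PiM_lborel: fixes n :: nat shows "sigma_finite_measure (lebesgue_blocks n)"
proof -
  interpret L: product_sigma_finite "\<lambda>_. lborel :: complex measure"
    by (simp add: product_sigma_finite_def lborel.sigma_finite_measure_axioms)
  show ?thesis by (rule L.sigma_finite) simp
qed

lemma nn_integral_noise1_shift:
  assumes [measurable]: "f \<in> borel_measurable (blocks n)"
  shows "(\<integral>\<^sup>+z. f (add_noise n x z) \<partial>noise1 n)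
    = (\<integral>\<^sup>+y. ennreal (shifted_density n x y) * f y \<partial>lebesgue_blocks n)"
proof -
  have m: "(\<lambda>z. add_noise n x z) \<in> noise1 n \<rightarrow>\<^sub>M blocks n"
    unfolding noise1_def by measurable
  have s: "sets (lebesgue_blocks n) = sets (blocks n)"
    by (rule sets_PiM_cong) auto
  have f: "f \<in> borel_measurable (lebesgue_blocks n)"
    unfolding measurable_cong_sets[OF s refl] by (rule assms)
  have g: "(\<lambda>y. ennreal (shifted_density n x y)) \<in> borel_measurable (lebesgue_blocks n)"
    by (intro measurable_compose[OF _ measurable_ennreal] gauss_density_measurable) simp
  have "(\<integral>\<^sup>+z. f (add_noise n x z) \<partial>noise1 n)
    = (\<integral>\<^sup>+y. f y \<partial>distr (noise1 n) (blocks n) (\<lambda>z. add_noise n x z))"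
    using m by (subst nn_integral_distr) auto
  also have "\<dots> = (\<integral>\<^sup>+y. f y \<partial>density (lebesgue_blocks n) (\<lambda>y. ennreal (shifted_density n x y)))"
    unfolding noise1_def gauss_density_def by (subst distr_PiM_shift) (simp_all add: prod_ennreal)
  also have "\<dots> = (\<integral>\<^sup>+y. ennreal (shifted_density n x y) * f y \<partial>lebesgue_blocks n)"
    by (rule nn_integral_density[OF g f])
  finally show ?thesis .
qed

text \<open>The genie signal carries the noise of the other receiver, so with the messages fixed the
  pair of blocks has a product density.\<close>

lemma nn_integral_noise_shift:
  assumes h: "(\<lambda>(y, s). h y s) \<in> borel_measurable (blocks n \<Otimes>\<^sub>M blocks n)"
  shows "(\<integral>\<^sup>+zz. h (add_noise n x (fst zz)) (add_noise n x' (snd zz)) \<partial>noise n)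
    = (\<integral>\<^sup>+y. \<integral>\<^sup>+s. ennreal (shifted_density n x y) * (ennreal (shifted_density n x' s) * h y s)
        \<partial>lebesgue_blocks n \<partial>lebesgue_blocks n)"
proof -
  let ?L = "lebesgue_blocks n" and ?M = "blocks n"
  interpret L: sigma_finite_measure ?L by (rule sigma_finite_PiM_lborel)
  have s: "sets ?L = sets ?M" by (rule sets_PiM_cong) auto
  have m: "(\<lambda>z. add_noise n x z) \<in> noise1 n \<rightarrow>\<^sub>M ?M" for x
    unfolding noise1_def by measurable
  have h1: "h y \<in> borel_measurable ?M" if "y \<in> space ?M" for y
    using measurable_compose[OF measurable_Pair1'[OF that] h] by simp
  have hL: "(\<lambda>p. h (fst p) (snd p)) \<in> borel_measurable (?M \<Otimes>\<^sub>M ?L)"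
    using h unfolding measurable_cong_sets[OF sets_pair_measure_cong[OF refl s] refl] split_beta' .
  have g: "(\<lambda>y. ennreal (shifted_density n x y)) \<in> borel_measurable ?L" for x
    by (intro measurable_compose[OF _ measurable_ennreal] gauss_density_measurable) simp
  have pm: "(\<lambda>zz. h (add_noise n x (fst zz)) (add_noise n x' (snd zz)))
      \<in> borel_measurable (noise1 n \<Otimes>\<^sub>M noise1 n)"
    using measurable_compose[OF measurable_Pair[OF measurable_compose[OF measurable_fst m] measurable_compose[OF measurable_snd m]] h]
    by simp
  have gs: "(\<lambda>p. ennreal (gauss_density n (\<lambda>t. snd p t - x' t))) \<in> borel_measurable (?M \<Otimes>\<^sub>M ?L)"
    by (rule measurable_compose[OF measurable_snd g])
  have inner: "(\<lambda>y. \<integral>\<^sup>+s. ennreal (shifted_density n x' s) * h y s \<partial>?L) \<in> borel_measurable ?M"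
    using L.borel_measurable_nn_integral[of "\<lambda>y s. ennreal (shifted_density n x' s) * h y s" ?M]
      borel_measurable_times_ennreal[OF gs hL] by (simp add: split_beta')
  have "(\<integral>\<^sup>+zz. h (add_noise n x (fst zz)) (add_noise n x' (snd zz)) \<partial>noise n)
    = (\<integral>\<^sup>+z. \<integral>\<^sup>+z'. h (add_noise n x z) (restrict (\<lambda>t. x' t + z' t) {..<n}) \<partial>noise1 n \<partial>noise1 n)"
    unfolding noise_eq using noise1.nn_integral_fst[OF pm] by simp
  also have "\<dots> = (\<integral>\<^sup>+z. (\<lambda>y. \<integral>\<^sup>+s. ennreal (shifted_density n x' s) * h y s \<partial>?L) (add_noise n x z) \<partial>noise1 n)"
    by (intro nn_integral_cong nn_integral_noise1_shift h1) (rule measurable_space[OF m])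
  also have "\<dots> = (\<integral>\<^sup>+y. ennreal (shifted_density n x y) * (\<integral>\<^sup>+s. ennreal (shifted_density n x' s) * h y s \<partial>?L) \<partial>?L)"
    by (rule nn_integral_noise1_shift[OF inner])
  also have "\<dots> = (\<integral>\<^sup>+y. \<integral>\<^sup>+s. ennreal (shifted_density n x y) * (ennreal (shifted_density n x' s) * h y s) \<partial>?L \<partial>?L)"
  proof (rule nn_integral_cong)
    fix y assume "y \<in> space ?L"
    then have y: "y \<in> space ?M" by (simp add: sets_eq_imp_space_eq[OF s])
    have "h y \<in> borel_measurable ?L"
      unfolding measurable_cong_sets[OF s refl] by (rule h1[OF y])
    then show "ennreal (shifted_density n x y) * (\<integral>\<^sup>+s. ennreal (shifted_density n x' s) * h y s \<partial>?L)
      = (\<integral>\<^sup>+s. ennreal (shifted_density n x y) * (ennreal (shifted_density n x' s) * h y s) \<partial>?L)"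
      using g by (intro nn_integral_cmult[symmetric] borel_measurable_times_ennreal) auto
  qed
  finally show ?thesis .
qed

text \<open>As with \<open>mix_entropy\<close>, this is the negative of an entropy, here that of a
  noise block.\<close>

definition noise_entropy :: "nat \<Rightarrow> real" where
  "noise_entropy n = (\<integral>z. ln (gauss_density n z) \<partial>noise1 n)"

lemma ln_gauss_density_integrable: "integrable (noise1 n) (\<lambda>z. ln (gauss_density n z))"
  unfolding ln_gauss_density
  by (intro Bochner_Integration.integrable_diff Bochner_Integration.integrable_minus
    Bochner_Integration.integrable_sum noise1_component_power2 noise1.integrable_const) auto

lemma noise_entropy_le_0: "noise_entropy n \<le> 0"
proof -
  have "(\<integral>z. - ln (gauss_density n z) \<partial>noise1 n) \<ge> 0"
    using gauss_density_le_1 gauss_density_pos by (intro integral_nonneg_AE AE_I2) simp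
  then show ?thesis by (simp add: noise_entropy_def)
qed

lemma mix_entropy_const:
  assumes "finite J" "j \<in> J" "\<And>j t. j \<in> J \<Longrightarrow> t < n \<Longrightarrow> u j t = w t"
  shows "mix_entropy n J u j = noise_entropy n"
proof -
  have c: "card J > 0" using assms by (auto simp: card_gt_0_iff)
  have "gauss_density n (\<lambda>t. (u j t + z t) - u j' t) = gauss_density n z" if "j' \<in> J" for j' z
    unfolding gauss_density_def using assms that by (intro prod.cong) auto
  then have "gauss_mix n J u (\<lambda>t. u j t + z t) = gauss_density n z" for z
    unfolding gauss_mix_def using c by simp
  then show ?thesis by (simp add: mix_entropy_def noise_entropy_def)
qed

text \<open>\<open>B\<close> contains the messages to be decoded and \<open>C\<close> indexes what
  the receiver does not know. \<open>sh1 i j\<close> is the noiseless received block,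
  \<open>sh2 i\<close> the noiseless genie signal, and \<open>\<kappa> t + c * s t\<close> the
  estimate of \<open>y t\<close> from what is given.\<close>

context
  fixes n :: nat and B :: "'i set" and C :: "'j set"
    and sh1 :: "'i \<Rightarrow> 'j \<Rightarrow> nat \<Rightarrow> complex" and sh2 :: "'i \<Rightarrow> nat \<Rightarrow> complex"
    and \<kappa> :: "nat \<Rightarrow> complex" and c :: complex and v :: real and D :: "(nat \<Rightarrow> complex) \<Rightarrow> 'i"
  assumes B: "finite B" "B \<noteq> {}" and C: "finite C" "C \<noteq> {}" and v: "v > 0"
    and D: "D \<in> blocks n \<rightarrow>\<^sub>M count_space UNIV"
begin

text \<open>The guess of the decoder, mixed with a uniform guess to keep it positive. Taking this as the test posterior
  of the message turns the Gibbs inequality below into the Fano inequality.\<close>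

definition "posterior i y = (if D y = i then 1/2 else 0) + 1 / (2 * real (card B))"
definition "test_density y s = gauss_var n v (\<lambda>t. y t - (\<kappa> t + c * s t))"
text \<open>The quotient of a test density and the true density of message and observation, where \<open>y\<close> is the received
  block and \<open>s\<close> the genie signal. Its mean is at most 1, and \<open>ln x \<le> x - 1\<close> then gives the
  converse. The test law of \<open>s\<close> is its true law, and that of \<open>y\<close> given \<open>s\<close> is Gaussian about a linear estimate.\<close>

definition "ratio i y s = gauss_mix n B sh2 s * test_density y s * posterior i y * real (card B)
    / (gauss_mix n C (sh1 i) y * shifted_density n (sh2 i) s)"

lemma posterior_pos: "posterior i y > 0"
  using B by (simp add: posterior_def card_gt_0_iff add_nonneg_pos)

lemma sum_posterior: "(\<Sum>i\<in>B. posterior i y) \<le> 1"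
proof -
  have "(\<Sum>i\<in>B. posterior i y) = (\<Sum>i\<in>B. if D y = i then 1/2 else 0) + real (card B) * (1 / (2 * real (card B)))"
    by (simp add: posterior_def sum.distrib)
  also have "(\<Sum>i\<in>B. if D y = i then 1/2 else (0::real)) \<le> 1/2"
    using B by (simp add: sum.delta)
  also have "real (card B) * (1 / (2 * real (card B))) = 1/2"
    using B by (simp add: card_gt_0_iff)
  finally show ?thesis by simp
qed

lemma ratio_measurable_real:
  "(\<lambda>p. ratio i (fst p) (snd p)) \<in> borel_measurable (blocks n \<Otimes>\<^sub>M blocks n)"
proof -
  let ?M = "blocks n"
  have y: "(\<lambda>p. fst p t) \<in> borel_measurable (?M \<Otimes>\<^sub>M ?M)" and s: "(\<lambda>p. snd p t) \<in> borel_measurable (?M \<Otimes>\<^sub>M ?M)" if "t < n" for t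
    using that by (auto intro!: measurable_compose[OF measurable_fst measurable_component_singleton]
        measurable_compose[OF measurable_snd measurable_component_singleton])
  have g: "(\<lambda>p. test_density (fst p) (snd p)) \<in> borel_measurable (?M \<Otimes>\<^sub>M ?M)"
    unfolding test_density_def gauss_var_def
    using y s by (intro borel_measurable_prod borel_measurable_divide measurable_compose[OF _ measurable_cgauss]
      borel_measurable_scaleR borel_measurable_diff borel_measurable_add borel_measurable_times borel_measurable_const) auto
  have "(\<lambda>y. posterior i y) \<in> borel_measurable ?M"
    unfolding posterior_def by (rule measurable_compose[OF D]) simp
  then have p: "(\<lambda>p. posterior i (fst p)) \<in> borel_measurable (?M \<Otimes>\<^sub>M ?M)"
    by (rule measurable_compose[OF measurable_fst])
  show ?thesis
    unfolding ratio_def using y s g p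
    by (intro borel_measurable_divide borel_measurable_times gauss_mix_measurable gauss_density_measurable
      borel_measurable_diff borel_measurable_const) auto
qed

lemma ratio_measurable:
  "(\<lambda>(y, s). ennreal (ratio i y s)) \<in> borel_measurable (blocks n \<Otimes>\<^sub>M blocks n)"
  unfolding split_beta' by (rule measurable_compose[OF ratio_measurable_real measurable_ennreal])

lemma ratio_pos: "ratio i y s > 0"
  unfolding ratio_def test_density_def using B C v
  by (intro divide_pos_pos mult_pos_pos gauss_mix_pos gauss_var_pos posterior_pos gauss_density_pos) (auto simp: card_gt_0_iff)

definition "noisy_ratio i j zz = ratio i (add_noise n (sh1 i j) (fst zz)) (add_noise n (sh2 i) (snd zz))"

text \<open>Against the true law the denominator of \<open>ratio\<close> cancels, since the sum over
  \<open>j\<close> restores the mixture. What remains is the test law: the posteriors sum to at most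
  1 and both test densities integrate to 1. The right-hand side is the number of pairs, so the mean
  ratio is at most 1.\<close>

lemma sum_expected_ratio:
  "(\<Sum>i\<in>B. \<Sum>j\<in>C. \<integral>\<^sup>+zz. ennreal (noisy_ratio i j zz) \<partial>noise n)
    \<le> ennreal (real (card B) * real (card C))"
proof -
  let ?L = "lebesgue_blocks n" and ?M = "blocks n"
  let ?g = "\<lambda>x y. shifted_density n x y"
  interpret L: sigma_finite_measure ?L by (rule sigma_finite_PiM_lborel)
  interpret LL: pair_sigma_finite ?L ?L ..
  have sML: "sets ?L = sets ?M" by (rule sets_PiM_cong) auto
  have gm: "(\<lambda>y. ?g x y) \<in> borel_measurable ?L" for x
    by (intro gauss_density_measurable) simp
  define f where "f i j p = ennreal (?g (sh1 i j) (fst p)) * (ennreal (?g (sh2 i) (snd p)) * ennreal (ratio i (fst p) (snd p)))" for i j p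
  have fm: "f i j \<in> borel_measurable (?L \<Otimes>\<^sub>M ?L)" for i j
  proof -
    have "(\<lambda>p. ennreal (ratio i (fst p) (snd p))) \<in> borel_measurable (?L \<Otimes>\<^sub>M ?L)"
      using ratio_measurable unfolding measurable_cong_sets[OF sets_pair_measure_cong[OF sML sML] refl] by (simp add: split_beta')
    then show ?thesis
      unfolding f_def
      by (intro borel_measurable_times_ennreal measurable_compose[OF measurable_compose[OF measurable_fst gm] measurable_ennreal]
        measurable_compose[OF measurable_compose[OF measurable_snd gm] measurable_ennreal])
  qed
  have pt: "(\<Sum>i\<in>B. \<Sum>j\<in>C. f i j p) \<le> ennreal (real (card B) * real (card C)) * (ennreal (gauss_mix n B sh2 (snd p)) * ennreal (test_density (fst p) (snd p)))" for p
  proof -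
    obtain y s where p: "p = (y, s)" by (cases p)
    have td: "test_density y s > 0" unfolding test_density_def by (rule gauss_var_pos[OF v])
    have mB: "gauss_mix n B sh2 s > 0" by (rule gauss_mix_pos[OF B])
    have "(\<Sum>j\<in>C. ?g (sh1 i j) y * (?g (sh2 i) s * ratio i y s))
      = real (card C) * real (card B) * (gauss_mix n B sh2 s * test_density y s) * posterior i y" for i
    proof -
      have "(\<Sum>j\<in>C. ?g (sh1 i j) y * (?g (sh2 i) s * ratio i y s)) = (\<Sum>j\<in>C. ?g (sh1 i j) y) * (?g (sh2 i) s * ratio i y s)"
        by (simp add: sum_distrib_right)
      also have "(\<Sum>j\<in>C. ?g (sh1 i j) y) = real (card C) * gauss_mix n C (sh1 i) y"
        using C by (simp add: gauss_mix_def card_gt_0_iff)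
      finally show ?thesis
        using gauss_mix_pos[OF C, of n "sh1 i" y] gauss_density_pos[of n "\<lambda>t. s t - sh2 i t"]
        unfolding ratio_def by (simp add: field_simps)
    qed
    then have "(\<Sum>i\<in>B. \<Sum>j\<in>C. ?g (sh1 i j) y * (?g (sh2 i) s * ratio i y s))
      = real (card C) * real (card B) * (gauss_mix n B sh2 s * test_density y s) * (\<Sum>i\<in>B. posterior i y)"
      by (simp add: sum_distrib_left)
    also have "\<dots> \<le> real (card C) * real (card B) * (gauss_mix n B sh2 s * test_density y s) * 1"
      using td mB by (intro mult_left_mono sum_posterior) auto
    finally have le: "(\<Sum>i\<in>B. \<Sum>j\<in>C. ?g (sh1 i j) y * (?g (sh2 i) s * ratio i y s))
      \<le> real (card B) * real (card C) * (gauss_mix n B sh2 s * test_density y s)"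
      by (simp add: mult_ac)
    have "(\<Sum>i\<in>B. \<Sum>j\<in>C. f i j p) = ennreal (\<Sum>i\<in>B. \<Sum>j\<in>C. ?g (sh1 i j) y * (?g (sh2 i) s * ratio i y s))"
      unfolding f_def p fst_conv snd_conv
      using less_imp_le[OF gauss_density_pos] less_imp_le[OF ratio_pos]
      by (simp add: ennreal_mult[symmetric] sum_ennreal sum_nonneg)
    also have "\<dots> \<le> ennreal (real (card B) * real (card C) * (gauss_mix n B sh2 s * test_density y s))"
      by (rule ennreal_leI[OF le])
    also have "\<dots> = ennreal (real (card B) * real (card C)) * (ennreal (gauss_mix n B sh2 s) * ennreal (test_density y s))"
      using td mB by (simp add: ennreal_mult)
    finally show ?thesis by (simp add: p)
  qed
  have tm: "(\<lambda>p. ennreal (gauss_mix n B sh2 (snd p)) * ennreal (test_density (fst p) (snd p))) \<in> borel_measurable (?L \<Otimes>\<^sub>M ?L)"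
  proof -
    have 1: "(\<lambda>x. x t) \<in> borel_measurable ?L" if "t < n" for t
      using that by simp
    have "(\<lambda>p. fst p t) \<in> borel_measurable (?L \<Otimes>\<^sub>M ?L)" "(\<lambda>p. snd p t) \<in> borel_measurable (?L \<Otimes>\<^sub>M ?L)" if "t < n" for t
      using measurable_compose[OF measurable_fst 1[OF that]] measurable_compose[OF measurable_snd 1[OF that]] .
    then have "(\<lambda>p. gauss_mix n B sh2 (snd p)) \<in> borel_measurable (?L \<Otimes>\<^sub>M ?L)"
      "(\<lambda>p. test_density (fst p) (snd p)) \<in> borel_measurable (?L \<Otimes>\<^sub>M ?L)"
      unfolding test_density_def gauss_var_def
      by (intro gauss_mix_measurable borel_measurable_prod borel_measurable_divide measurable_compose[OF _ measurable_cgauss]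
        borel_measurable_scaleR borel_measurable_diff borel_measurable_add borel_measurable_times borel_measurable_const; simp)+
    then show ?thesis
      by (intro borel_measurable_times_ennreal) (auto intro: measurable_compose[OF _ measurable_ennreal])
  qed
  have "(\<Sum>i\<in>B. \<Sum>j\<in>C. \<integral>\<^sup>+zz. ennreal (noisy_ratio i j zz) \<partial>noise n)
    = (\<Sum>i\<in>B. \<Sum>j\<in>C. \<integral>\<^sup>+p. f i j p \<partial>(?L \<Otimes>\<^sub>M ?L))"
  proof (intro sum.cong refl)
    fix i j
    show "(\<integral>\<^sup>+zz. ennreal (noisy_ratio i j zz) \<partial>noise n)
      = (\<integral>\<^sup>+p. f i j p \<partial>(?L \<Otimes>\<^sub>M ?L))"
      unfolding noisy_ratio_def
      by (subst nn_integral_noise_shift[OF ratio_measurable], subst L.nn_integral_fst[OF fm, symmetric])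
        (simp only: f_def fst_conv snd_conv)
  qed
  also have "\<dots> = (\<Sum>i\<in>B. \<integral>\<^sup>+p. (\<Sum>j\<in>C. f i j p) \<partial>(?L \<Otimes>\<^sub>M ?L))"
    by (intro sum.cong refl nn_integral_sum[symmetric] fm)
  also have "\<dots> = (\<integral>\<^sup>+p. (\<Sum>i\<in>B. \<Sum>j\<in>C. f i j p) \<partial>(?L \<Otimes>\<^sub>M ?L))"
    by (intro nn_integral_sum[symmetric] borel_measurable_sum fm)
  also have "\<dots> \<le> (\<integral>\<^sup>+p. ennreal (real (card B) * real (card C)) * (ennreal (gauss_mix n B sh2 (snd p)) * ennreal (test_density (fst p) (snd p))) \<partial>(?L \<Otimes>\<^sub>M ?L))"
    by (intro nn_integral_mono pt)
  also have "\<dots> = ennreal (real (card B) * real (card C)) * (\<integral>\<^sup>+p. ennreal (gauss_mix n B sh2 (snd p)) * ennreal (test_density (fst p) (snd p)) \<partial>(?L \<Otimes>\<^sub>M ?L))"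
    by (rule nn_integral_cmult[OF tm])
  \<comment> \<open>The test density of \<open>y\<close> is conditional on \<open>s\<close>, so
    \<open>y\<close> is integrated first.\<close>
  also have "(\<integral>\<^sup>+p. ennreal (gauss_mix n B sh2 (snd p)) * ennreal (test_density (fst p) (snd p)) \<partial>(?L \<Otimes>\<^sub>M ?L))
    = (\<integral>\<^sup>+s. \<integral>\<^sup>+y. ennreal (gauss_mix n B sh2 s) * ennreal (test_density y s) \<partial>?L \<partial>?L)"
    using LL.nn_integral_snd[OF tm] by simp
  also have "\<dots> = (\<integral>\<^sup>+s. ennreal (gauss_mix n B sh2 s) \<partial>?L)"
  proof (rule nn_integral_cong)
    fix s
    have "(\<lambda>y. ennreal (test_density y s)) \<in> borel_measurable ?L"
      unfolding test_density_def gauss_var_def by measurable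
    then have "(\<integral>\<^sup>+y. ennreal (gauss_mix n B sh2 s) * ennreal (test_density y s) \<partial>?L)
      = ennreal (gauss_mix n B sh2 s) * (\<integral>\<^sup>+y. ennreal (test_density y s) \<partial>?L)"
      by (rule nn_integral_cmult)
    also have "(\<integral>\<^sup>+y. ennreal (test_density y s) \<partial>?L) = 1"
      unfolding test_density_def by (rule nn_integral_gauss_var[OF v])
    finally show "(\<integral>\<^sup>+y. ennreal (gauss_mix n B sh2 s) * ennreal (test_density y s) \<partial>?L) = ennreal (gauss_mix n B sh2 s)"
      by simp
  qed
  also have "\<dots> = 1" by (rule nn_integral_gauss_mix[OF B])
  finally show ?thesis unfolding mult_1_right .
qed

text \<open>The core of the Fano inequality: a correct decision is worth
  \<open>ln (real (card B))\<close> up to \<open>ln 2\<close>, and the uniform part of the guess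
  limits the cost of a wrong one to \<open>ln 2\<close>.\<close>

lemma ln_posterior_ge: "(if D y = i then ln (real (card B)) else 0) - ln 2 \<le> ln (posterior i y * real (card B))"
proof -
  have b: "real (card B) > 0" using B by (simp add: card_gt_0_iff)
  have eq: "posterior i y * real (card B) = (if D y = i then real (card B) / 2 else 0) + 1 / 2"
    using b by (simp add: posterior_def field_simps)
  show ?thesis
  proof (cases "D y = i")
    case True
    have "ln (real (card B)) - ln 2 = ln (real (card B) / 2)"
      using b by (simp add: ln_div)
    also have "\<dots> \<le> ln (real (card B) / 2 + 1 / 2)"
      using b by (intro ln_mono) auto
    finally show ?thesis using True eq by simp
  next
    case False
    then have "posterior i y * real (card B) = 1 / 2" using eq by simp
    then show ?thesis using False by (simp only: if_False) (simp add: ln_div)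
  qed
qed

text \<open>Cross terms between signal and noise are absorbed by the factor 3 instead of being
  integrated out. It is the 3 in all variances below and affects constants only.\<close>

lemma cmod_sum3_power2_le: "(cmod (x + y - z))\<^sup>2 \<le> 3 * ((cmod x)\<^sup>2 + (cmod y)\<^sup>2 + (cmod z)\<^sup>2)"
proof -
  have "cmod (x + y - z) \<le> cmod x + cmod y + cmod z"
    using norm_triangle_ineq4[of "x + y" z] norm_triangle_ineq[of x y] by linarith
  then have "(cmod (x + y - z))\<^sup>2 \<le> (cmod x + cmod y + cmod z)\<^sup>2"
    by (rule power_mono) simp
  also have "\<dots> \<le> 3 * ((cmod x)\<^sup>2 + (cmod y)\<^sup>2 + (cmod z)\<^sup>2)"
  proof -
    have "0 \<le> (cmod x - cmod y)\<^sup>2 + (cmod y - cmod z)\<^sup>2 + (cmod x - cmod z)\<^sup>2" by simp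
    then show ?thesis by (simp add: power2_eq_square algebra_simps)
  qed
  finally show ?thesis .
qed

text \<open>The part of the error of the linear estimate that does not come from noise.\<close>

definition "residual i j t = sh1 i j t - \<kappa> t - c * sh2 i t"

text \<open>Up to constants the lower bound is a function of the first noise plus a function of the
  second, so that its expectation involves only the two marginals.\<close>

lemma ln_ratio_ge:
  "(if D (add_noise n (sh1 i j) z1) = i then ln (real (card B)) else 0) - ln 2
    + ln (gauss_mix n B sh2 (\<lambda>t. sh2 i t + z2 t))
    - (\<Sum>t<n. 3 * ((cmod (residual i j t))\<^sup>2 + (cmod (z1 t))\<^sup>2 + (cmod c)\<^sup>2 * (cmod (z2 t))\<^sup>2)) / v - real n * ln (pi * v)
    - ln (gauss_mix n C (sh1 i) (\<lambda>t. sh1 i j t + z1 t)) - ln (gauss_density n z2)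
   \<le> ln (ratio i (add_noise n (sh1 i j) z1) (add_noise n (sh2 i) z2))"
proof -
  let ?y = "add_noise n (sh1 i j) z1" and ?s = "add_noise n (sh2 i) z2"
  have b: "real (card B) > 0" using B by (simp add: card_gt_0_iff)
  have 1: "gauss_mix n B sh2 ?s = gauss_mix n B sh2 (\<lambda>t. sh2 i t + z2 t)"
    and 2: "gauss_mix n C (sh1 i) ?y = gauss_mix n C (sh1 i) (\<lambda>t. sh1 i j t + z1 t)"
    and 3: "gauss_density n (\<lambda>t. ?s t - sh2 i t) = gauss_density n z2"
    unfolding gauss_mix_def gauss_density_def
    by (auto intro!: arg_cong2[where f = "(*)"] sum.cong prod.cong)
  have td: "- (\<Sum>t<n. 3 * ((cmod (residual i j t))\<^sup>2 + (cmod (z1 t))\<^sup>2 + (cmod c)\<^sup>2 * (cmod (z2 t))\<^sup>2)) / v - real n * ln (pi * v)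
      \<le> ln (test_density ?y ?s)"
  proof -
    have "(\<Sum>t<n. (cmod (?y t - (\<kappa> t + c * ?s t)))\<^sup>2)
      \<le> (\<Sum>t<n. 3 * ((cmod (residual i j t))\<^sup>2 + (cmod (z1 t))\<^sup>2 + (cmod c)\<^sup>2 * (cmod (z2 t))\<^sup>2))"
    proof (rule sum_mono)
      fix t assume "t \<in> {..<n}"
      then have "?y t - (\<kappa> t + c * ?s t) = residual i j t + z1 t - c * z2 t"
        by (simp add: residual_def algebra_simps)
      then show "(cmod (?y t - (\<kappa> t + c * ?s t)))\<^sup>2
        \<le> 3 * ((cmod (residual i j t))\<^sup>2 + (cmod (z1 t))\<^sup>2 + (cmod c)\<^sup>2 * (cmod (z2 t))\<^sup>2)"
        using cmod_sum3_power2_le[of "residual i j t" "z1 t" "c * z2 t"] by (simp add: norm_mult power_mult_distrib)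
    qed
    then show ?thesis
      unfolding test_density_def ln_gauss_var[OF v] using v by (simp add: divide_right_mono)
  qed
  have "ln (ratio i ?y ?s) = ln (gauss_mix n B sh2 ?s) + ln (test_density ?y ?s) + ln (posterior i ?y * real (card B))
    - (ln (gauss_mix n C (sh1 i) ?y) + ln (gauss_density n (\<lambda>t. ?s t - sh2 i t)))"
  proof -
    have pos: "gauss_mix n B sh2 ?s > 0" "test_density ?y ?s > 0" "posterior i ?y * real (card B) > 0"
      "gauss_mix n C (sh1 i) ?y > 0" "gauss_density n (\<lambda>t. ?s t - sh2 i t) > 0"
      unfolding test_density_def using b
      by (intro gauss_mix_pos[OF B] gauss_mix_pos[OF C] gauss_var_pos[OF v] gauss_density_pos mult_pos_pos posterior_pos; assumption?)+
    have "ln (a * b * p / (m * g)) = ln a + ln b + ln p - (ln m + ln g)"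
      if "a > 0" "b > 0" "p > 0" "m > 0" "g > 0" for a b p m g :: real
      using that by (simp add: ln_div ln_mult)
    from this[OF pos] show ?thesis
      unfolding ratio_def mult.assoc[of _ "posterior i ?y"] .
  qed
  then show ?thesis
    using ln_posterior_ge[of ?y i] td unfolding 1 2 3 by linarith
qed

text \<open>The expectation of the lower bound in \<open>ln_ratio_ge\<close>, with the second
  moments of the noise replaced by their bound \<open>noise_power\<close>.\<close>

definition "log_bound i j = \<P>(z in noise1 n. D (add_noise n (sh1 i j) z) = i) * ln (real (card B)) - ln 2
    + mix_entropy n B sh2 i
    - (\<Sum>t<n. 3 * ((cmod (residual i j t))\<^sup>2 + noise_power * (1 + (cmod c)\<^sup>2))) / v - real n * ln (pi * v)
    - mix_entropy n C (sh1 i) j - noise_entropy n"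

text \<open>Only the lower bound \<open>f1 + f2\<close> and the ratio itself are integrated;
  \<open>ln x \<le> x - 1\<close> compares them pointwise.\<close>

lemma expected_log_bound:
  assumes i: "i \<in> B" and j: "j \<in> C" and X: "integrable (noise n) (noisy_ratio i j)"
  shows "log_bound i j \<le> (\<integral>zz. noisy_ratio i j zz \<partial>noise n) - 1"
proof -
  let ?S = "{z \<in> space (noise1 n). D (add_noise n (sh1 i j) z) = i}"
  let ?r = "\<Sum>t<n. 3 * (cmod (residual i j t))\<^sup>2" and ?w = "\<lambda>z :: nat \<Rightarrow> complex. \<Sum>t<n. 3 * (cmod (z t))\<^sup>2"
  let ?wc = "\<lambda>z :: nat \<Rightarrow> complex. \<Sum>t<n. 3 * (cmod c)\<^sup>2 * (cmod (z t))\<^sup>2" and ?l = "ln (real (card B))"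
  define f1 where "f1 z = (if D (add_noise n (sh1 i j) z) = i then ?l else 0)
    - (\<Sum>t<n. 3 * ((cmod (residual i j t))\<^sup>2 + (cmod (z t))\<^sup>2)) / v
    - ln (gauss_mix n C (sh1 i) (\<lambda>t. sh1 i j t + z t))" for z
  define f2 where "f2 z = ln (gauss_mix n B sh2 (\<lambda>t. sh2 i t + z t))
    - (\<Sum>t<n. 3 * ((cmod c)\<^sup>2 * (cmod (z t))\<^sup>2)) / v - ln (gauss_density n z)" for z
  have le: "f1 (fst zz) + f2 (snd zz) - ln 2 - real n * ln (pi * v) \<le> noisy_ratio i j zz - 1" for zz
  proof -
    have "f1 (fst zz) + f2 (snd zz) - ln 2 - real n * ln (pi * v) \<le> ln (noisy_ratio i j zz)"
      using ln_ratio_ge[of i j "fst zz" "snd zz"] unfolding f1_def f2_def noisy_ratio_def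
      by (simp add: sum.distrib distrib_left add_divide_distrib)
    also have "\<dots> \<le> noisy_ratio i j zz - 1"
      unfolding noisy_ratio_def by (intro ln_le_minus_one ratio_pos)
    finally show ?thesis .
  qed
  have S: "?S \<in> sets (noise1 n)"
  proof -
    have "(\<lambda>z. add_noise n (sh1 i j) z) \<in> noise1 n \<rightarrow>\<^sub>M blocks n"
      unfolding noise1_def by measurable
    from measurable_sets[OF measurable_compose[OF this D], of "{i}"] show ?thesis
      by (simp add: vimage_def Int_def conj_commute)
  qed
  have pw: "integrable (noise1 n) (\<lambda>z. (\<Sum>t<n. k * (cmod (z t))\<^sup>2))" for k
    by (intro Bochner_Integration.integrable_sum integrable_mult_right noise1_component_power2) auto
  have pw_le: "(\<integral>z. (\<Sum>t<n. k * (cmod (z t))\<^sup>2) \<partial>noise1 n) \<le> (\<Sum>t<n. k * noise_power)" if "k \<ge> 0" for k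
  proof -
    have "(\<integral>z. (\<Sum>t<n. k * (cmod (z t))\<^sup>2) \<partial>noise1 n) = (\<Sum>t<n. k * (\<integral>z. (cmod (z t))\<^sup>2 \<partial>noise1 n))"
      using noise1_component_power2 by (subst Bochner_Integration.integral_sum) auto
    also have "\<dots> \<le> (\<Sum>t<n. k * noise_power)"
      using that noise1_component_power2 by (intro sum_mono mult_left_mono) auto
    finally show ?thesis .
  qed
  have f1_eq: "f1 z = ?l * indicat_real ?S z - ?r / v
      - (1 / v) * ?w z - ln (gauss_mix n C (sh1 i) (\<lambda>t. sh1 i j t + z t))" if "z \<in> space (noise1 n)" for z
    using that by (simp add: f1_def indicator_def sum.distrib distrib_left add_divide_distrib)
  have f2_eq: "f2 z = ln (gauss_mix n B sh2 (\<lambda>t. sh2 i t + z t))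
    - (1 / v) * ?wc z - ln (gauss_density n z)" for z
    by (simp add: f2_def mult.assoc)
  note int = ln_gauss_mix_integrable[OF C(1) j] ln_gauss_mix_integrable[OF B(1) i] ln_gauss_density_integrable pw
  have ind: "integrable (noise1 n) (indicat_real ?S)"
    using S by (simp add: noise1.emeasure_finite less_top[symmetric])
  have f1: "integrable (noise1 n) f1" and f1_val: "(\<integral>z. f1 z \<partial>noise1 n) = ?l * measure (noise1 n) ?S
      - ?r / v
      - (1 / v) * integral\<^sup>L (noise1 n) ?w - mix_entropy n C (sh1 i) j"
  proof -
    let ?g = "\<lambda>z. ?l * indicat_real ?S z - ?r / v
      - (1 / v) * ?w z - ln (gauss_mix n C (sh1 i) (\<lambda>t. sh1 i j t + z t))"
    have I1: "integrable (noise1 n) (\<lambda>z. ?l * indicat_real ?S z)"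
      and I2: "integrable (noise1 n) (\<lambda>z. ?r / v)"
      and I3: "integrable (noise1 n) (\<lambda>z. (1 / v) * ?w z)"
      by (rule integrable_mult_right[OF ind], rule noise1.integrable_const, rule integrable_mult_right[OF pw])
    note I12 = Bochner_Integration.integrable_diff[OF I1 I2]
    note I123 = Bochner_Integration.integrable_diff[OF I12 I3]
    have "integrable (noise1 n) ?g"
      by (rule Bochner_Integration.integrable_diff[OF I123 int(1)])
    then show "integrable (noise1 n) f1"
      using f1_eq by (subst Bochner_Integration.integrable_cong[OF refl]) auto
    have "(\<integral>z. f1 z \<partial>noise1 n) = (\<integral>z. ?g z \<partial>noise1 n)"
      using f1_eq by (intro Bochner_Integration.integral_cong refl) auto
    also have "\<dots> = (\<integral>z. ?l * indicat_real ?S z \<partial>noise1 n) - (\<integral>z. ?r / v \<partial>noise1 n)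
      - (\<integral>z. (1 / v) * ?w z \<partial>noise1 n) - mix_entropy n C (sh1 i) j"
      unfolding mix_entropy_def
      by (simp only: Bochner_Integration.integral_diff I1 I2 I3 I12 I123 int(1))
    also have "(\<integral>z. ?l * indicat_real ?S z \<partial>noise1 n) = ?l * measure (noise1 n) ?S"
      using S by simp
    also have "(\<integral>z. ?r / v \<partial>noise1 n) = ?r / v"
      by (simp add: noise1.prob_space)
    also have "(\<integral>z. (1 / v) * ?w z \<partial>noise1 n) = (1 / v) * integral\<^sup>L (noise1 n) ?w"
      by (rule integral_mult_right_zero)
    finally show "(\<integral>z. f1 z \<partial>noise1 n) = ?l * measure (noise1 n) ?S
      - ?r / v
      - (1 / v) * integral\<^sup>L (noise1 n) ?w - mix_entropy n C (sh1 i) j" .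
  qed
  have J: "integrable (noise1 n) (\<lambda>z. (1 / v) * ?wc z)"
    by (rule integrable_mult_right[OF pw])
  note J2 = Bochner_Integration.integrable_diff[OF int(2) J]
  have f2: "integrable (noise1 n) f2"
    unfolding f2_eq by (rule Bochner_Integration.integrable_diff[OF J2 int(3)])
  have f2_val: "(\<integral>z. f2 z \<partial>noise1 n) = mix_entropy n B sh2 i
      - (1 / v) * integral\<^sup>L (noise1 n) ?wc - noise_entropy n"
    unfolding f2_eq mix_entropy_def noise_entropy_def
    by (simp only: Bochner_Integration.integral_diff int(2) J J2 int(3) integral_mult_right_zero)
  have F1: "integrable (noise n) (\<lambda>zz. f1 (fst zz))" "(\<integral>zz. f1 (fst zz) \<partial>noise n) = (\<integral>z. f1 z \<partial>noise1 n)"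
    using integral_noise_marginal[OF borel_measurable_integrable[OF f1], of fst] f1 by auto
  have F2: "integrable (noise n) (\<lambda>zz. f2 (snd zz))" "(\<integral>zz. f2 (snd zz) \<partial>noise n) = (\<integral>z. f2 z \<partial>noise1 n)"
    using integral_noise_marginal[OF borel_measurable_integrable[OF f2], of snd] f2 by auto
  have "(\<integral>zz. f1 (fst zz) + f2 (snd zz) - ln 2 - real n * ln (pi * v) \<partial>noise n) \<le> (\<integral>zz. noisy_ratio i j zz - 1 \<partial>noise n)"
    by (intro integral_mono le Bochner_Integration.integrable_diff Bochner_Integration.integrable_add F1 F2 X noise.integrable_const)
  also have "(\<integral>zz. noisy_ratio i j zz - 1 \<partial>noise n) = (\<integral>zz. noisy_ratio i j zz \<partial>noise n) - 1"
    using X by (simp add: noise.prob_space)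
  also have "(\<integral>zz. f1 (fst zz) + f2 (snd zz) - ln 2 - real n * ln (pi * v) \<partial>noise n)
    = (\<integral>z. f1 z \<partial>noise1 n) + (\<integral>z. f2 z \<partial>noise1 n) - ln 2 - real n * ln (pi * v)"
    using F1 F2 by (simp add: noise.prob_space)
  finally have main: "(\<integral>z. f1 z \<partial>noise1 n) + (\<integral>z. f2 z \<partial>noise1 n) - ln 2 - real n * ln (pi * v) \<le> (\<integral>zz. noisy_ratio i j zz \<partial>noise n) - 1" .
  have "(1 / v) * integral\<^sup>L (noise1 n) ?w \<le> (1 / v) * (\<Sum>t<n. 3 * noise_power)"
    "(1 / v) * integral\<^sup>L (noise1 n) ?wc \<le> (1 / v) * (\<Sum>t<n. 3 * (cmod c)\<^sup>2 * noise_power)"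
    using v by (intro mult_left_mono pw_le; simp)+
  moreover have "(\<Sum>t<n. 3 * ((cmod (residual i j t))\<^sup>2 + noise_power * (1 + (cmod c)\<^sup>2))) / v
    = ?r / v + (1 / v) * (\<Sum>t<n. 3 * noise_power) + (1 / v) * (\<Sum>t<n. 3 * (cmod c)\<^sup>2 * noise_power)"
    by (simp add: distrib_left sum.distrib add_divide_distrib mult_ac)
  ultimately show ?thesis
    using main unfolding f1_val f2_val log_bound_def by (simp only: mult.commute[of "?l"])
qed

text \<open>The Gibbs inequality: the mean ratio is at most 1, so the summands
  \<open>ratio - 1\<close> have nonpositive mean. Each ratio is integrable because the finite sum of
  all of them is.\<close>

lemma sum_log_bound:
  "(\<Sum>i\<in>B. \<Sum>j\<in>C. log_bound i j) \<le> 0"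
proof -
  have X0: "noisy_ratio i j zz > 0" for i j zz unfolding noisy_ratio_def by (rule ratio_pos)
  have Xm: "noisy_ratio i j \<in> borel_measurable (noise n)" for i j
  proof -
    let ?M = "blocks n"
    have m: "(\<lambda>z. add_noise n x z) \<in> noise1 n \<rightarrow>\<^sub>M ?M" for x
      unfolding noise1_def by measurable
    show ?thesis
      using measurable_compose[OF measurable_Pair[OF measurable_compose[OF measurable_fst m] measurable_compose[OF measurable_snd m]] ratio_measurable_real]
      unfolding noise_eq noisy_ratio_def[abs_def] fst_conv snd_conv .
  qed
  have sum: "(\<Sum>i\<in>B. \<Sum>j\<in>C. \<integral>\<^sup>+zz. ennreal (noisy_ratio i j zz) \<partial>noise n) \<le> ennreal (real (card B) * real (card C))"
    by (rule sum_expected_ratio)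
  have X: "integrable (noise n) (noisy_ratio i j)" if "i \<in> B" "j \<in> C" for i j
  proof (rule integrableI_bounded[OF Xm])
    have "(\<integral>\<^sup>+zz. ennreal (noisy_ratio i j zz) \<partial>noise n) \<le> (\<Sum>j\<in>C. \<integral>\<^sup>+zz. ennreal (noisy_ratio i j zz) \<partial>noise n)"
      using C that by (intro member_le_sum) auto
    also have "\<dots> \<le> (\<Sum>i\<in>B. \<Sum>j\<in>C. \<integral>\<^sup>+zz. ennreal (noisy_ratio i j zz) \<partial>noise n)"
      using B that by (intro member_le_sum[where f = "\<lambda>i. \<Sum>j\<in>C. \<integral>\<^sup>+zz. ennreal (noisy_ratio i j zz) \<partial>noise n"]) auto
    also note sum
    also have "ennreal (real (card B) * real (card C)) < \<infinity>" by simp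
    finally show "(\<integral>\<^sup>+zz. ennreal (norm (noisy_ratio i j zz)) \<partial>noise n) < \<infinity>"
      using less_imp_le[OF X0] by simp
  qed
  have "(\<Sum>i\<in>B. \<Sum>j\<in>C. \<integral>\<^sup>+zz. ennreal (noisy_ratio i j zz) \<partial>noise n) = ennreal (\<Sum>i\<in>B. \<Sum>j\<in>C. \<integral>zz. noisy_ratio i j zz \<partial>noise n)"
  proof -
    have "(\<Sum>i\<in>B. \<Sum>j\<in>C. \<integral>\<^sup>+zz. ennreal (noisy_ratio i j zz) \<partial>noise n) = (\<Sum>i\<in>B. \<Sum>j\<in>C. ennreal (\<integral>zz. noisy_ratio i j zz \<partial>noise n))"
      using less_imp_le[OF X0] by (intro sum.cong refl nn_integral_eq_integral X AE_I2)
    also have "\<dots> = ennreal (\<Sum>i\<in>B. \<Sum>j\<in>C. \<integral>zz. noisy_ratio i j zz \<partial>noise n)"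
      using less_imp_le[OF X0] by (simp add: sum_ennreal sum_nonneg integral_nonneg_AE)
    finally show ?thesis .
  qed
  with sum have le: "(\<Sum>i\<in>B. \<Sum>j\<in>C. \<integral>zz. noisy_ratio i j zz \<partial>noise n) \<le> real (card B) * real (card C)"
    by simp
  have "(\<Sum>i\<in>B. \<Sum>j\<in>C. log_bound i j) \<le> (\<Sum>i\<in>B. \<Sum>j\<in>C. (\<integral>zz. noisy_ratio i j zz \<partial>noise n) - 1)"
    using X by (intro sum_mono expected_log_bound)
  also have "\<dots> = (\<Sum>i\<in>B. \<Sum>j\<in>C. \<integral>zz. noisy_ratio i j zz \<partial>noise n) - real (card B) * real (card C)"
    by (simp add: sum_subtractf)
  finally show ?thesis using le by linarith
qed

end

section \<open>Bounds on the messages of a code\<close>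

definition mean :: "'a set \<Rightarrow> ('a \<Rightarrow> real) \<Rightarrow> real" where
  "mean A f = (\<Sum>x\<in>A. f x) / real (card A)"

abbreviation mean3 :: "'a set \<Rightarrow> 'b set \<Rightarrow> 'c set \<Rightarrow> ('a \<Rightarrow> 'b \<Rightarrow> 'c \<Rightarrow> real) \<Rightarrow> real" where
  "mean3 A B C f \<equiv> mean A (\<lambda>x. mean B (\<lambda>y. mean C (f x y)))"

lemma mean_const: "finite A \<Longrightarrow> A \<noteq> {} \<Longrightarrow> mean A (\<lambda>_. c) = c"
  by (simp add: mean_def card_gt_0_iff)

lemma mean_add: "mean A (\<lambda>x. f x + g x) = mean A f + mean A g"
  by (simp add: mean_def sum.distrib add_divide_distrib)

lemma mean_diff: "mean A (\<lambda>x. f x - g x) = mean A f - mean A g"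
  by (simp add: mean_def sum_subtractf diff_divide_distrib)

lemma mean_cmult: "mean A (\<lambda>x. c * f x) = c * mean A f"
  by (simp add: mean_def sum_distrib_left)

lemma mean_divide: "mean A (\<lambda>x. f x / c) = mean A f / c"
  by (simp add: mean_def sum_divide_distrib[symmetric] mult.commute)

lemma mean_sum: "mean A (\<lambda>x. \<Sum>t\<in>T. f t x) = (\<Sum>t\<in>T. mean A (f t))"
  unfolding mean_def by (subst sum.swap) (simp add: sum_divide_distrib)

lemma mean_mono: "(\<And>x. x \<in> A \<Longrightarrow> f x \<le> g x) \<Longrightarrow> mean A f \<le> mean A g"
  unfolding mean_def by (intro divide_right_mono sum_mono) auto

lemma mean_cong: "(\<And>x. x \<in> A \<Longrightarrow> f x = g x) \<Longrightarrow> mean A f = mean A g"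
  unfolding mean_def by (intro arg_cong2[where f = "(/)"] sum.cong) auto

lemma mean_Times: "mean (A \<times> B) f = mean A (\<lambda>a. mean B (\<lambda>b. f (a, b)))"
  unfolding mean_def by (simp add: sum.cartesian_product' card_cartesian_product sum_divide_distrib[symmetric] field_simps)

lemma mean_swap: "mean A (\<lambda>a. mean B (\<lambda>b. f a b)) = mean B (\<lambda>b. mean A (\<lambda>a. f a b))"
  unfolding mean_def by (simp add: sum_divide_distrib[symmetric] mult.commute sum.swap[of f B A])

lemma mean_singleton [simp]: "mean {x} f = f x"
  by (simp add: mean_def)

text \<open>\<open>A\<close> indexes what the receiver is given. The choice of \<open>v\<close>
  bounds the averaged quadratic terms divided by \<open>v\<close> by \<open>n\<close>, which is the
  summand 1 next to \<open>ln (pi * v)\<close>. These terms are linear in the powers, so a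
  constraint on the average power is enough.\<close>

lemma receiver_bound:
  fixes A :: "'k set" and B :: "'i set" and C :: "'j set"
  assumes A: "finite A" "A \<noteq> {}" and B: "finite B" "B \<noteq> {}" and C: "finite C" "C \<noteq> {}"
    and D: "\<And>k. k \<in> A \<Longrightarrow> D k \<in> blocks n \<rightarrow>\<^sub>M count_space UNIV"
    and err: "mean3 A B C (\<lambda>k i j. \<P>(z in noise1 n. D k (add_noise n (sh1 k i j) z) \<noteq> i)) \<le> \<epsilon>"
    and res: "mean3 A B C (\<lambda>k i j. \<Sum>t<n. (cmod (sh1 k i j t - \<kappa> k t - c * sh2 k i t))\<^sup>2) \<le> real n * \<rho>"
    and \<rho>: "\<rho> \<ge> 0" and v: "v = 3 * (\<rho> + noise_power * (1 + (cmod c)\<^sup>2))"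
  shows "(1 - \<epsilon>) * ln (real (card B)) - ln 2 \<le>
    mean A (\<lambda>k. mean B (\<lambda>i. mean C (mix_entropy n C (sh1 k i)))) + noise_entropy n
    - mean A (\<lambda>k. mean B (mix_entropy n B (sh2 k))) + real n * (ln (pi * v) + 1)"
proof -
  have "noise_power * (1 + (cmod c)\<^sup>2) > 0"
    using noise_power_pos by (intro mult_pos_pos add_pos_nonneg) auto
  then have v0: "v > 0"
    unfolding v using \<rho> by (intro mult_pos_pos[of 3] add_nonneg_pos) simp_all
  let ?P = "\<lambda>k i j. \<P>(z in noise1 n. D k (add_noise n (sh1 k i j) z) \<noteq> i)"
  let ?R = "\<lambda>k i j. \<Sum>t<n. (cmod (sh1 k i j t - \<kappa> k t - c * sh2 k i t))\<^sup>2"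
  let ?m = "\<lambda>f. mean3 A B C (\<lambda>k i j. f k i j)"
  define K where "K = ln (real (card B)) - ln 2 - (real n * (3 * (noise_power * (1 + (cmod c)\<^sup>2)))) / v - real n * ln (pi * v) - noise_entropy n"
  let ?T = "\<lambda>k i j. K - ln (real (card B)) * ?P k i j + mix_entropy n B (sh2 k) i - 3 * ?R k i j / v - mix_entropy n C (sh1 k i) j"
  have "?m (\<lambda>k i j. ?T k i j) \<le> mean A (\<lambda>_. 0)"
  proof (rule mean_mono)
    fix k assume k: "k \<in> A"
    have *: "\<P>(z in noise1 n. D k (add_noise n (sh1 k i j) z) = i) = 1 - ?P k i j" for i j
    proof -
      have "(\<lambda>z. add_noise n (sh1 k i j) z) \<in> noise1 n \<rightarrow>\<^sub>M blocks n"
        unfolding noise1_def by measurable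
      from measurable_sets[OF measurable_compose[OF this D[OF k]], of "{i}"]
      have S: "{z \<in> space (noise1 n). D k (add_noise n (sh1 k i j) z) = i} \<in> sets (noise1 n)"
        by (simp add: vimage_def Int_def conj_commute)
      have "space (noise1 n) - {z \<in> space (noise1 n). D k (add_noise n (sh1 k i j) z) = i}
        = {z \<in> space (noise1 n). D k (add_noise n (sh1 k i j) z) \<noteq> i}"
        by auto
      then show ?thesis
        using noise1.prob_compl[OF S] by simp
    qed
    have "(\<Sum>t<n. 3 * ((cmod (sh1 k i j t - \<kappa> k t - c * sh2 k i t))\<^sup>2 + noise_power * (1 + (cmod c)\<^sup>2))) / v
      = 3 * ?R k i j / v + (real n * (3 * (noise_power * (1 + (cmod c)\<^sup>2)))) / v" for i j
      by (simp add: distrib_left sum.distrib sum_distrib_left add_divide_distrib)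
    then have "(\<Sum>i\<in>B. \<Sum>j\<in>C. ?T k i j) \<le> 0"
      using sum_log_bound[OF B C v0 D[OF k], where ?sh1.0 = "sh1 k" and \<kappa> = "\<kappa> k" and c = c and ?sh2.0 = "sh2 k"]
      unfolding log_bound_def[OF B C v0 D[OF k]] * residual_def[OF B C v0 D[OF k]] K_def by (simp add: algebra_simps)
    then have "(\<Sum>i\<in>B. \<Sum>j\<in>C. ?T k i j)
       / real (card C) / real (card B) \<le> 0"
      by (simp add: divide_nonpos_nonneg)
    then show "mean B (\<lambda>i. mean C (\<lambda>j. ?T k i j)) \<le> 0"
      by (simp only: mean_def sum_divide_distrib)
  qed
  then have "K - ln (real (card B)) * ?m ?P + mean A (\<lambda>k. mean B (mix_entropy n B (sh2 k))) - 3 * ?m ?R / v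
     - mean A (\<lambda>k. mean B (\<lambda>i. mean C (mix_entropy n C (sh1 k i)))) \<le> 0"
    by (simp only: mean_add mean_diff mean_cmult mean_divide mean_const[OF A] mean_const[OF B] mean_const[OF C])
  moreover have "ln (real (card B)) * ?m ?P \<le> ln (real (card B)) * \<epsilon>"
    using B err by (intro mult_left_mono) (auto simp: Suc_le_eq card_gt_0_iff)
  moreover have "3 * ?m ?R / v \<le> 3 * (real n * \<rho>) / v"
    using res v0 by (intro divide_right_mono mult_left_mono) auto
  moreover have "3 * (real n * \<rho>) / v + (real n * (3 * (noise_power * (1 + (cmod c)\<^sup>2)))) / v = real n"
  proof -
    have "3 * (real n * \<rho>) / v + (real n * (3 * (noise_power * (1 + (cmod c)\<^sup>2)))) / v = real n * v / v"
      unfolding add_divide_distrib[symmetric] by (simp add: v algebra_simps)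
    then show ?thesis using v0 by simp
  qed
  ultimately show ?thesis
    unfolding K_def by (simp add: algebra_simps)
qed

text \<open>A negative entropy conditional on the common message. It enters with a plus sign at the
  receiver for which the signal is interference and with a minus sign at the one that gets it from
  the genie.\<close>

definition mean_entropy :: "nat \<Rightarrow> nat \<Rightarrow> nat \<Rightarrow> complex \<Rightarrow> (nat \<Rightarrow> nat \<Rightarrow> nat \<Rightarrow> complex) \<Rightarrow> real" where
  "mean_entropy n K0 K g f = mean {1..K0} (\<lambda>m0. mean {1..K} (mix_entropy n {1..K} (\<lambda>m t. g * f m0 m t)))"

text \<open>What the converse needs to know about a code from the point of view of one receiver; the other receiver
  has the same form with the users exchanged.\<close>

definition rx_facts :: "nat \<Rightarrow> nat \<Rightarrow> nat \<Rightarrow> nat \<Rightarrow> complex \<Rightarrow> complex \<Rightarrow> (nat \<Rightarrow> nat \<Rightarrow> nat \<Rightarrow> complex)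
    \<Rightarrow> (nat \<Rightarrow> nat \<Rightarrow> nat \<Rightarrow> complex) \<Rightarrow> ((nat \<Rightarrow> complex) \<Rightarrow> nat \<times> nat) \<Rightarrow> real \<Rightarrow> bool" where
  "rx_facts n K0 K1 K2 a b f1 f2 g \<epsilon> \<longleftrightarrow>
    K0 > 0 \<and> K1 > 0 \<and> K2 > 0 \<and> g \<in> blocks n \<rightarrow>\<^sub>M count_space UNIV \<and>
    mean3 {1..K0} {1..K1} {1..K2} (\<lambda>m0 m1 m2. \<P>(z in noise1 n. g (rx n a b (f1 m0 m1) (f2 m0 m2) z) \<noteq> (m0, m1))) \<le> \<epsilon> \<and>
    mean {1..K0} (\<lambda>m0. mean {1..K1} (\<lambda>m1. \<Sum>t<n. (cmod (f1 m0 m1 t))\<^sup>2)) \<le> real n \<and>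
    mean {1..K0} (\<lambda>m0. mean {1..K2} (\<lambda>m2. \<Sum>t<n. (cmod (f2 m0 m2 t))\<^sup>2)) \<le> real n"

text \<open>For \<open>v > 0\<close> this is \<open>ln (pi * exp 1 * v)\<close>, the differential
  entropy of a circular Gaussian of variance \<open>v\<close>.\<close>

definition cost :: "real \<Rightarrow> real" where
  "cost v = ln (pi * v) + 1"

text \<open>The factors 2 allow for the correlation that the common message creates between the two
  transmitters.\<close>

definition cost_all :: "complex \<Rightarrow> complex \<Rightarrow> real" where
  "cost_all a b = cost (3 * (2 * (cmod a)\<^sup>2 + 2 * (cmod b)\<^sup>2 + noise_power))"

definition cost_direct :: "complex \<Rightarrow> real" where
  "cost_direct a = cost (3 * ((cmod a)\<^sup>2 + noise_power))"

text \<open>Subtracting \<open>a / h\<close> times the genie signal removes the own signal and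
  leaves a combination of both noises.\<close>

definition cost_residual :: "complex \<Rightarrow> complex \<Rightarrow> real" where
  "cost_residual a h = cost (3 * (noise_power * (1 + (cmod (a / h))\<^sup>2)))"

text \<open>As in \<open>cost_residual\<close> the own signal is removed, but here the interference
  of power \<open>(cmod b)\<^sup>2\<close> remains.\<close>

definition cost_genie :: "complex \<Rightarrow> complex \<Rightarrow> complex \<Rightarrow> real" where
  "cost_genie a b h = cost (3 * ((cmod b)\<^sup>2 + noise_power * (1 + (cmod (a / h))\<^sup>2)))"

context
  fixes n K0 K1 K2 :: nat and a b :: complex and f1 f2 :: "nat \<Rightarrow> nat \<Rightarrow> nat \<Rightarrow> complex"
    and g1 :: "(nat \<Rightarrow> complex) \<Rightarrow> nat \<times> nat" and \<epsilon> :: real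
  assumes facts: "rx_facts n K0 K1 K2 a b f1 f2 g1 \<epsilon>"
begin

lemma index_sets:
  "finite {1..K0}" "{1..K0} \<noteq> {}" "finite {1..K1}" "{1..K1} \<noteq> {}" "finite {1..K2}" "{1..K2} \<noteq> {}"
  using facts by (auto simp: rx_facts_def)

lemma g1: "g1 \<in> blocks n \<rightarrow>\<^sub>M count_space UNIV"
  and err: "mean3 {1..K0} {1..K1} {1..K2} (\<lambda>m0 m1 m2. \<P>(z in noise1 n. g1 (rx n a b (f1 m0 m1) (f2 m0 m2) z) \<noteq> (m0, m1))) \<le> \<epsilon>"
  and pow1: "mean {1..K0} (\<lambda>m0. mean {1..K1} (\<lambda>m1. \<Sum>t<n. (cmod (f1 m0 m1 t))\<^sup>2)) \<le> real n"
  and pow2: "mean {1..K0} (\<lambda>m0. mean {1..K2} (\<lambda>m2. \<Sum>t<n. (cmod (f2 m0 m2 t))\<^sup>2)) \<le> real n"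
  using facts unfolding rx_facts_def by blast+

lemma rx_eq: "rx n a b x1 x2 z = restrict (\<lambda>t. (a * x1 t + b * x2 t) + z t) {..<n}"
  by (simp add: rx_def)

lemma err_private_le:
  "\<P>(z in noise1 n. snd (g1 (restrict (\<lambda>t. (a * f1 m0 m1 t + b * f2 m0 m2 t) + z t) {..<n})) \<noteq> m1)
   \<le> \<P>(z in noise1 n. g1 (rx n a b (f1 m0 m1) (f2 m0 m2) z) \<noteq> (m0, m1))"
  unfolding rx_eq[symmetric]
  by (intro noise1.finite_measure_mono decoder_error_sets g1) auto

lemma snd_g1: "(\<lambda>y. snd (g1 y)) \<in> blocks n \<rightarrow>\<^sub>M count_space UNIV"
  by (rule measurable_compose[OF g1]) simp

lemma scaled_power: "mean {1..K0} (\<lambda>m0. mean {1..K} (\<lambda>m. \<Sum>t<n. (cmod (h * f m0 m t))\<^sup>2)) \<le> real n * (cmod h)\<^sup>2"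
  if "mean {1..K0} (\<lambda>m0. mean {1..K} (\<lambda>m. \<Sum>t<n. (cmod (f m0 m t))\<^sup>2)) \<le> real n" for h f K
proof -
  have "mean {1..K0} (\<lambda>m0. mean {1..K} (\<lambda>m. \<Sum>t<n. (cmod (h * f m0 m t))\<^sup>2))
    = (cmod h)\<^sup>2 * mean {1..K0} (\<lambda>m0. mean {1..K} (\<lambda>m. \<Sum>t<n. (cmod (f m0 m t))\<^sup>2))"
    by (simp only: norm_mult power_mult_distrib sum_distrib_left[symmetric] mean_cmult)
  then show ?thesis
    using mult_left_mono[OF that, of "(cmod h)\<^sup>2"] by (simp add: mult.commute)
qed

text \<open>No genie: with \<open>c = 0\<close> and a zero signal the genie block is pure noise, and
  the two noise entropies cancel. Nothing is given, so the common message is among the messages to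
  be decoded.\<close>

lemma bound_all_messages:
  "(1 - \<epsilon>) * ln (real (K0 * K1)) - ln 2
    \<le> mean_entropy n K0 K2 b f2 + real n * cost_all a b"
proof -
  let ?sh1 = "\<lambda>(_ :: unit) (m :: nat \<times> nat) m2 t. a * f1 (fst m) (snd m) t + b * f2 (fst m) m2 t"
  let ?sh2 = "\<lambda>(_ :: unit) (m :: nat \<times> nat) (t :: nat). 0 :: complex"
  have "(1 - \<epsilon>) * ln (real (card ({1..K0} \<times> {1..K1}))) - ln 2 \<le>
    mean {()} (\<lambda>k. mean ({1..K0} \<times> {1..K1}) (\<lambda>i. mean {1..K2} (mix_entropy n {1..K2} (?sh1 k i)))) + noise_entropy n
    - mean {()} (\<lambda>k. mean ({1..K0} \<times> {1..K1}) (mix_entropy n ({1..K0} \<times> {1..K1}) (?sh2 k)))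
    + real n * (ln (pi * (3 * (2 * (cmod a)\<^sup>2 + 2 * (cmod b)\<^sup>2 + noise_power))) + 1)"
  proof (rule receiver_bound[where D = "\<lambda>_. g1" and \<kappa> = "\<lambda>_ _. 0" and c = 0 and \<rho> = "2 * (cmod a)\<^sup>2 + 2 * (cmod b)\<^sup>2"])
    show "mean {()} (\<lambda>k. mean ({1..K0} \<times> {1..K1}) (\<lambda>i. mean {1..K2} (\<lambda>j. \<P>(z in noise1 n. g1 (add_noise n (?sh1 k i j) z) \<noteq> i)))) \<le> \<epsilon>"
      using err unfolding rx_eq by (simp add: mean_Times)
    have "mean3 {1..K0} {1..K1} {1..K2} (\<lambda>m0 m1 m2. \<Sum>t<n. (cmod (a * f1 m0 m1 t + b * f2 m0 m2 t))\<^sup>2)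
      \<le> mean3 {1..K0} {1..K1} {1..K2} (\<lambda>m0 m1 m2. 2 * (\<Sum>t<n. (cmod (a * f1 m0 m1 t))\<^sup>2) + 2 * (\<Sum>t<n. (cmod (b * f2 m0 m2 t))\<^sup>2))"
    proof (intro mean_mono)
      fix m0 m1 m2
      have "(cmod (x + y))\<^sup>2 \<le> 2 * (cmod x)\<^sup>2 + 2 * (cmod y)\<^sup>2" for x y
      proof -
        have "(cmod (x + y))\<^sup>2 \<le> (cmod x + cmod y)\<^sup>2"
          by (intro power_mono norm_triangle_ineq) simp
        also have "\<dots> \<le> 2 * (cmod x)\<^sup>2 + 2 * (cmod y)\<^sup>2"
          using sum_squares_bound[of "cmod x" "cmod y"] by (simp add: power2_sum)
        finally show ?thesis .
      qed
      then show "(\<Sum>t<n. (cmod (a * f1 m0 m1 t + b * f2 m0 m2 t))\<^sup>2) \<le> 2 * (\<Sum>t<n. (cmod (a * f1 m0 m1 t))\<^sup>2) + 2 * (\<Sum>t<n. (cmod (b * f2 m0 m2 t))\<^sup>2)"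
        unfolding sum_distrib_left sum.distrib[symmetric] by (intro sum_mono)
    qed
    also have "\<dots> = 2 * mean {1..K0} (\<lambda>m0. mean {1..K1} (\<lambda>m1. \<Sum>t<n. (cmod (a * f1 m0 m1 t))\<^sup>2))
        + 2 * mean {1..K0} (\<lambda>m0. mean {1..K2} (\<lambda>m2. \<Sum>t<n. (cmod (b * f2 m0 m2 t))\<^sup>2))"
      by (simp only: mean_add mean_cmult mean_const[OF index_sets(3,4)] mean_const[OF index_sets(5,6)])
    also have "\<dots> \<le> real n * (2 * (cmod a)\<^sup>2 + 2 * (cmod b)\<^sup>2)"
      using scaled_power[OF pow1, of a] scaled_power[OF pow2, of b] by (simp add: algebra_simps)
    finally show "mean {()} (\<lambda>k. mean ({1..K0} \<times> {1..K1}) (\<lambda>i. mean {1..K2} (\<lambda>j. \<Sum>t<n. (cmod (?sh1 k i j t - 0 - 0 * ?sh2 k i t))\<^sup>2)))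
      \<le> real n * (2 * (cmod a)\<^sup>2 + 2 * (cmod b)\<^sup>2)"
      by (simp add: mean_Times)
  qed (use index_sets g1 in auto)
  moreover have "mean ({1..K0} \<times> {1..K1}) (mix_entropy n ({1..K0} \<times> {1..K1}) (?sh2 ())) = noise_entropy n"
  proof -
    have "mean ({1..K0} \<times> {1..K1}) (mix_entropy n ({1..K0} \<times> {1..K1}) (?sh2 ())) = mean ({1..K0} \<times> {1..K1}) (\<lambda>_. noise_entropy n)"
      by (intro mean_cong mix_entropy_const[where w = "\<lambda>_. 0"]) auto
    then show ?thesis using index_sets by (simp add: mean_const)
  qed
  moreover have "mean ({1..K0} \<times> {1..K1}) (\<lambda>i. mean {1..K2} (mix_entropy n {1..K2} (?sh1 () i))) = mean_entropy n K0 K2 b f2"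
  proof -
    have "mean {1..K2} (mix_entropy n {1..K2} (?sh1 () i)) = mean {1..K2} (mix_entropy n {1..K2} (\<lambda>m2 t. b * f2 (fst i) m2 t))" for i
      by (intro mean_cong mix_entropy_translate[where w = "\<lambda>t. a * f1 (fst i) (snd i) t"]) auto
    then show ?thesis
      unfolding mean_entropy_def by (simp only: mean_Times fst_conv mean_const[OF index_sets(3,4)])
  qed
  ultimately show ?thesis
    unfolding cost_all_def cost_def by (simp add: card_cartesian_product)
qed

text \<open>The common message is given, and \<open>c = a / h\<close> makes the linear estimate
  remove the own signal, which leaves the interference as residual.\<close>

lemma bound_private_genie:
  assumes "h \<noteq> 0"
  shows "(1 - \<epsilon>) * ln (real K1) - ln 2
    \<le> mean_entropy n K0 K2 b f2 - mean_entropy n K0 K1 h f1 + real n * cost_genie a b h"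
proof -
  define c where "c = a / h"
  then have c: "c * h = a" using assms by simp
  let ?sh1 = "\<lambda>m0 m1 m2 t. a * f1 m0 m1 t + b * f2 m0 m2 t" and ?sh2 = "\<lambda>m0 m1 t. h * f1 m0 m1 t"
  have "(1 - \<epsilon>) * ln (real (card {1..K1})) - ln 2 \<le>
    mean {1..K0} (\<lambda>m0. mean {1..K1} (\<lambda>m1. mean {1..K2} (mix_entropy n {1..K2} (?sh1 m0 m1)))) + noise_entropy n
    - mean {1..K0} (\<lambda>m0. mean {1..K1} (mix_entropy n {1..K1} (?sh2 m0)))
    + real n * (ln (pi * (3 * ((cmod b)\<^sup>2 + noise_power * (1 + (cmod c)\<^sup>2)))) + 1)"
  proof (rule receiver_bound[where D = "\<lambda>_ y. snd (g1 y)" and \<kappa> = "\<lambda>_ _. 0" and c = c and \<rho> = "(cmod b)\<^sup>2"])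
    show "mean3 {1..K0} {1..K1} {1..K2} (\<lambda>m0 m1 m2. \<P>(z in noise1 n. snd (g1 (add_noise n (?sh1 m0 m1 m2) z)) \<noteq> m1)) \<le> \<epsilon>"
      by (rule order_trans[OF _ err]) (intro mean_mono err_private_le)
    have "?sh1 m0 m1 m2 t - 0 - c * ?sh2 m0 m1 t = b * f2 m0 m2 t" for m0 m1 m2 t
      using c by (simp flip: mult.assoc)
    then show "mean3 {1..K0} {1..K1} {1..K2} (\<lambda>m0 m1 m2. \<Sum>t<n. (cmod (?sh1 m0 m1 m2 t - 0 - c * ?sh2 m0 m1 t))\<^sup>2)
      \<le> real n * (cmod b)\<^sup>2"
      using scaled_power[OF pow2, of b] by (simp only: mean_const[OF index_sets(3,4)])
  qed (use index_sets snd_g1 in auto)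
  moreover have "mean {1..K0} (\<lambda>m0. mean {1..K1} (\<lambda>m1. mean {1..K2} (mix_entropy n {1..K2} (?sh1 m0 m1)))) = mean_entropy n K0 K2 b f2"
  proof -
    have "mean {1..K2} (mix_entropy n {1..K2} (?sh1 m0 m1)) = mean {1..K2} (mix_entropy n {1..K2} (\<lambda>m2 t. b * f2 m0 m2 t))" for m0 m1
      by (intro mean_cong mix_entropy_translate[where w = "\<lambda>t. a * f1 m0 m1 t"]) auto
    then show ?thesis
      unfolding mean_entropy_def by (simp only: mean_const[OF index_sets(3,4)])
  qed
  ultimately show ?thesis
    using noise_entropy_le_0[of n] unfolding cost_genie_def cost_def mean_entropy_def c_def by simp
qed

text \<open>The interfering message is given as well, so the interference is the known shift
  \<open>\<kappa>\<close> and the unknown index is trivial. Two cases are needed: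
  \<open>c = a / g\<close> with a genie, and \<open>c = g = 0\<close> without one.\<close>

lemma bound_private_known_interference_aux:
  assumes c: "\<rho> = (cmod (a - c * g))\<^sup>2"
  shows "(1 - \<epsilon>) * ln (real K1) - ln 2
    \<le> 2 * noise_entropy n - mean_entropy n K0 K1 g f1 + real n * cost (3 * (\<rho> + noise_power * (1 + (cmod c)\<^sup>2)))"
proof -
  let ?A = "{1..K0} \<times> {1..K2}"
  let ?sh1 = "\<lambda>(k :: nat \<times> nat) m1 (_ :: unit) t. a * f1 (fst k) m1 t + b * f2 (fst k) (snd k) t"
  let ?sh2 = "\<lambda>(k :: nat \<times> nat) m1 t. g * f1 (fst k) m1 t"
  have "(1 - \<epsilon>) * ln (real (card {1..K1})) - ln 2 \<le>
    mean ?A (\<lambda>k. mean {1..K1} (\<lambda>m1. mean {()} (mix_entropy n {()} (?sh1 k m1)))) + noise_entropy n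
    - mean ?A (\<lambda>k. mean {1..K1} (mix_entropy n {1..K1} (?sh2 k)))
    + real n * (ln (pi * (3 * (\<rho> + noise_power * (1 + (cmod c)\<^sup>2)))) + 1)"
  proof (rule receiver_bound[where D = "\<lambda>_ y. snd (g1 y)" and \<kappa> = "\<lambda>k t. b * f2 (fst k) (snd k) t" and c = c and \<rho> = \<rho>])
    have "mean3 ?A {1..K1} {()} (\<lambda>k m1 j. \<P>(z in noise1 n. snd (g1 (add_noise n (?sh1 k m1 j) z)) \<noteq> m1))
      = mean3 {1..K0} {1..K1} {1..K2} (\<lambda>m0 m1 m2. \<P>(z in noise1 n. snd (g1 (restrict (\<lambda>t. (a * f1 m0 m1 t + b * f2 m0 m2 t) + z t) {..<n})) \<noteq> m1))"
      by (simp only: mean_Times mean_singleton fst_conv snd_conv mean_swap[of "{1..K2}" "{1..K1}"])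
    also have "\<dots> \<le> \<epsilon>"
      by (rule order_trans[OF _ err]) (intro mean_mono err_private_le)
    finally show "mean3 ?A {1..K1} {()} (\<lambda>k m1 j. \<P>(z in noise1 n. snd (g1 (add_noise n (?sh1 k m1 j) z)) \<noteq> m1)) \<le> \<epsilon>" .
    have "?sh1 k m1 j t - b * f2 (fst k) (snd k) t - c * ?sh2 k m1 t = (a - c * g) * f1 (fst k) m1 t" for k m1 j t
      by (simp add: algebra_simps)
    then show "mean3 ?A {1..K1} {()} (\<lambda>k m1 j. \<Sum>t<n. (cmod (?sh1 k m1 j t - b * f2 (fst k) (snd k) t - c * ?sh2 k m1 t))\<^sup>2)
      \<le> real n * \<rho>"
      unfolding c using scaled_power[OF pow1, of "a - c * g"]
      by (simp only: mean_Times fst_conv snd_conv mean_singleton mean_const[OF index_sets(5,6)])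
  qed (use index_sets snd_g1 c in auto)
  moreover have "mean ?A (\<lambda>k. mean {1..K1} (\<lambda>m1. mean {()} (mix_entropy n {()} (?sh1 k m1)))) = noise_entropy n"
  proof -
    have "mix_entropy n {()} (?sh1 k m1) () = noise_entropy n" for k m1
      by (rule mix_entropy_const[where w = "?sh1 k m1 ()"]) auto
    then show ?thesis
      using index_sets by (simp add: mean_const)
  qed
  moreover have "mean ?A (\<lambda>k. mean {1..K1} (mix_entropy n {1..K1} (?sh2 k))) = mean_entropy n K0 K1 g f1"
    unfolding mean_entropy_def by (simp only: mean_Times fst_conv mean_const[OF index_sets(5,6)])
  ultimately show ?thesis
    unfolding cost_def by simp
qed

lemma bound_private_known_interference:
  assumes "h \<noteq> 0"
  shows "(1 - \<epsilon>) * ln (real K1) - ln 2 \<le> - mean_entropy n K0 K1 h f1 + real n * cost_residual a h"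
  using bound_private_known_interference_aux[of 0 "a / h" h] assms noise_entropy_le_0[of n]
  unfolding cost_residual_def by simp

lemma bound_private:
  "(1 - \<epsilon>) * ln (real K1) - ln 2 \<le> real n * cost_direct a"
proof -
  \<comment> \<open>At gain 0 the genie signal is pure noise, and its entropy cancels one of the two
    noise entropies.\<close>
  have "mean_entropy n K0 K1 0 f1 = mean {1..K0} (\<lambda>m0. mean {1..K1} (\<lambda>_. noise_entropy n))"
    unfolding mean_entropy_def by (intro mean_cong mix_entropy_const[where w = "\<lambda>_. 0"]) auto
  also have "\<dots> = noise_entropy n"
    by (simp only: mean_const[OF index_sets(1,2)] mean_const[OF index_sets(3,4)])
  finally show ?thesis
    using bound_private_known_interference_aux[of "(cmod a)\<^sup>2" 0 0] noise_entropy_le_0[of n]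
    unfolding cost_direct_def by simp
qed

lemma mean_entropy_le_0: "mean_entropy n K0 K1 g f1 \<le> 0" "mean_entropy n K0 K2 g f2 \<le> 0"
proof -
  have "mean_entropy n K0 K g f \<le> 0" for K f
  proof -
    have "mean_entropy n K0 K g f \<le> mean {1..K0} (\<lambda>m0. mean {1..K} (\<lambda>m. 0))"
      unfolding mean_entropy_def by (intro mean_mono mix_entropy_le_0) auto
    also have "\<dots> = 0" by (simp add: mean_def)
    finally show ?thesis .
  qed
  then show "mean_entropy n K0 K1 g f1 \<le> 0" "mean_entropy n K0 K2 g f2 \<le> 0" by auto
qed

end

section \<open>Converse\<close>

lemma valid_code_rx_facts:
  fixes h11 h12 h21 h22 :: complex
  assumes "valid_code n K0 K1 K2 f1 f2 g1 g2" and K: "K0 > 0" "K1 > 0" "K2 > 0"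
  defines "\<epsilon> \<equiv> err_prob h11 h12 h21 h22 n K0 K1 K2 f1 f2 g1 g2"
  shows "rx_facts n K0 K1 K2 h11 h12 f1 f2 g1 \<epsilon>" "rx_facts n K0 K2 K1 h22 h21 f2 f1 g2 \<epsilon>"
proof -
  have n: "n > 0" and g: "g1 \<in> blocks n \<rightarrow>\<^sub>M count_space UNIV" "g2 \<in> blocks n \<rightarrow>\<^sub>M count_space UNIV"
    and p1: "(1 / real n) * (\<Sum>t<n. (1 / (real K0 * real K1)) * (\<Sum>m0\<in>{1..K0}. \<Sum>m1\<in>{1..K1}. (cmod (f1 m0 m1 t))\<^sup>2)) \<le> 1"
    and p2: "(1 / real n) * (\<Sum>t<n. (1 / (real K0 * real K2)) * (\<Sum>m0\<in>{1..K0}. \<Sum>m2\<in>{1..K2}. (cmod (f2 m0 m2 t))\<^sup>2)) \<le> 1"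
    using assms(1) unfolding valid_code_def by auto
  have pow: "mean {1..K0} (\<lambda>m0. mean {1..K} (\<lambda>m. \<Sum>t<n. (cmod (f m0 m t))\<^sup>2)) \<le> real n"
    if "(1 / real n) * (\<Sum>t<n. (1 / (real K0 * real K)) * (\<Sum>m0\<in>{1..K0}. \<Sum>m\<in>{1..K}. (cmod (f m0 m t))\<^sup>2)) \<le> 1"
    for f :: "nat \<Rightarrow> nat \<Rightarrow> nat \<Rightarrow> complex" and K
  proof -
    have "mean {1..K0} (\<lambda>m0. mean {1..K} (\<lambda>m. \<Sum>t<n. (cmod (f m0 m t))\<^sup>2))
      = (\<Sum>t<n. mean {1..K0} (\<lambda>m0. mean {1..K} (\<lambda>m. (cmod (f m0 m t))\<^sup>2)))"
      by (simp only: mean_sum)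
    also have "\<dots> = (\<Sum>t<n. (1 / (real K0 * real K)) * (\<Sum>m0\<in>{1..K0}. \<Sum>m\<in>{1..K}. (cmod (f m0 m t))\<^sup>2))"
      by (intro sum.cong refl) (simp add: mean_def sum_divide_distrib[symmetric] mult.commute)
    also have "\<dots> \<le> real n"
      using that n by (simp add: field_simps)
    finally show ?thesis .
  qed
  let ?E = "\<lambda>m0 m1 m2. measure (noise n) {zz \<in> space (noise n).
      g1 (rx n h11 h12 (f1 m0 m1) (f2 m0 m2) (fst zz)) \<noteq> (m0, m1) \<or>
      g2 (rx n h21 h22 (f1 m0 m1) (f2 m0 m2) (snd zz)) \<noteq> (m0, m2)}"
  have \<epsilon>: "\<epsilon> = mean3 {1..K0} {1..K1} {1..K2} (\<lambda>m0 m1 m2. ?E m0 m1 m2)"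
    unfolding \<epsilon>_def err_prob_def by (simp add: mean_def sum_divide_distrib[symmetric] mult_ac)
  have swap: "rx n h22 h21 (f2 m0 m2) (f1 m0 m1) = rx n h21 h22 (f1 m0 m1) (f2 m0 m2)" for m0 m1 m2
    by (auto simp: rx_def fun_eq_iff)
  note ge = prob_noise_disj(2,3)[OF decoder_error_sets[OF g(1)] decoder_error_sets[OF g(2)]]
  have e1: "mean3 {1..K0} {1..K1} {1..K2} (\<lambda>m0 m1 m2. \<P>(z in noise1 n. g1 (rx n h11 h12 (f1 m0 m1) (f2 m0 m2) z) \<noteq> (m0, m1))) \<le> \<epsilon>"
    unfolding \<epsilon> by (intro mean_mono ge(1))
  have "mean3 {1..K0} {1..K1} {1..K2} (\<lambda>m0 m1 m2. \<P>(z in noise1 n. g2 (rx n h21 h22 (f1 m0 m1) (f2 m0 m2) z) \<noteq> (m0, m2))) \<le> \<epsilon>"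
    unfolding \<epsilon> by (intro mean_mono ge(2))
  then have e2: "mean3 {1..K0} {1..K2} {1..K1} (\<lambda>m0 m2 m1. \<P>(z in noise1 n. g2 (rx n h22 h21 (f2 m0 m2) (f1 m0 m1) z) \<noteq> (m0, m2))) \<le> \<epsilon>"
    unfolding swap by (simp only: mean_swap[of "{1..K2}" "{1..K1}"])
  show "rx_facts n K0 K1 K2 h11 h12 f1 f2 g1 \<epsilon>" "rx_facts n K0 K2 K1 h22 h21 f2 f1 g2 \<epsilon>"
    unfolding rx_facts_def using K g e1 e2 pow[OF p1] pow[OF p2] by blast+
qed

text \<open>What the converse uses of achievability, in a form that is visibly symmetric in the
  users, so that every bound is proved for one user only.\<close>

definition reliable :: "complex \<Rightarrow> complex \<Rightarrow> complex \<Rightarrow> complex \<Rightarrow> real \<Rightarrow> real \<Rightarrow> real \<Rightarrow> bool" where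
  "reliable h11 h12 h21 h22 R0 R1 R2 \<longleftrightarrow> R0 \<ge> 0 \<and> R1 \<ge> 0 \<and> R2 \<ge> 0 \<and>
    (\<exists>f1 f2 g1 g2 \<epsilon>. \<epsilon> \<longlonglongrightarrow> 0 \<and> (\<forall>n>0.
      rx_facts n (msgs n R0) (msgs n R1) (msgs n R2) h11 h12 (f1 n) (f2 n) (g1 n) (\<epsilon> n) \<and>
      rx_facts n (msgs n R0) (msgs n R2) (msgs n R1) h22 h21 (f2 n) (f1 n) (g2 n) (\<epsilon> n)))"

lemma reliable_swap: "reliable h11 h12 h21 h22 R0 R1 R2 \<Longrightarrow> reliable h22 h21 h12 h11 R0 R2 R1"
  unfolding reliable_def by blast

lemma achievable_imp_reliable:
  assumes "achievable h11 h12 h21 h22 R0 R1 R2"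
  shows "reliable h11 h12 h21 h22 R0 R1 R2"
proof -
  obtain f1 f2 g1 g2 where R: "R0 \<ge> 0" "R1 \<ge> 0" "R2 \<ge> 0"
    and code: "\<forall>n>0. valid_code n (msgs n R0) (msgs n R1) (msgs n R2) (f1 n) (f2 n) (g1 n) (g2 n)"
    and lim: "(\<lambda>n. err_prob h11 h12 h21 h22 n (msgs n R0) (msgs n R1) (msgs n R2) (f1 n) (f2 n) (g1 n) (g2 n)) \<longlonglongrightarrow> 0"
    using assms unfolding achievable_def by blast
  have "\<forall>n>0. rx_facts n (msgs n R0) (msgs n R1) (msgs n R2) h11 h12 (f1 n) (f2 n) (g1 n) (err_prob h11 h12 h21 h22 n (msgs n R0) (msgs n R1) (msgs n R2) (f1 n) (f2 n) (g1 n) (g2 n)) \<and>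
      rx_facts n (msgs n R0) (msgs n R2) (msgs n R1) h22 h21 (f2 n) (f1 n) (g2 n) (err_prob h11 h12 h21 h22 n (msgs n R0) (msgs n R1) (msgs n R2) (f1 n) (f2 n) (g1 n) (g2 n))"
    using code by (intro allI impI conjI valid_code_rx_facts msgs_pos) auto
  then show ?thesis
    unfolding reliable_def using R lim by blast
qed

lemma rate_le_of_block_bound:
  assumes \<epsilon>: "\<epsilon> \<longlonglongrightarrow> 0" and b: "\<And>n. n > 0 \<Longrightarrow> (1 - \<epsilon> n) * L n \<le> k + real n * W"
    and L: "\<And>n. real n * S \<le> L n"
  shows "S \<le> W"
proof (rule tendsto_le[OF sequentially_bot])
  have "(\<lambda>n. k / real n) \<longlonglongrightarrow> 0" by (rule lim_const_over_n)
  then have "(\<lambda>n. k / real n + W) \<longlonglongrightarrow> 0 + W" by (intro tendsto_add tendsto_const)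
  then show "(\<lambda>n. k / real n + W) \<longlonglongrightarrow> W" by simp
  have "(\<lambda>n. (1 - \<epsilon> n) * S) \<longlonglongrightarrow> (1 - 0) * S" by (intro tendsto_intros \<epsilon>)
  then show "(\<lambda>n. (1 - \<epsilon> n) * S) \<longlonglongrightarrow> S" by simp
  have "\<forall>\<^sub>F n in sequentially. \<epsilon> n < 1" using \<epsilon> by (rule order_tendstoD) simp
  then show "\<forall>\<^sub>F n in sequentially. (1 - \<epsilon> n) * S \<le> k / real n + W"
    using eventually_gt_at_top[of 0]
  proof eventually_elim
    case (elim n)
    have "(1 - \<epsilon> n) * (real n * S) \<le> (1 - \<epsilon> n) * L n"
      using elim L by (intro mult_left_mono) auto
    also have "\<dots> \<le> k + real n * W" using elim b by simp
    finally show ?case using elim by (simp add: field_simps)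
  qed
qed

lemma ln_msgs_ge: "real n * (R * ln 2) \<le> ln (real (msgs n R))"
proof -
  have "ln (2 powr (real n * R)) \<le> ln (real (msgs n R))"
    by (intro ln_mono msgs_ge) (auto simp: msgs_pos)
  then show ?thesis by (simp add: ln_powr mult.assoc)
qed

text \<open>The sums are chosen so that interference entropies cancel. The two genie bounds cancel
  crosswise; the bound with known interference at receiver 1 cancels the entropy of
  \<open>h21 x1 + z2\<close> at receiver 2; in the last bound receiver 1 is used twice and the genie
  bound of receiver 2 links both uses.\<close>

lemma reliable_bounds:
  assumes "reliable h11 h12 h21 h22 R0 R1 R2" and nz: "h12 \<noteq> 0" "h21 \<noteq> 0"
  shows "(R0 + R1) * ln 2 \<le> cost_all h11 h12"
    and "R1 * ln 2 \<le> cost_direct h11"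
    and "(R1 + R2) * ln 2 \<le> cost_genie h11 h12 h21
      + cost_genie h22 h21 h12"
    and "(R0 + R1 + R2) * ln 2 \<le> cost_residual h11 h21
      + cost_all h22 h21"
    and "(R0 + 2 * R1 + R2) * ln 2 \<le> cost_residual h11 h21
      + cost_all h11 h12
      + cost_genie h22 h21 h12"
proof -
  obtain f1 f2 g1 g2 \<epsilon> where \<epsilon>: "\<epsilon> \<longlonglongrightarrow> 0"
    and F1: "\<And>n. n > 0 \<Longrightarrow> rx_facts n (msgs n R0) (msgs n R1) (msgs n R2) h11 h12 (f1 n) (f2 n) (g1 n) (\<epsilon> n)"
    and F2: "\<And>n. n > 0 \<Longrightarrow> rx_facts n (msgs n R0) (msgs n R2) (msgs n R1) h22 h21 (f2 n) (f1 n) (g2 n) (\<epsilon> n)"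
    using assms(1) unfolding reliable_def by blast
  let ?l0 = "\<lambda>n. ln (real (msgs n R0))" and ?l1 = "\<lambda>n. ln (real (msgs n R1))" and ?l2 = "\<lambda>n. ln (real (msgs n R2))"
  have ln2: "ln (real (msgs n R * msgs n S)) = ln (real (msgs n R)) + ln (real (msgs n S))" for n R S
    by (simp add: ln_mult msgs_pos)
  note all1 = bound_all_messages[OF F1, unfolded ln2] and all2 = bound_all_messages[OF F2, unfolded ln2]
  note known1 = bound_private_known_interference[OF F1 nz(2)]
  note genie1 = bound_private_genie[OF F1 nz(2)] and genie2 = bound_private_genie[OF F2 nz(1)]
  note ge0 = ln_msgs_ge[of _ R0] and ge1 = ln_msgs_ge[of _ R1] and ge2 = ln_msgs_ge[of _ R2]
  show "(R0 + R1) * ln 2 \<le> cost_all h11 h12"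
  proof (rule rate_le_of_block_bound[OF \<epsilon>])
    show "(1 - \<epsilon> n) * (?l0 n + ?l1 n) \<le> ln 2 + real n * cost_all h11 h12" if "n > 0" for n
      using all1[OF that] mean_entropy_le_0(2)[OF F1[OF that], of h12] by linarith
    show "real n * ((R0 + R1) * ln 2) \<le> ?l0 n + ?l1 n" for n
      using ge0[of n] ge1[of n] by (simp add: algebra_simps)
  qed
  show "R1 * ln 2 \<le> cost_direct h11"
  proof (rule rate_le_of_block_bound[OF \<epsilon>])
    show "(1 - \<epsilon> n) * ?l1 n \<le> ln 2 + real n * cost_direct h11" if "n > 0" for n
      using bound_private[OF F1[OF that]] by linarith
  qed (rule ge1)
  show "(R1 + R2) * ln 2 \<le> cost_genie h11 h12 h21
      + cost_genie h22 h21 h12" (is "_ \<le> ?c1 + ?c2")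
  proof (rule rate_le_of_block_bound[OF \<epsilon>])
    show "(1 - \<epsilon> n) * (?l1 n + ?l2 n) \<le> 2 * ln 2 + real n * (?c1 + ?c2)" if "n > 0" for n
      using genie1[OF that] genie2[OF that] unfolding distrib_left by linarith
    show "real n * ((R1 + R2) * ln 2) \<le> ?l1 n + ?l2 n" for n
      using ge1[of n] ge2[of n] by (simp add: algebra_simps)
  qed
  show "(R0 + R1 + R2) * ln 2 \<le> cost_residual h11 h21
      + cost_all h22 h21" (is "_ \<le> ?c1 + ?c2")
  proof (rule rate_le_of_block_bound[OF \<epsilon>])
    show "(1 - \<epsilon> n) * ((?l0 n + ?l2 n) + ?l1 n) \<le> 2 * ln 2 + real n * (?c1 + ?c2)" if "n > 0" for n
      using known1[OF that] all2[OF that] unfolding distrib_left[of _ _ "?l1 n"] distrib_left[of "real n"] by linarith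
    show "real n * ((R0 + R1 + R2) * ln 2) \<le> (?l0 n + ?l2 n) + ?l1 n" for n
      using ge0[of n] ge1[of n] ge2[of n] by (simp add: algebra_simps)
  qed
  show "(R0 + 2 * R1 + R2) * ln 2 \<le> cost_residual h11 h21
      + cost_all h11 h12
      + cost_genie h22 h21 h12" (is "_ \<le> ?c1 + ?c2 + ?c3")
  proof (rule rate_le_of_block_bound[OF \<epsilon>])
    show "(1 - \<epsilon> n) * ((?l0 n + ?l1 n) + (?l1 n + ?l2 n)) \<le> 3 * ln 2 + real n * (?c1 + ?c2 + ?c3)" if "n > 0" for n
      using all1[OF that] known1[OF that] genie2[OF that]
      unfolding distrib_left[of _ "?l0 n + ?l1 n"] distrib_left[of _ "?l1 n" "?l2 n"] distrib_left[of "real n"] by linarith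
    show "real n * ((R0 + 2 * R1 + R2) * ln 2) \<le> (?l0 n + ?l1 n) + (?l1 n + ?l2 n)" for n
      using ge0[of n] ge1[of n] ge2[of n] by (simp add: algebra_simps)
  qed
qed

section \<open>From rate bounds to degrees of freedom\<close>

lemma capacity_region_linear_bound:
  assumes "\<And>R0 R1 R2. reliable h11 h12 h21 h22 R0 R1 R2 \<Longrightarrow> (c0 * R0 + c1 * R1 + c2 * R2) * ln 2 \<le> W"
    and "(R0, R1, R2) \<in> capacity_region h11 h12 h21 h22"
  shows "(c0 * R0 + c1 * R1 + c2 * R2) * ln 2 \<le> W"
proof -
  let ?S = "{p :: real \<times> real \<times> real. (c0 * fst p + c1 * fst (snd p) + c2 * snd (snd p)) * ln 2 \<le> W}"
  \<comment> \<open>The capacity region is a closure, and a closed half-space that contains the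
    achievable triples contains it too.\<close>
  have "closed ?S"
    by (intro closed_Collect_le continuous_intros)
  moreover have "{(R0, R1, R2). achievable h11 h12 h21 h22 R0 R1 R2} \<subseteq> ?S"
    using assms(1) achievable_imp_reliable by auto
  ultimately have "capacity_region h11 h12 h21 h22 \<subseteq> ?S"
    unfolding capacity_region_def by (rule closure_minimal[rotated])
  then show ?thesis using assms(2) by auto
qed

text \<open>The 12 is \<open>3 * (2 + 2)\<close> from the variance in \<open>cost_all\<close>; it is
  large enough for the other costs.\<close>

definition cost_const :: real where
  "cost_const = ln (pi * (12 * (1 + noise_power))) + 1"

lemma cost_le:
  assumes "P \<ge> 1" "v \<le> 12 * (1 + noise_power) * P powr e" "v > 0"
  shows "cost v \<le> cost_const + e * ln P"
proof -
  have "ln (pi * v) \<le> ln (pi * (12 * (1 + noise_power)) * P powr e)"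
    using assms by (intro ln_mono) (auto simp: mult.assoc)
  also have "\<dots> = ln (pi * (12 * (1 + noise_power))) + e * ln P"
    using assms noise_power_pos by (subst ln_mult) (auto simp: ln_powr)
  finally show ?thesis by (simp add: cost_def cost_const_def)
qed

text \<open>Each variance is a sum of powers of \<open>P\<close>, of which the largest wins. Noise
  counts as exponent 0: it is hidden in \<open>max (\<alpha> - \<gamma>) \<beta>\<close> because
  \<open>\<beta> \<ge> 0\<close>, but shows in \<open>max 0 (\<alpha> - \<gamma>)\<close>. This is
  the origin of the terms \<open>E1\<close> and \<open>A1\<close> of the polytope.\<close>

lemma costs_le:
  assumes P: "P \<ge> 1" and a: "(cmod a)\<^sup>2 = P powr \<alpha>" and b: "(cmod b)\<^sup>2 = P powr \<beta>" and g: "(cmod g)\<^sup>2 = P powr \<gamma>"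
    and nn: "\<alpha> \<ge> 0" "\<beta> \<ge> 0"
  shows "cost_all a b \<le> cost_const + max \<alpha> \<beta> * ln P"
    and "cost_direct a \<le> cost_const + \<alpha> * ln P"
    and "cost_residual a g \<le> cost_const + max 0 (\<alpha> - \<gamma>) * ln P"
    and "cost_genie a b g \<le> cost_const + max (\<alpha> - \<gamma>) \<beta> * ln P"
proof -
  note np = noise_power_pos
  have q: "(cmod (a / g))\<^sup>2 = P powr (\<alpha> - \<gamma>)"
    by (simp only: norm_divide power_divide a g powr_diff)
  have mono: "P powr x \<le> P powr y" if "x \<le> y" for x y
    using P that by (intro powr_mono) auto
  have one: "1 \<le> P powr y" if "y \<ge> 0" for y
    using mono[OF that] P by simp
  have np1: "noise_power \<le> noise_power * P powr y" if "y \<ge> 0" for y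
    using one[OF that] np by simp
  have np2: "noise_power * P powr x \<le> noise_power * P powr y" if "x \<le> y" for x y
    using mono[OF that] np by simp
  have pp: "0 \<le> P powr y" "0 < P powr y" for y using P by auto
  have npp: "0 \<le> noise_power * P powr y" for y using np pp by simp
  have rhs: "12 * (1 + noise_power) * X = 12 * X + 12 * (noise_power * X)"
    and lhs: "noise_power * (1 + X) = noise_power + noise_power * X" for X
    by (simp_all add: algebra_simps)
  have ar: "3 * (x + y) \<le> 12 * X + 12 * Y" if "x \<le> X" "y \<le> 2 * Y" "0 \<le> X" "0 \<le> Y" for x y X Y :: real
    using that unfolding distrib_left by linarith
  have two: "u + w \<le> 2 * Y" if "u \<le> Y" "w \<le> Y" for u w Y :: real
    using that by linarith
  show "cost_all a b \<le> cost_const + max \<alpha> \<beta> * ln P"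
    unfolding cost_all_def
  proof (rule cost_le[OF P])
    have "P powr \<alpha> \<le> P powr max \<alpha> \<beta>" "P powr \<beta> \<le> P powr max \<alpha> \<beta>" "noise_power \<le> noise_power * P powr max \<alpha> \<beta>"
      using nn by (intro mono np1; simp)+
    then show "3 * (2 * (cmod a)\<^sup>2 + 2 * (cmod b)\<^sup>2 + noise_power) \<le> 12 * (1 + noise_power) * P powr max \<alpha> \<beta>"
      unfolding a b using npp[of "max \<alpha> \<beta>"] by (simp add: algebra_simps)
  qed (use a b np pp in \<open>auto intro: add_nonneg_pos\<close>)
  show "cost_direct a \<le> cost_const + \<alpha> * ln P"
    unfolding cost_direct_def
  proof (rule cost_le[OF P])
    show "3 * ((cmod a)\<^sup>2 + noise_power) \<le> 12 * (1 + noise_power) * P powr \<alpha>"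
      unfolding a rhs using two[OF np1[OF nn(1)] npp[of \<alpha>]]
      by (intro ar pp(1) npp order_refl) simp
  qed (use a np pp in \<open>auto intro: add_nonneg_pos\<close>)
  show "cost_residual a g \<le> cost_const + max 0 (\<alpha> - \<gamma>) * ln P"
    unfolding cost_residual_def
  proof (rule cost_le[OF P])
    have "noise_power + noise_power * P powr (\<alpha> - \<gamma>) \<le> 2 * (noise_power * P powr max 0 (\<alpha> - \<gamma>))"
      by (intro two np1 np2; simp)
    from ar[of 0, OF pp(1) this pp(1) npp]
    show "3 * (noise_power * (1 + (cmod (a / g))\<^sup>2)) \<le> 12 * (1 + noise_power) * P powr max 0 (\<alpha> - \<gamma>)"
      unfolding q rhs lhs add_0 .
    show "3 * (noise_power * (1 + (cmod (a / g))\<^sup>2)) > 0"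
      unfolding q using np pp by (intro mult_pos_pos add_pos_nonneg) auto
  qed
  show "cost_genie a b g \<le> cost_const + max (\<alpha> - \<gamma>) \<beta> * ln P"
    unfolding cost_genie_def
  proof (rule cost_le[OF P])
    have "P powr \<beta> \<le> P powr max (\<alpha> - \<gamma>) \<beta>"
      by (intro mono) simp
    moreover have "noise_power + noise_power * P powr (\<alpha> - \<gamma>) \<le> 2 * (noise_power * P powr max (\<alpha> - \<gamma>) \<beta>)"
      using nn by (intro two np1 np2; simp)
    ultimately show "3 * ((cmod b)\<^sup>2 + noise_power * (1 + (cmod (a / g))\<^sup>2)) \<le> 12 * (1 + noise_power) * P powr max (\<alpha> - \<gamma>) \<beta>"
      unfolding q b rhs lhs by (intro ar pp(1) npp)
    show "3 * ((cmod b)\<^sup>2 + noise_power * (1 + (cmod (a / g))\<^sup>2)) > 0"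
      unfolding q b using np pp by (intro mult_pos_pos add_pos_nonneg add_pos_pos) auto
  qed
qed

lemma dof_le_of_rate_bound:
  assumes lim: "((\<lambda>P. S P / log 2 P) \<longlongrightarrow> s) at_top" and b: "\<And>P. P > 1 \<Longrightarrow> S P * ln 2 \<le> k + e * ln P"
  shows "s \<le> e"
proof (rule tendsto_le[OF trivial_limit_at_top_linorder _ lim])
  have "((\<lambda>P. k / ln P + e) \<longlongrightarrow> 0 + e) at_top"
    by (intro tendsto_add tendsto_const tendsto_divide_0[OF tendsto_const] filterlim_at_top_imp_at_infinity ln_at_top)
  then show "((\<lambda>P. k / ln P + e) \<longlongrightarrow> e) at_top" by simp
  show "\<forall>\<^sub>F P in at_top. S P / log 2 P \<le> k / ln P + e"
    using eventually_gt_at_top[of 1]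
  proof eventually_elim
    case (elim P)
    then have "ln P > 0" by simp
    moreover have "S P / log 2 P = S P * ln 2 / ln P" by (simp add: log_def)
    ultimately show ?case using b[OF elim] by (simp add: field_simps)
  qed
qed

text \<open>The capacity region enters only through \<open>lin\<close>, so that the lemma applies a
  second time with the users exchanged.\<close>

lemma GDoF_region_bounds:
  assumes nn: "a11 \<ge> 0" "a12 \<ge> 0" "a21 \<ge> 0" "a22 \<ge> 0"
    and h: "\<And>P. P > 1 \<Longrightarrow> (cmod (h11 P))\<^sup>2 = P powr a11" "\<And>P. P > 1 \<Longrightarrow> (cmod (h12 P))\<^sup>2 = P powr a12"
      "\<And>P. P > 1 \<Longrightarrow> (cmod (h21 P))\<^sup>2 = P powr a21" "\<And>P. P > 1 \<Longrightarrow> (cmod (h22 P))\<^sup>2 = P powr a22"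
    and lin: "\<And>c0 c1 c2 W P. P > 0 \<Longrightarrow> (\<And>r0 r1 r2. reliable (h11 P) (h12 P) (h21 P) (h22 P) r0 r1 r2 \<Longrightarrow> (c0 * r0 + c1 * r1 + c2 * r2) * ln 2 \<le> W)
      \<Longrightarrow> (c0 * R0 P + c1 * R1 P + c2 * R2 P) * ln 2 \<le> W"
    and lim: "((\<lambda>P. R0 P / log 2 P) \<longlongrightarrow> d0) at_top" "((\<lambda>P. R1 P / log 2 P) \<longlongrightarrow> d1) at_top" "((\<lambda>P. R2 P / log 2 P) \<longlongrightarrow> d2) at_top"
  shows "d0 + d1 \<le> max a11 a12" "d1 \<le> a11" "d1 + d2 \<le> max (a11 - a21) a12 + max (a22 - a12) a21"
    "d0 + d1 + d2 \<le> max 0 (a11 - a21) + max a22 a21"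
    "d0 + 2 * d1 + d2 \<le> max 0 (a11 - a21) + max a11 a12 + max (a22 - a12) a21"
proof -
  let ?rel = "\<lambda>P. reliable (h11 P) (h12 P) (h21 P) (h22 P)"
  have lc: "((\<lambda>P. (c0 * R0 P + c1 * R1 P + c2 * R2 P) / log 2 P) \<longlongrightarrow> c0 * d0 + c1 * d1 + c2 * d2) at_top" for c0 c1 c2
  proof -
    have "((\<lambda>P. c0 * (R0 P / log 2 P) + c1 * (R1 P / log 2 P) + c2 * (R2 P / log 2 P)) \<longlongrightarrow> c0 * d0 + c1 * d1 + c2 * d2) at_top"
      by (intro tendsto_add tendsto_mult tendsto_const lim)
    then show ?thesis by (simp add: add_divide_distrib)
  qed
  have main: "c0 * d0 + c1 * d1 + c2 * d2 \<le> e"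
    if "\<And>P r0 r1 r2. P > 1 \<Longrightarrow> ?rel P r0 r1 r2 \<Longrightarrow> (c0 * r0 + c1 * r1 + c2 * r2) * ln 2 \<le> k + e * ln P"
    for c0 c1 c2 k e
    using that by (intro dof_le_of_rate_bound[OF lc, of _ _ _ k] lin) auto
  have nz: "h12 P \<noteq> 0" "h21 P \<noteq> 0" if "P > 1" for P
    using h(2)[of P] h(3)[of P] that by auto
  note rb = reliable_bounds[OF _ nz]
  note c1 = costs_le[OF less_imp_le h(1) h(2) h(3) nn(1,2)] and c2 = costs_le[OF less_imp_le h(4) h(3) h(2) nn(4,3)]
  have "1 * d0 + 1 * d1 + 0 * d2 \<le> max a11 a12"
  proof (rule main[of _ _ _ cost_const])
    fix P r0 r1 r2 assume P: "P > 1" and "?rel P r0 r1 r2"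
    from rb(1)[OF this(2) P P] show "(1 * r0 + 1 * r1 + 0 * r2) * ln 2 \<le> cost_const + max a11 a12 * ln P"
      using c1(1)[OF P P P P] by simp
  qed
  then show "d0 + d1 \<le> max a11 a12" by simp
  have "0 * d0 + 1 * d1 + 0 * d2 \<le> a11"
  proof (rule main[of _ _ _ cost_const])
    fix P r0 r1 r2 assume P: "P > 1" and "?rel P r0 r1 r2"
    from rb(2)[OF this(2) P P] show "(0 * r0 + 1 * r1 + 0 * r2) * ln 2 \<le> cost_const + a11 * ln P"
      using c1(2)[OF P P P P] by simp
  qed
  then show "d1 \<le> a11" by simp
  have "0 * d0 + 1 * d1 + 1 * d2 \<le> max (a11 - a21) a12 + max (a22 - a12) a21"
  proof (rule main[of _ _ _ "2 * cost_const"])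
    fix P r0 r1 r2 assume P: "P > 1" and "?rel P r0 r1 r2"
    from rb(3)[OF this(2) P P] show "(0 * r0 + 1 * r1 + 1 * r2) * ln 2 \<le> 2 * cost_const + (max (a11 - a21) a12 + max (a22 - a12) a21) * ln P"
      using c1(4)[OF P P P P] c2(4)[OF P P P P] unfolding distrib_right[of _ _ "ln P"] by simp
  qed
  then show "d1 + d2 \<le> max (a11 - a21) a12 + max (a22 - a12) a21" by simp
  have "1 * d0 + 1 * d1 + 1 * d2 \<le> max 0 (a11 - a21) + max a22 a21"
  proof (rule main[of _ _ _ "2 * cost_const"])
    fix P r0 r1 r2 assume P: "P > 1" and "?rel P r0 r1 r2"
    from rb(4)[OF this(2) P P] show "(1 * r0 + 1 * r1 + 1 * r2) * ln 2 \<le> 2 * cost_const + (max 0 (a11 - a21) + max a22 a21) * ln P"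
      using c1(3)[OF P P P P] c2(1)[OF P P P P] unfolding distrib_right[of _ _ "ln P"] by simp
  qed
  then show "d0 + d1 + d2 \<le> max 0 (a11 - a21) + max a22 a21" by simp
  have "1 * d0 + 2 * d1 + 1 * d2 \<le> max 0 (a11 - a21) + max a11 a12 + max (a22 - a12) a21"
  proof (rule main[of _ _ _ "3 * cost_const"])
    fix P r0 r1 r2 assume P: "P > 1" and "?rel P r0 r1 r2"
    from rb(5)[OF this(2) P P] show "(1 * r0 + 2 * r1 + 1 * r2) * ln 2 \<le> 3 * cost_const + (max 0 (a11 - a21) + max a11 a12 + max (a22 - a12) a21) * ln P"
      using c1(1)[OF P P P P] c1(3)[OF P P P P] c2(4)[OF P P P P] unfolding distrib_right[of _ _ "ln P"] by simp
  qed
  then show "d0 + 2 * d1 + d2 \<le> max 0 (a11 - a21) + max a11 a12 + max (a22 - a12) a21" by simp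
qed

lemma GDoF_region_subset_formula:
  assumes nn: "a11 \<ge> 0" "a12 \<ge> 0" "a21 \<ge> 0" "a22 \<ge> 0"
  shows "GDoF_region a11 a12 a21 a22 \<subseteq> GDoF_formula a11 a12 a21 a22"
proof
  fix d assume "d \<in> GDoF_region a11 a12 a21 a22"
  then obtain d0 d1 d2 where d: "d = (d0, d1, d2)" and mem: "(d0, d1, d2) \<in> GDoF_region a11 a12 a21 a22"
    by (cases d) auto
  \<comment> \<open>Membership in the region concerns all channels of the given strengths; for the
    converse one of them suffices, and real coefficients are the simplest.\<close>
  define g where "g e P = complex_of_real (P powr (e / 2))" for e P
  have g: "(cmod (g e P))\<^sup>2 = P powr e" for e P
    by (simp only: g_def norm_of_real power2_abs powr_half_square)
  have d_nn: "d0 \<ge> 0" "d1 \<ge> 0" "d2 \<ge> 0"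
    and "\<exists>R0 R1 R2. (\<forall>P>0. (R0 P, R1 P, R2 P) \<in> capacity_region (g a11 P) (g a12 P) (g a21 P) (g a22 P)) \<and>
      ((\<lambda>P. R0 P / log 2 P) \<longlongrightarrow> d0) at_top \<and> ((\<lambda>P. R1 P / log 2 P) \<longlongrightarrow> d1) at_top \<and> ((\<lambda>P. R2 P / log 2 P) \<longlongrightarrow> d2) at_top"
    using mem g unfolding GDoF_region_def by auto
  then obtain R0 R1 R2 where cap: "\<And>P. P > 0 \<Longrightarrow> (R0 P, R1 P, R2 P) \<in> capacity_region (g a11 P) (g a12 P) (g a21 P) (g a22 P)"
    and lim: "((\<lambda>P. R0 P / log 2 P) \<longlongrightarrow> d0) at_top" "((\<lambda>P. R1 P / log 2 P) \<longlongrightarrow> d1) at_top" "((\<lambda>P. R2 P / log 2 P) \<longlongrightarrow> d2) at_top"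
    by blast
  have lin: "(c0 * R0 P + c1 * R1 P + c2 * R2 P) * ln 2 \<le> W"
    if "P > 0" "\<And>r0 r1 r2. reliable (g a11 P) (g a12 P) (g a21 P) (g a22 P) r0 r1 r2 \<Longrightarrow> (c0 * r0 + c1 * r1 + c2 * r2) * ln 2 \<le> W"
    for c0 c1 c2 W P
    by (rule capacity_region_linear_bound[OF that(2) cap[OF that(1)]])
  have lin': "(c0 * R0 P + c1 * R2 P + c2 * R1 P) * ln 2 \<le> W"
    if "P > 0" "\<And>r0 r1 r2. reliable (g a22 P) (g a21 P) (g a12 P) (g a11 P) r0 r1 r2 \<Longrightarrow> (c0 * r0 + c1 * r1 + c2 * r2) * ln 2 \<le> W"
    for c0 c1 c2 W P
  proof -
    have "(c0 * R0 P + c2 * R1 P + c1 * R2 P) * ln 2 \<le> W"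
    proof (rule lin[OF that(1)])
      fix r0 r1 r2 assume "reliable (g a11 P) (g a12 P) (g a21 P) (g a22 P) r0 r1 r2"
      from that(2)[OF reliable_swap[OF this]] show "(c0 * r0 + c2 * r1 + c1 * r2) * ln 2 \<le> W"
        by (simp add: algebra_simps)
    qed
    then show ?thesis by (simp add: algebra_simps)
  qed
  \<comment> \<open>Five bounds and their mirror images, with the one on \<open>d1 + d2\<close>
    occurring twice, are the nine facets.\<close>
  note b1 = GDoF_region_bounds[OF nn g g g g lin lim]
    and b2 = GDoF_region_bounds[OF nn(4,3,2,1) g g g g lin' lim(1,3,2)]
  show "d \<in> GDoF_formula a11 a12 a21 a22"
    unfolding d GDoF_formula_def Let_def pos_part_def using d_nn b1 b2 by (simp add: algebra_simps)
qed

theorem theorem5: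
  fixes a11 a12 a21 a22 :: real
  assumes "a11 \<ge> 0" "a12 \<ge> 0" "a21 \<ge> 0" "a22 \<ge> 0"
  shows "GDoF_region a11 a12 a21 a22 = GDoF_formula a11 a12 a21 a22"
  using GDoF_region_subset_formula[OF assms] GDoF_formula_subset_region[OF assms]
  by (rule equalityI)

end
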